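(* Let $\varphi:U_q(\hat{\mathfrak g})\to\mathrm{End}(V)$ and $\psi:U_q(\hat{\mathfrak g})\to\mathrm{End}(W)$ be two finite-dimensional representations. Then both power series $(\varphi\otimes\psi)(\mathbf R^{\pm}(z))$ are Taylor expansions at $z=0$ of $\mathrm{End}(V\otimes W)$-valued rational functions of $z$. Moreover, any pole of the rational functions $(\varphi\otimes\psi)(\mathbf R^-(z))$ and $(\varphi\otimes\psi)(\mathbf R^+(z^{-1}))$ is necessarily the ratio of a pole of the rational function $\varphi(x_i^-(z)_{>0})$ to a pole of the rational function $\psi(x_i^+(z)_{\ge0})$ for a certain $i\in I$.
   Context: **Lie algebra data.** $\mathbb N=\mathbb Z_{\ge0}$. $\mathfrak g$ is a finite-dimensional simple complex Lie algebra of rank $r$, $I=\{1,\dots,r\}$, simple roots $\alpha_i$, invariant form $(\,,)$ on $\mathfrak h^*$ normalized so that $d_i=(\alpha_i,\alpha_i)/2$ are coprime positive integers in $\{1,2,3\}$; $c_{ij}=2(\alpha_i,\alpha_j)/(\alpha_i,\alpha_i)$, $b_{ij}=(\alpha_i,\alpha_j)$. $\mathbf Q=\bigoplus_i\mathbb Z\alpha_i$, $\mathbf Q_+=\sum_i\mathbb N\alpha_i$; $\Phi_{0,+}$ is the set of positive roots. $q\in\mathbb C^\times$ is not a root of unity, $q_i=q^{d_i}$, $[t]_q=(q^t-q^{-t})/(q-q^{-1})$, ${t\brack n}_q=\prod_{m=1}^n[t-m+1]_q/[m]_q$. **Quantum affine algebra $U_q(\hat{\mathfrak g})$** (zero central charge,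 no derivation). Let $\theta=\sum_i a_i\alpha_i$ be the highest root; extend the Cartan matrix by $c_{00}=2$, $c_{i0}=-2(\alpha_i,\theta)/(\alpha_i,\alpha_i)$, $c_{0i}=-2(\theta,\alpha_i)/(\theta,\theta)$; $q_0=q^{(\theta,\theta)/2}$. Drinfeld–Jimbo presentation: generators $E_i,F_i,K_i^{\pm1}$ ($0\le i\le r$), relations: the $K_i$ are invertible and commute, $K_0K_1^{a_1}\cdots K_r^{a_r}=1$, $K_iE_j=q_i^{c_{ij}}E_jK_i$, $K_iF_j=q_i^{-c_{ij}}F_jK_i$, $[E_i,F_j]=\delta_{ij}(K_i-K_i^{-1})/(q_i-q_i^{-1})$, and for $i\ne j$ the Serre relations $\sum_{s=0}^{1-c_{ij}}(-1)^s{1-c_{ij}\brack s}_{q_i}E_i^{1-c_{ij}-s}E_jE_i^s=0$ and the same for $F$. Coproduct: $\Delta(E_i)=E_i\otimes1+K_i\otimes E_i$, $\Delta(F_i)=1\otimes F_i+F_i\otimes K_i^{-1}$, $\Delta(K_i)=K_i\otimes K_i$. Drinfeld presentation (identified with the former by Beck's isomorphism, under which $E_i=x_{i,0}^+$, $F_i=x_{i,0}^-$, $K_i=\phi_{i,0}^+$ for $1\le i\le r$): generators $x_{i,m}^\pm,\phi_{i,m}^\pm$ ($i\in I,m\in\mathbb Z$), relations: $\phi_{i,m}^+=0$ for $m<0$, $\phi_{i,m}^-=0$ for $m>0$, $\phi_{i,0}^+\phi_{i,0}^-=1$, the $\phi$'s commute, $[x_{i,m}^+,x_{j,n}^-]=\delta_{ij}(\phi_{i,m+n}^+-\phi_{i,m+n}^-)/(q_i-q_i^{-1})$,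 $\phi_{i,m+1}^\varepsilon x_{j,n}^\pm-q^{\pm b_{ij}}\phi_{i,m}^\varepsilon x_{j,n+1}^\pm=q^{\pm b_{ij}}x_{j,n}^\pm\phi_{i,m+1}^\varepsilon-x_{j,n+1}^\pm\phi_{i,m}^\varepsilon$ ($\varepsilon=\pm$), $x_{i,m+1}^\pm x_{j,n}^\pm-q^{\pm b_{ij}}x_{i,m}^\pm x_{j,n+1}^\pm=q^{\pm b_{ij}}x_{j,n}^\pm x_{i,m+1}^\pm-x_{j,n+1}^\pm x_{i,m}^\pm$, and for $i\neq j$ $\sum_{s=0}^{1-c_{ij}}(-1)^s{1-c_{ij}\brack s}_{q_i}(x_{i,0}^\pm)^{1-c_{ij}-s}x_{j,0}^\pm(x_{i,0}^\pm)^s=0$. Weight grading by $\mathbf Q$: $x_{i,m}^\pm$ has weight $\pm\alpha_i$, $\phi_{i,m}^\pm$ weight $0$; a subscript $\beta$ denotes the weight-$\beta$ subspace. $\mathbb Z$-grading: $\deg x_{i,m}^\pm=\deg\phi_{i,m}^\pm=m$; equivalently $\deg E_0=1$, $\deg F_0=-1$, and the other Drinfeld–Jimbo generators have degree $0$. $\tau_z,\tau_{z^{-1}}:U_q(\hat{\mathfrak g})\to U_q(\hat{\mathfrak g})[z,z^{-1}]$ are the algebra maps $x\mapsto z^{\deg x}x$, resp. $x\mapsto z^{-\deg x}x$, for $x$ homogeneous. $U_q^\pm(\hat{\mathfrak g})$, $U_q^0(\hat{\mathfrak g})$, $U_q^{\ge}(\hat{\mathfrak g})$, $U_q^{\le}(\hat{\mathfrak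 g})$ are the subalgebras generated respectively by the $x_{i,m}^\pm$; the $\phi_{i,m}^\pm$; the $x_{i,m}^+,\phi_{i,m}^\pm$; the $x_{i,m}^-,\phi_{i,m}^\pm$. Series: $x_i^\pm(u)=\sum_{m\in\mathbb Z}x_{i,m}^\pm u^m$, $\phi_i^\pm(u)=\sum_m\phi_{i,m}^\pm u^m$, and $h_{i,s}\in U_q^0(\hat{\mathfrak g})$ ($s\neq0$) are defined by $\phi_i^\pm(u)=\phi_{i,0}^\pm\exp(\pm(q-q^{-1})\sum_{\pm s>0}h_{i,s}u^s)$. **0-completed tensor product.** For $\mathbf Q$-graded algebras $\mathbb A,\mathbb B$: $\mathbb A\,\overline\otimes\,\mathbb B=\prod_{\beta\in\mathbf Q_+}\mathbb A_{-\beta}\otimes\mathbb B_\beta$, with its natural algebra structure. **Unitriangular R-matrices $\mathbf R^\pm(z)$.** They are the unitriangular factors in the Gauss decomposition $(\tau_z\otimes\mathrm{Id})(R_{\hat{\mathfrak g}})=\mathbf R_{21}^+(z)\times R^0(z)q^{-t_\infty}\times\mathbf R^-(z)$ of the universal R-matrix of $U_q(\hat{\mathfrak g})$ (subscript $21$ = flip of tensor factors; $t_\infty$ = canonical element of the form on $\mathfrak h$; $R^0(z)$ lies in a completion of $U_q^0(\hat{\mathfrak g})^{\otimes2}$). Explicitly (Khoroshkin–Tolstoy, Damiani), with $E_{n\delta\pm\beta},F_{n\delta\pm\beta}$ the real affine root vectors attached to Damiani's convex order, $q_\beta=q^{(\beta,\beta)/2}$ and $\exp_q(x)=\sum_{m\ge0}x^m/\prod_{k=1}^m\frac{q^{2k}-1}{q^2-1}$,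 $\mathbf R^-(z)=\prod^{\succ}_{(n,\beta)\in\mathbb Z_{>0}\times\Phi_{0,+}}\exp_{q_\beta}((q_\beta^{-1}-q_\beta)K_\beta E_{n\delta-\beta}\otimes F_{n\delta-\beta}K_\beta^{-1}z^n)$ and $\mathbf R^+(z)=\prod^{\succ}_{(n,\beta)\in\mathbb Z_{\ge0}\times\Phi_{0,+}}\exp_{q_\beta}((q_\beta^{-1}-q_\beta)F_{n\delta+\beta}\otimes E_{n\delta+\beta}z^n)$. They have the following known properties, which characterize them and may be taken as their definition: (U1) $\mathbf R^\pm(z)=\sum_{\beta\in\mathbf Q_+}\mathbf R_\beta^\pm(z)$ with $\mathbf R_\beta^\pm(z)\in(U_q^-(\hat{\mathfrak g})_{-\beta}\otimes U_q^+(\hat{\mathfrak g})_\beta)[[z]]$ and $\mathbf R_0^\pm(z)=1\otimes1$. (U2) For $i\in I$, $s\in\mathbb Z_{\ne0}$ (Laurent series in $z$ with coefficients in $U_q^{\le}(\hat{\mathfrak g})\,\overline\otimes\,U_q^{\ge}(\hat{\mathfrak g})$): $(h_{i,s}\otimes z^s+1\otimes h_{i,s})\mathbf R^-(z)=\mathbf R^-(z)\,(\tau_z\otimes\mathrm{Id})\Delta(h_{i,s})$; $\mathbf R^+(z)(h_{i,s}\otimes1+z^s\otimes h_{i,s})=(\mathrm{Id}\otimes\tau_z)\Delta(h_{i,s})\,\mathbf R^+(z)$; $(h_{i,s}\otimes1+z^{-s}\otimes h_{i,s})\mathbf R^-(z)=\mathbf R^-(z)\,(\mathrm{Id}\otimes\tau_{z^{-1}})\Delta(h_{i,s})$;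 $\mathbf R^+(z)(h_{i,s}\otimes z^{-s}+1\otimes h_{i,s})=(\tau_{z^{-1}}\otimes\mathrm{Id})\Delta(h_{i,s})\,\mathbf R^+(z)$. **Evaluation.** For finite-dimensional $\varphi,\psi$, only finitely many components $(\varphi\otimes\psi)(\mathbf R^\pm_\beta(z))$ are nonzero, so $(\varphi\otimes\psi)(\mathbf R^\pm(z))\in\mathrm{End}(V\otimes W)[[z]]$. **Truncated series.** For a formal series $f(z)=\sum_{n\in\mathbb Z}f_nz^n$, $f(z)_{\ge0}=\sum_{n\ge0}f_nz^n$ and $f(z)_{>0}=\sum_{n>0}f_nz^n$. It is well known that for finite-dimensional representations the series $\varphi(x_i^-(z)_{>0})$ and $\psi(x_i^+(z)_{\ge0})$ are expansions at $z=0$ of rational functions of $z$ with values in $\mathrm{End}(V)$, resp. $\mathrm{End}(W)$; the claim refers to the poles of these rational functions. *)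

theory Defs
  imports
    "HOL-Complex_Analysis.Complex_Analysis"
    "HOL-Library.Poly_Mapping"
    "HOL-Library.Multiset"
begin

(* "$" is reserved for vector and matrix entries *)
no_notation fps_nth (infixl "$" 75)

section \<open>Unital complex algebras\<close>

class complex_algebra_1 = ring_1 +
  fixes scaleC :: "complex \<Rightarrow> 'a \<Rightarrow> 'a" (infixr "*\<^sub>C" 75)
  assumes scaleC_add_right: "c *\<^sub>C (x + y) = c *\<^sub>C x + c *\<^sub>C y"
    and scaleC_add_left: "(c + e) *\<^sub>C x = c *\<^sub>C x + e *\<^sub>C x"
    and scaleC_scaleC: "c *\<^sub>C e *\<^sub>C x = (c * e) *\<^sub>C x"
    and scaleC_one: "1 *\<^sub>C x = x"
    and mult_scaleC_left: "(c *\<^sub>C x) * y = c *\<^sub>C (x * y)"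
    and mult_scaleC_right: "x * (c *\<^sub>C y) = c *\<^sub>C (x * y)"

lemma vector_space_scaleC:
  "vector_space (scaleC :: complex \<Rightarrow> 'a \<Rightarrow> 'a::complex_algebra_1)"
  by unfold_locales (simp_all add: scaleC_add_right scaleC_add_left scaleC_scaleC scaleC_one)

lemma scaleC_zero_left: "0 *\<^sub>C (x::'a::complex_algebra_1) = 0"
  using scaleC_add_left[of 0 0 x] by simp

lemma scaleC_zero_right: "c *\<^sub>C (0::'a::complex_algebra_1) = 0"
  using scaleC_add_right[of c 0 0] by simp

lemma scaleC_minus_right: "c *\<^sub>C (- x) = - (c *\<^sub>C (x::'a::complex_algebra_1))"
  using scaleC_add_right[of c "- x" x] by (simp add: scaleC_zero_right eq_neg_iff_add_eq_0)

instantiation complex :: complex_algebra_1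
begin
definition scaleC_complex :: "complex \<Rightarrow> complex \<Rightarrow> complex"
  where "scaleC_complex = (*)"
instance by standard (simp_all add: scaleC_complex_def algebra_simps)
end

abbreviation cspan :: "'a::complex_algebra_1 set \<Rightarrow> 'a set"
  where "cspan \<equiv> module.span scaleC"

definition algebra_hom :: "('a::complex_algebra_1 \<Rightarrow> 'b::complex_algebra_1) \<Rightarrow> bool"
  where "algebra_hom f \<longleftrightarrow>
    f 1 = 1 \<and> (\<forall>x y. f (x + y) = f x + f y) \<and> (\<forall>x y. f (x * y) = f x * f y) \<and>
    (\<forall>c x. f (c *\<^sub>C x) = c *\<^sub>C f x)"

inductive_set subalgebra_generated :: "'a::complex_algebra_1 set \<Rightarrow> 'a set"
  for S :: "'a set" where
  gen: "x \<in> S \<Longrightarrow> x \<in> subalgebra_generated S"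
| one: "1 \<in> subalgebra_generated S"
| add: "x \<in> subalgebra_generated S \<Longrightarrow> y \<in> subalgebra_generated S \<Longrightarrow>
    x + y \<in> subalgebra_generated S"
| mult: "x \<in> subalgebra_generated S \<Longrightarrow> y \<in> subalgebra_generated S \<Longrightarrow>
    x * y \<in> subalgebra_generated S"
| scale: "x \<in> subalgebra_generated S \<Longrightarrow> c *\<^sub>C x \<in> subalgebra_generated S"

inductive_set ideal_generated :: "'a::ring_1 set \<Rightarrow> 'a set"
  for S :: "'a set" where
  zero: "0 \<in> ideal_generated S"
| gen: "x \<in> S \<Longrightarrow> a * x * b \<in> ideal_generated S"
| add: "x \<in> ideal_generated S \<Longrightarrow> y \<in> ideal_generated S \<Longrightarrow> x + y \<in> ideal_generated S"


section \<open>Presentations by generators and relations\<close>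

datatype 'g word = Word (letters: "'g list")

instantiation word :: (type) monoid_add
begin
definition zero_word :: "'g word" where "zero_word = Word []"
definition plus_word :: "'g word \<Rightarrow> 'g word \<Rightarrow> 'g word"
  where "plus_word u v = Word (letters u @ letters v)"
instance by standard (simp_all add: zero_word_def plus_word_def)
end

text \<open>
  The monoid algebra of the free monoid is the free associative algebra (noncommutative
  polynomials) on \<^typ>\<open>'g\<close>; the product of \<^typ>\<open>'g word \<Rightarrow>\<^sub>0 complex\<close> is convolution along
  concatenation of words.
\<close>

type_synonym 'g free_algebra = "'g word \<Rightarrow>\<^sub>0 complex"

lemma poly_mapping_single_zero_commute:
  fixes p :: "'a::monoid_add \<Rightarrow>\<^sub>0 'b::complex_algebra_1"
  shows "Poly_Mapping.single 0 (c *\<^sub>C 1) * p = p * Poly_Mapping.single 0 (c *\<^sub>C 1)"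
proof -
  have p: "p = (\<Sum>k\<in>Poly_Mapping.keys p. Poly_Mapping.single k (Poly_Mapping.lookup p k))"
    by (rule poly_mapping_eqI) (simp add: lookup_sum lookup_single when_def in_keys_iff)
  show ?thesis
    by (subst (1 2) p)
      (simp add: sum_distrib_left sum_distrib_right mult_single mult_scaleC_left mult_scaleC_right)
qed

instantiation poly_mapping :: (monoid_add, complex_algebra_1) complex_algebra_1
begin
definition scaleC_poly_mapping :: "complex \<Rightarrow> ('a \<Rightarrow>\<^sub>0 'b) \<Rightarrow> 'a \<Rightarrow>\<^sub>0 'b"
  where "scaleC_poly_mapping c p = Poly_Mapping.single 0 (c *\<^sub>C 1) * p"
instance
proof
  fix c e :: complex and x y :: "'a \<Rightarrow>\<^sub>0 'b"
  show "c *\<^sub>C (x + y) = c *\<^sub>C x + c *\<^sub>C y"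
    by (simp add: scaleC_poly_mapping_def distrib_left)
  show "(c + e) *\<^sub>C x = c *\<^sub>C x + e *\<^sub>C x"
    by (simp add: scaleC_poly_mapping_def scaleC_add_left single_add distrib_right)
  show "c *\<^sub>C e *\<^sub>C x = (c * e) *\<^sub>C x"
    by (simp add: scaleC_poly_mapping_def mult_single mult_scaleC_left scaleC_scaleC
        flip: mult.assoc)
  show "1 *\<^sub>C x = x"
    by (simp add: scaleC_poly_mapping_def scaleC_one)
  show "(c *\<^sub>C x) * y = c *\<^sub>C (x * y)"
    by (simp add: scaleC_poly_mapping_def mult.assoc)
  show "x * (c *\<^sub>C y) = c *\<^sub>C (x * y)"
    unfolding scaleC_poly_mapping_def
    by (metis mult.assoc poly_mapping_single_zero_commute)
qed
end

definition free_var :: "'g \<Rightarrow> 'g free_algebra"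
  where "free_var g = Poly_Mapping.single (Word [g]) 1"

definition free_eval :: "('g \<Rightarrow> 'a::complex_algebra_1) \<Rightarrow> 'g free_algebra \<Rightarrow> 'a"
  where "free_eval g p =
    (\<Sum>w\<in>Poly_Mapping.keys p. Poly_Mapping.lookup p w *\<^sub>C prod_list (map g (letters w)))"

text \<open>The algebra \<^typ>\<open>'a\<close>, with generators \<open>g\<close>, is the free algebra modulo the relators \<open>R\<close>.\<close>

definition presented_by ::
    "('g \<Rightarrow> 'a::complex_algebra_1) \<Rightarrow> 'g free_algebra set \<Rightarrow> bool"
  where "presented_by g R \<longleftrightarrow>
    surj (free_eval g) \<and> {p. free_eval g p = 0} = ideal_generated R"


section \<open>Tensor products of algebras\<close>

text \<open>
  Finite formal sums of pairs modulo the bilinear relations. The multiset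
  \<open>{#(a, b), (a', b'), \<dots>#}\<close> stands for \<open>a \<otimes> b + a' \<otimes> b' + \<dots>\<close>.
\<close>

inductive tensor_eq ::
    "('a::complex_algebra_1 \<times> 'b::complex_algebra_1) multiset \<Rightarrow> ('a \<times> 'b) multiset \<Rightarrow> bool"
  where
  refl: "tensor_eq M M"
| sym: "tensor_eq M N \<Longrightarrow> tensor_eq N M"
| trans: "tensor_eq M N \<Longrightarrow> tensor_eq N P \<Longrightarrow> tensor_eq M P"
| cong: "tensor_eq M N \<Longrightarrow> tensor_eq (M + P) (N + P)"
| zero: "tensor_eq {#(0, b)#} {#}"
| add_left: "tensor_eq {#(a + a', b)#} {#(a, b), (a', b)#}"
| add_right: "tensor_eq {#(a, b + b')#} {#(a, b), (a, b')#}"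
| scale: "tensor_eq {#(c *\<^sub>C a, b)#} {#(a, c *\<^sub>C b)#}"

lemma tensor_eq_add:
  "tensor_eq M N \<Longrightarrow> tensor_eq M' N' \<Longrightarrow> tensor_eq (M + M') (N + N')"
  by (metis add.commute tensor_eq.cong tensor_eq.trans)

quotient_type (overloaded) ('a, 'b) tensor =
  "('a::complex_algebra_1 \<times> 'b::complex_algebra_1) multiset" / tensor_eq
proof (rule equivpI)
  show "reflp (tensor_eq :: ('a \<times> 'b) multiset \<Rightarrow> _)"
    by (auto intro: reflpI tensor_eq.refl)
  show "symp (tensor_eq :: ('a \<times> 'b) multiset \<Rightarrow> _)"
    by (auto intro: sympI tensor_eq.sym)
  show "transp (tensor_eq :: ('a \<times> 'b) multiset \<Rightarrow> _)"
    by (auto intro: transpI tensor_eq.trans)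
qed

definition tensor_mult_rep ::
    "('a::complex_algebra_1 \<times> 'b::complex_algebra_1) multiset \<Rightarrow> ('a \<times> 'b) multiset \<Rightarrow>
      ('a \<times> 'b) multiset"
  where "tensor_mult_rep M N =
    (\<Sum>(a, b)\<in>#M. image_mset (\<lambda>(a', b'). (a * a', b * b')) N)"

lemma tensor_mult_rep_simps [simp]:
  "tensor_mult_rep {#} N = {#}"
  "tensor_mult_rep M {#} = {#}"
  "tensor_mult_rep (M + M') N = tensor_mult_rep M N + tensor_mult_rep M' N"
  "tensor_mult_rep M (N + N') = tensor_mult_rep M N + tensor_mult_rep M N'"
  "tensor_mult_rep (add_mset (a, b) M) N =
     image_mset (\<lambda>(a', b'). (a * a', b * b')) N + tensor_mult_rep M N"
  "tensor_mult_rep M (add_mset (a, b) N) =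
     image_mset (\<lambda>(a', b'). (a' * a, b' * b)) M + tensor_mult_rep M N"
proof -
  show "tensor_mult_rep M {#} = {#}"
    by (induction M) (auto simp: tensor_mult_rep_def)
  show "tensor_mult_rep M (N + N') = tensor_mult_rep M N + tensor_mult_rep M N'"
    by (induction M) (auto simp: tensor_mult_rep_def)
  show "tensor_mult_rep M (add_mset (a, b) N) =
     image_mset (\<lambda>(a', b'). (a' * a, b' * b)) M + tensor_mult_rep M N"
    by (induction M) (auto simp: tensor_mult_rep_def)
qed (auto simp: tensor_mult_rep_def)

lemma tensor_eq_mult_right:
  "tensor_eq M N \<Longrightarrow> tensor_eq (tensor_mult_rep M P) (tensor_mult_rep N P)"
proof (induction P)
  case (add x P)
  obtain u v where x: "x = (u, v)" by (cases x)
  have "tensor_eq (image_mset (\<lambda>(a', b'). (a' * u, b' * v)) M)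
      (image_mset (\<lambda>(a', b'). (a' * u, b' * v)) N)"
    using add.prems
  proof (induction rule: tensor_eq.induct)
    case (zero b)
    show ?case by (simp add: tensor_eq.zero)
  next
    case (add_left a a' b)
    show ?case by (simp add: distrib_right tensor_eq.add_left)
  next
    case (add_right a b b')
    show ?case by (simp add: distrib_right tensor_eq.add_right)
  next
    case (scale c a b)
    show ?case by (simp add: mult_scaleC_left tensor_eq.scale)
  next
    case (trans M N P)
    then show ?case by (blast intro: tensor_eq.trans)
  qed (simp_all add: tensor_eq.refl tensor_eq.sym tensor_eq.cong)
  with add show ?case by (simp add: x tensor_eq_add)
qed (simp add: tensor_eq.refl)

lemma tensor_eq_mult_left:
  "tensor_eq M N \<Longrightarrow> tensor_eq (tensor_mult_rep P M) (tensor_mult_rep P N)"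
proof (induction P)
  case (add x P)
  obtain u v where x: "x = (u, v)" by (cases x)
  have "tensor_eq (image_mset (\<lambda>(a', b'). (u * a', v * b')) M)
      (image_mset (\<lambda>(a', b'). (u * a', v * b')) N)"
    using add.prems
  proof (induction rule: tensor_eq.induct)
    case (zero b)
    show ?case by (simp add: tensor_eq.zero)
  next
    case (add_left a a' b)
    show ?case by (simp add: distrib_left tensor_eq.add_left)
  next
    case (add_right a b b')
    show ?case by (simp add: distrib_left tensor_eq.add_right)
  next
    case (scale c a b)
    show ?case by (simp add: mult_scaleC_right tensor_eq.scale)
  next
    case (trans M N P)
    then show ?case by (blast intro: tensor_eq.trans)
  qed (simp_all add: tensor_eq.refl tensor_eq.sym tensor_eq.cong)
  with add show ?case by (simp add: x tensor_eq_add)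
qed (simp add: tensor_eq.refl)

lemma tensor_eq_map_left:
  assumes add: "\<And>x y. f (x + y) = f x + f y" and scale: "\<And>c x. f (c *\<^sub>C x) = c *\<^sub>C f x"
  shows "tensor_eq M N \<Longrightarrow>
    tensor_eq (image_mset (\<lambda>(a, b). (f a, b)) M) (image_mset (\<lambda>(a, b). (f a, b)) N)"
proof (induction rule: tensor_eq.induct)
  case (zero b)
  have "f 0 = 0" using add[of 0 0] by simp
  then show ?case by (simp add: tensor_eq.zero)
next
  case (trans M N P)
  then show ?case by (blast intro: tensor_eq.trans)
qed (simp_all add: assms tensor_eq.refl tensor_eq.sym tensor_eq.cong tensor_eq.add_left
    tensor_eq.add_right tensor_eq.scale)

lemma tensor_mult_rep_assoc:
  "tensor_mult_rep (tensor_mult_rep M N) P = tensor_mult_rep M (tensor_mult_rep N P)"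
proof (induction M)
  case (add x M)
  obtain a b where x: "x = (a, b)" by (cases x)
  have "tensor_mult_rep (image_mset (\<lambda>(a', b'). (a * a', b * b')) N) P =
      image_mset (\<lambda>(a', b'). (a * a', b * b')) (tensor_mult_rep N P)"
    by (induction N) (auto simp: image_mset.compositionality o_def case_prod_unfold mult.assoc)
  with add show ?case by (simp add: x)
qed simp

lemma tensor_eq_neg: "tensor_eq (image_mset (\<lambda>(a, b). (- a, b)) M + M) {#}"
proof (induction M)
  case (add x M)
  obtain a b where x: "x = (a, b)" by (cases x)
  have "tensor_eq {#(- a, b), (a, b)#} {#(- a + a, b)#}"
    by (rule tensor_eq.sym[OF tensor_eq.add_left])
  then have "tensor_eq {#(- a, b), (a, b)#} {#}"
    using tensor_eq.trans tensor_eq.zero by fastforce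
  from tensor_eq_add[OF this add.IH] show ?case
    by (simp add: x add_mset_commute)
qed (simp add: tensor_eq.refl)

text \<open>
  Evaluation of a bilinear map \<open>f\<close> on a tensor; for bilinear \<open>f\<close> this does not depend on the
  chosen representative (lemma \<open>tensor_eq_bilinear\<close>).
\<close>

definition tensor_lift ::
    "('a::complex_algebra_1 \<Rightarrow> 'b::complex_algebra_1 \<Rightarrow> 'c::comm_monoid_add) \<Rightarrow>
      ('a, 'b) tensor \<Rightarrow> 'c"
  where "tensor_lift f T = (\<Sum>(a, b)\<in>#rep_tensor T. f a b)"

lemma tensor_eq_bilinear:
  fixes f :: "'a::complex_algebra_1 \<Rightarrow> 'b::complex_algebra_1 \<Rightarrow> 'c::ab_group_add"
  assumes "\<And>a a' b. f (a + a') b = f a b + f a' b"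
    and "\<And>a b b'. f a (b + b') = f a b + f a b'"
    and "\<And>c a b. f (c *\<^sub>C a) b = f a (c *\<^sub>C b)"
  shows "tensor_eq M N \<Longrightarrow> (\<Sum>(a, b)\<in>#M. f a b) = (\<Sum>(a, b)\<in>#N. f a b)"
proof (induction rule: tensor_eq.induct)
  case (zero b)
  have "f 0 b = 0" using assms(1)[of 0 0 b] by simp
  then show ?case by simp
qed (auto simp: assms)

lemma ex_linear_functional_one:
  "\<exists>f :: 'a::complex_algebra_1 \<Rightarrow> complex.
     (\<forall>x y. f (x + y) = f x + f y) \<and> (\<forall>c x. f (c *\<^sub>C x) = c * f x) \<and> f 1 = 1"
proof -
  interpret vs: vector_space_pair "scaleC :: complex \<Rightarrow> 'a \<Rightarrow> 'a" "(*) :: complex \<Rightarrow> complex \<Rightarrow> complex"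
    by (intro vector_space_pair.intro vector_space_scaleC)
      (unfold_locales, simp_all add: algebra_simps)
  have ind: "vs.vs1.independent {1 :: 'a}"
    using vs.vs1.dependent_single by simp
  let ?f = "vs.construct {1 :: 'a} (\<lambda>_. 1)"
  have "Vector_Spaces.linear scaleC (*) ?f" by (rule vs.linear_construct[OF ind])
  then interpret l: Vector_Spaces.linear "scaleC :: complex \<Rightarrow> 'a \<Rightarrow> 'a" "(*)" ?f .
  have "?f 1 = 1" by (rule vs.construct_basis[OF ind]) simp
  with l.add l.scale show ?thesis by blast
qed

instantiation tensor :: (complex_algebra_1, complex_algebra_1) complex_algebra_1
begin

lift_definition zero_tensor :: "('a, 'b) tensor" is "{#}" .

lift_definition one_tensor :: "('a, 'b) tensor" is "{#(1, 1)#}" .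

lift_definition plus_tensor :: "('a, 'b) tensor \<Rightarrow> ('a, 'b) tensor \<Rightarrow> ('a, 'b) tensor"
  is "(+)" by (rule tensor_eq_add)

lift_definition uminus_tensor :: "('a, 'b) tensor \<Rightarrow> ('a, 'b) tensor"
  is "image_mset (\<lambda>(a, b). (- a, b))"
  by (rule tensor_eq_map_left) (simp_all add: scaleC_minus_right)

definition minus_tensor :: "('a, 'b) tensor \<Rightarrow> ('a, 'b) tensor \<Rightarrow> ('a, 'b) tensor"
  where "minus_tensor S T = S + (- T)"

lift_definition times_tensor :: "('a, 'b) tensor \<Rightarrow> ('a, 'b) tensor \<Rightarrow> ('a, 'b) tensor"
  is tensor_mult_rep
  by (blast intro: tensor_eq.trans tensor_eq_mult_left tensor_eq_mult_right)

lift_definition scaleC_tensor :: "complex \<Rightarrow> ('a, 'b) tensor \<Rightarrow> ('a, 'b) tensor"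
  is "\<lambda>c. image_mset (\<lambda>(a, b). (c *\<^sub>C a, b))"
  by (rule tensor_eq_map_left) (simp_all add: scaleC_add_right scaleC_scaleC mult.commute)

instance
proof
  fix S T P :: "('a, 'b) tensor" and c e :: complex
  show "S + T + P = S + (T + P)"
    by transfer (simp add: add.assoc tensor_eq.refl)
  show "S + T = T + S"
    by transfer (simp add: add.commute tensor_eq.refl)
  show "0 + S = S"
    by transfer (simp add: tensor_eq.refl)
  show "- S + S = 0"
    by transfer (rule tensor_eq_neg)
  show "S - T = S + - T"
    by (rule minus_tensor_def)
  show "S * T * P = S * (T * P)"
    by transfer (simp add: tensor_mult_rep_assoc tensor_eq.refl)
  show "1 * S = S"
    by transfer (simp add: tensor_eq.refl)
  show "S * 1 = S"
    by transfer (simp add: tensor_eq.refl)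
  show "(S + T) * P = S * P + T * P"
    by transfer (simp add: tensor_eq.refl)
  show "S * (T + P) = S * T + S * P"
    by transfer (simp add: tensor_eq.refl)
  show "(0 :: ('a, 'b) tensor) \<noteq> 1"
  proof
    assume "(0 :: ('a, 'b) tensor) = 1"
    then have eq: "tensor_eq {#} {#(1 :: 'a, 1 :: 'b)#}" by transfer
    obtain f :: "'a \<Rightarrow> complex" where f: "\<And>x y. f (x + y) = f x + f y"
      "\<And>c x. f (c *\<^sub>C x) = c * f x" "f 1 = 1"
      using ex_linear_functional_one by blast
    obtain g :: "'b \<Rightarrow> complex" where g: "\<And>x y. g (x + y) = g x + g y"
      "\<And>c x. g (c *\<^sub>C x) = c * g x" "g 1 = 1"
      using ex_linear_functional_one by blast
    from tensor_eq_bilinear[of "\<lambda>a b. f a * g b", OF _ _ _ eq] show False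
      by (simp add: f g algebra_simps)
  qed
  show "c *\<^sub>C (S + T) = c *\<^sub>C S + c *\<^sub>C T"
    by transfer (simp add: tensor_eq.refl)
  show "(c + e) *\<^sub>C S = c *\<^sub>C S + e *\<^sub>C S"
  proof transfer
    fix c e :: complex and M :: "('a \<times> 'b) multiset"
    show "tensor_eq (image_mset (\<lambda>(a, b). ((c + e) *\<^sub>C a, b)) M)
      (image_mset (\<lambda>(a, b). (c *\<^sub>C a, b)) M + image_mset (\<lambda>(a, b). (e *\<^sub>C a, b)) M)"
    proof (induction M)
      case (add x M)
      obtain a b where x: "x = (a, b)" by (cases x)
      from tensor_eq_add[OF tensor_eq.add_left[of "c *\<^sub>C a" "e *\<^sub>C a" b] add.IH]
      show ?case by (simp add: x scaleC_add_left add_mset_commute)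
    qed (simp add: tensor_eq.refl)
  qed
  show "c *\<^sub>C e *\<^sub>C S = (c * e) *\<^sub>C S"
    by transfer (simp add: image_mset.compositionality o_def case_prod_unfold scaleC_scaleC tensor_eq.refl)
  show "1 *\<^sub>C S = S"
    by transfer (simp add: case_prod_unfold scaleC_one tensor_eq.refl)
  show "(c *\<^sub>C S) * T = c *\<^sub>C (S * T)"
  proof transfer
    fix c and M N :: "('a \<times> 'b) multiset"
    have "tensor_mult_rep (image_mset (\<lambda>(a, b). (c *\<^sub>C a, b)) M) N =
      image_mset (\<lambda>(a, b). (c *\<^sub>C a, b)) (tensor_mult_rep M N)"
      by (induction M)
        (auto simp: image_mset.compositionality o_def case_prod_unfold mult_scaleC_left)
    then show "tensor_eq (tensor_mult_rep (image_mset (\<lambda>(a, b). (c *\<^sub>C a, b)) M) N)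
      (image_mset (\<lambda>(a, b). (c *\<^sub>C a, b)) (tensor_mult_rep M N))"
      by (simp add: tensor_eq.refl)
  qed
  show "S * (c *\<^sub>C T) = c *\<^sub>C (S * T)"
  proof transfer
    fix c and M N :: "('a \<times> 'b) multiset"
    have "tensor_mult_rep M (image_mset (\<lambda>(a, b). (c *\<^sub>C a, b)) N) =
      image_mset (\<lambda>(a, b). (c *\<^sub>C a, b)) (tensor_mult_rep M N)"
      by (induction M)
        (auto simp: image_mset.compositionality o_def case_prod_unfold mult_scaleC_right)
    then show "tensor_eq (tensor_mult_rep M (image_mset (\<lambda>(a, b). (c *\<^sub>C a, b)) N))
      (image_mset (\<lambda>(a, b). (c *\<^sub>C a, b)) (tensor_mult_rep M N))"
      by (simp add: tensor_eq.refl)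
  qed
qed

end

lift_definition pure_tensor ::
    "'a::complex_algebra_1 \<Rightarrow> 'b::complex_algebra_1 \<Rightarrow> ('a, 'b) tensor" (infixr "\<otimes>\<^sub>C" 75)
  is "\<lambda>a b. {#(a, b)#}" .

lemma tensor_lift_pure:
  fixes f :: "'a::complex_algebra_1 \<Rightarrow> 'b::complex_algebra_1 \<Rightarrow> 'c::ab_group_add"
  assumes "\<And>a a' b. f (a + a') b = f a b + f a' b"
    and "\<And>a b b'. f a (b + b') = f a b + f a b'"
    and "\<And>c a b. f (c *\<^sub>C a) b = f a (c *\<^sub>C b)"
  shows "tensor_lift f (a \<otimes>\<^sub>C b) = f a b"
proof -
  have "tensor_eq (rep_tensor (abs_tensor {#(a, b)#})) {#(a, b)#}"
    by (metis Quotient3_rep_abs Quotient3_tensor tensor_eq.refl)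
  from tensor_eq_bilinear[OF assms this] show ?thesis
    by (simp add: tensor_lift_def pure_tensor_def)
qed

definition tensor_map ::
    "('a \<Rightarrow> 'c) \<Rightarrow> ('b \<Rightarrow> 'd) \<Rightarrow>
      ('a::complex_algebra_1, 'b::complex_algebra_1) tensor \<Rightarrow>
      ('c::complex_algebra_1, 'd::complex_algebra_1) tensor"
  where "tensor_map f g = tensor_lift (\<lambda>a b. f a \<otimes>\<^sub>C g b)"

definition tensor_subspace ::
    "'a::complex_algebra_1 set \<Rightarrow> 'b::complex_algebra_1 set \<Rightarrow> ('a, 'b) tensor set"
  where "tensor_subspace A B = cspan {a \<otimes>\<^sub>C b |a b. a \<in> A \<and> b \<in> B}"


section \<open>Cartan matrices, roots, affine Cartan matrix\<close>

text \<open>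
  A simple Lie algebra enters only through its Cartan matrix \<open>C i j = c\<^sub>i\<^sub>j\<close>, that is, through an
  indecomposable Cartan matrix of finite type. The finite index type \<^typ>\<open>'i\<close> is the set of
  nodes; \<open>d i = (\<alpha>\<^sub>i, \<alpha>\<^sub>i) / 2\<close>. Elements of the root lattice are coefficient functions
  \<^typ>\<open>'i \<Rightarrow> int\<close>.
\<close>

definition simple_cartan_datum :: "('i::finite \<Rightarrow> 'i \<Rightarrow> int) \<Rightarrow> ('i \<Rightarrow> int) \<Rightarrow> bool"
  where "simple_cartan_datum C d \<longleftrightarrow>
    (\<forall>i. C i i = 2) \<and>
    (\<forall>i j. i \<noteq> j \<longrightarrow> C i j \<le> 0) \<and>
    (\<forall>i j. d i * C i j = d j * C j i) \<and>
    (\<forall>i. d i > 0) \<and> Gcd (range d) = 1 \<and>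
    (\<forall>v :: 'i \<Rightarrow> real. v \<noteq> (\<lambda>_. 0) \<longrightarrow>
       (\<Sum>i\<in>UNIV. \<Sum>j\<in>UNIV. v i * of_int (d i * C i j) * v j) > 0) \<and>
    (\<forall>S. S \<noteq> {} \<and> S \<noteq> UNIV \<longrightarrow> (\<exists>i\<in>S. \<exists>j\<in>- S. C i j \<noteq> 0))"

definition simple_root :: "'i \<Rightarrow> 'i \<Rightarrow> int"
  where "simple_root i = (\<lambda>j. if j = i then 1 else 0)"

definition root_form ::
    "('i::finite \<Rightarrow> 'i \<Rightarrow> int) \<Rightarrow> ('i \<Rightarrow> int) \<Rightarrow> ('i \<Rightarrow> int) \<Rightarrow> ('i \<Rightarrow> int) \<Rightarrow> int"
  where "root_form C d \<beta> \<gamma> = (\<Sum>i\<in>UNIV. \<Sum>j\<in>UNIV. \<beta> i * (d i * C i j) * \<gamma> j)"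

text \<open>The root system is the Weyl group orbit of the simple roots.\<close>

inductive_set roots :: "('i::finite \<Rightarrow> 'i \<Rightarrow> int) \<Rightarrow> ('i \<Rightarrow> int) set"
  for C :: "'i \<Rightarrow> 'i \<Rightarrow> int" where
  simple: "simple_root i \<in> roots C"
| reflection: "\<beta> \<in> roots C \<Longrightarrow>
    (\<lambda>j. \<beta> j - (\<Sum>k\<in>UNIV. C i k * \<beta> k) * simple_root i j) \<in> roots C"

definition is_highest_root :: "('i::finite \<Rightarrow> 'i \<Rightarrow> int) \<Rightarrow> ('i \<Rightarrow> int) \<Rightarrow> bool"
  where "is_highest_root C \<theta> \<longleftrightarrow> \<theta> \<in> roots C \<and> (\<forall>\<beta>\<in>roots C. \<beta> \<le> \<theta>)"

text \<open>The affine nodes are \<^typ>\<open>'i option\<close>, with \<^const>\<open>None\<close> as node \<open>0\<close>. All divisions are exact.\<close>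

fun affine_cartan ::
    "('i::finite \<Rightarrow> 'i \<Rightarrow> int) \<Rightarrow> ('i \<Rightarrow> int) \<Rightarrow> ('i \<Rightarrow> int) \<Rightarrow> 'i option \<Rightarrow> 'i option \<Rightarrow> int"
  where
  "affine_cartan C d \<theta> None None = 2"
| "affine_cartan C d \<theta> (Some i) None =
     - ((2 * root_form C d (simple_root i) \<theta>) div root_form C d (simple_root i) (simple_root i))"
| "affine_cartan C d \<theta> None (Some i) =
     - ((2 * root_form C d \<theta> (simple_root i)) div root_form C d \<theta> \<theta>)"
| "affine_cartan C d \<theta> (Some i) (Some j) = C i j"

fun affine_d ::
    "('i::finite \<Rightarrow> 'i \<Rightarrow> int) \<Rightarrow> ('i \<Rightarrow> int) \<Rightarrow> ('i \<Rightarrow> int) \<Rightarrow> 'i option \<Rightarrow> int"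
  where
  "affine_d C d \<theta> None = root_form C d \<theta> \<theta> div 2"
| "affine_d C d \<theta> (Some i) = d i"


section \<open>The quantum affine algebra\<close>

definition qint :: "complex \<Rightarrow> int \<Rightarrow> complex"
  where "qint q t = (q powi t - q powi (- t)) / (q - inverse q)"

definition qbinomial :: "complex \<Rightarrow> int \<Rightarrow> nat \<Rightarrow> complex"
  where "qbinomial q t n = (\<Prod>m = 1..n. qint q (t - int m + 1) / qint q (int m))"

definition not_root_of_unity :: "complex \<Rightarrow> bool"
  where "not_root_of_unity q \<longleftrightarrow> q \<noteq> 0 \<and> (\<forall>n::nat. n > 0 \<longrightarrow> q ^ n \<noteq> 1)"

definition serre_element ::
    "complex \<Rightarrow> int \<Rightarrow> 'a \<Rightarrow> 'a \<Rightarrow> 'a::complex_algebra_1"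
  where "serre_element p c x y =
    (\<Sum>s\<le>nat (1 - c). ((-1) ^ s * qbinomial p (1 - c) s) *\<^sub>C (x ^ (nat (1 - c) - s) * y * x ^ s))"

datatype 'k jimbo_gen = GE 'k | GF 'k | GK 'k | GKinv 'k

text \<open>
  Relators \<open>lhs - rhs\<close> of the Drinfeld--Jimbo presentation, for generators \<open>J\<close>. The ordered product
  over the nodes is taken for every enumeration of the nodes, which amounts to the same since the
  \<open>K\<^sub>i\<close> commute.
\<close>

definition jimbo_relators ::
    "('i::finite \<Rightarrow> 'i \<Rightarrow> int) \<Rightarrow> ('i \<Rightarrow> int) \<Rightarrow> ('i \<Rightarrow> int) \<Rightarrow> complex \<Rightarrow>
      ('i option jimbo_gen \<Rightarrow> 'a::complex_algebra_1) \<Rightarrow> 'a set"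
  where "jimbo_relators C d \<theta> q J =
    (let c = affine_cartan C d \<theta>; p = (\<lambda>k. q powi affine_d C d \<theta> k) in
      {J (GK k) * J (GKinv k) - 1 |k. True} \<union>
      {J (GKinv k) * J (GK k) - 1 |k. True} \<union>
      {J (GK k) * J (GK l) - J (GK l) * J (GK k) |k l. True} \<union>
      {J (GK None) * prod_list (map (\<lambda>i. J (GK (Some i)) ^ nat (\<theta> i)) is) - 1 |is.
         distinct is \<and> set is = UNIV} \<union>
      {J (GK k) * J (GE l) - (p k powi c k l) *\<^sub>C (J (GE l) * J (GK k)) |k l. True} \<union>
      {J (GK k) * J (GF l) - (p k powi (- c k l)) *\<^sub>C (J (GF l) * J (GK k)) |k l. True} \<union>
      {J (GE k) * J (GF l) - J (GF l) * J (GE k) -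
         (if k = l then (1 / (p k - inverse (p k))) *\<^sub>C (J (GK k) - J (GKinv k)) else 0) |k l. True} \<union>
      {serre_element (p k) (c k l) (J (GE k)) (J (GE l)) |k l. k \<noteq> l} \<union>
      {serre_element (p k) (c k l) (J (GF k)) (J (GF l)) |k l. k \<noteq> l})"

datatype pm = Plus | Minus

primrec pm_sign :: "pm \<Rightarrow> int" where
  "pm_sign Plus = 1"
| "pm_sign Minus = -1"

text \<open>\<open>GX \<sigma> i m\<close> and \<open>GPhi \<sigma> i m\<close> index the Drinfeld generators \<open>x\<^sup>\<sigma>\<^sub>i\<^sub>,\<^sub>m\<close> and \<open>\<phi>\<^sup>\<sigma>\<^sub>i\<^sub>,\<^sub>m\<close>.\<close>

datatype 'i drinfeld_gen = GX pm 'i int | GPhi pm 'i int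

definition drinfeld_relators ::
    "('i::finite \<Rightarrow> 'i \<Rightarrow> int) \<Rightarrow> ('i \<Rightarrow> int) \<Rightarrow> complex \<Rightarrow>
      ('i drinfeld_gen \<Rightarrow> 'a::complex_algebra_1) \<Rightarrow> 'a set"
  where "drinfeld_relators C d q D =
    (let x = (\<lambda>\<sigma> i m. D (GX \<sigma> i m)); phi = (\<lambda>\<epsilon> i m. D (GPhi \<epsilon> i m));
         p = (\<lambda>i. q powi d i); qb = (\<lambda>\<sigma> i j. q powi (pm_sign \<sigma> * (d i * C i j))) in
      {phi Plus i m |i m. m < 0} \<union>
      {phi Minus i m |i m. m > 0} \<union>
      {phi Plus i 0 * phi Minus i 0 - 1 |i. True} \<union>
      {phi \<epsilon> i m * phi \<epsilon>' j n - phi \<epsilon>' j n * phi \<epsilon> i m |\<epsilon> \<epsilon>' i j m n. True} \<union>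
      {x Plus i m * x Minus j n - x Minus j n * x Plus i m -
         (if i = j then (1 / (p i - inverse (p i))) *\<^sub>C (phi Plus i (m + n) - phi Minus i (m + n))
          else 0) |i j m n. True} \<union>
      {phi \<epsilon> i (m + 1) * x \<sigma> j n - qb \<sigma> i j *\<^sub>C (phi \<epsilon> i m * x \<sigma> j (n + 1)) -
         (qb \<sigma> i j *\<^sub>C (x \<sigma> j n * phi \<epsilon> i (m + 1)) - x \<sigma> j (n + 1) * phi \<epsilon> i m)
         |\<epsilon> \<sigma> i j m n. True} \<union>
      {x \<sigma> i (m + 1) * x \<sigma> j n - qb \<sigma> i j *\<^sub>C (x \<sigma> i m * x \<sigma> j (n + 1)) -
         (qb \<sigma> i j *\<^sub>C (x \<sigma> j n * x \<sigma> i (m + 1)) - x \<sigma> j (n + 1) * x \<sigma> i m)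
         |\<sigma> i j m n. True} \<union>
      {serre_element (p i) (C i j) (x \<sigma> i 0) (x \<sigma> j 0) |\<sigma> i j. i \<noteq> j})"

text \<open>
  Beck's isomorphism. Besides \<open>E\<^sub>i = x\<^sup>+\<^sub>i\<^sub>,\<^sub>0\<close>, \<open>F\<^sub>i = x\<^sup>-\<^sub>i\<^sub>,\<^sub>0\<close>, \<open>K\<^sub>i = \<phi>\<^sup>+\<^sub>i\<^sub>,\<^sub>0\<close> for the finite nodes, the
  generators of node \<open>0\<close> are, in the explicit form recorded by Chari and Pressley,
  \<open>E\<^sub>0 = \<mu> w\<^sup>-\<^sub>i\<^sub>1 \<dots> w\<^sup>-\<^sub>i\<^sub>k (x\<^sup>-\<^sub>j\<^sub>,\<^sub>1) K\<^sub>0\<close> and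
  \<open>F\<^sub>0 = \<nu> K\<^sub>0\<^sup>-\<^sup>1 w\<^sup>+\<^sub>i\<^sub>1 \<dots> w\<^sup>+\<^sub>i\<^sub>k (x\<^sup>+\<^sub>j\<^sub>,\<^sub>-\<^sub>1)\<close>, where
  \<open>w\<^sup>\<sigma>\<^sub>i (a) = x\<^sup>\<sigma>\<^sub>i\<^sub>,\<^sub>0 a - K\<^sub>i\<^sup>\<sigma> a K\<^sub>i\<^sup>-\<^sup>\<sigma> x\<^sup>\<sigma>\<^sub>i\<^sub>,\<^sub>0\<close> and \<open>\<alpha>\<^sub>j\<close>, \<open>\<alpha>\<^sub>j + \<alpha>\<^sub>i\<^sub>k\<close>, \<open>\<dots>\<close>, \<open>\<alpha>\<^sub>j + \<alpha>\<^sub>i\<^sub>k + \<dots> + \<alpha>\<^sub>i\<^sub>1 = \<theta>\<close>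
  are roots. The product \<open>\<mu> \<nu>\<close> is fixed by \<open>[E\<^sub>0, F\<^sub>0]\<close>; rescaling \<open>\<mu>\<close> amounts to a twist by the
  \<open>\<int>\<close>-grading, which commutes with the coproduct. Here \<open>K\<^sub>0\<close> is the
  inverse of \<open>K\<^sub>\<theta>\<close>.
\<close>

definition twisted_bracket ::
    "('i drinfeld_gen \<Rightarrow> 'a::complex_algebra_1) \<Rightarrow> pm \<Rightarrow> 'i \<Rightarrow> 'a \<Rightarrow> 'a"
  where "twisted_bracket D \<sigma> i a =
    D (GX \<sigma> i 0) * a -
    D (GPhi \<sigma> i 0) * a * D (GPhi (case \<sigma> of Plus \<Rightarrow> Minus | Minus \<Rightarrow> Plus) i 0) * D (GX \<sigma> i 0)"

definition highest_root_chain ::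
    "('i::finite \<Rightarrow> 'i \<Rightarrow> int) \<Rightarrow> ('i \<Rightarrow> int) \<Rightarrow> 'i list \<Rightarrow> 'i \<Rightarrow> bool"
  where "highest_root_chain C \<theta> is j \<longleftrightarrow>
    (let part = (\<lambda>m k. simple_root j k + (\<Sum>i\<leftarrow>drop m is. simple_root i k)) in
      (\<forall>m\<le>length is. part m \<in> roots C) \<and> part 0 = \<theta>)"

definition beck_identification ::
    "('i::finite \<Rightarrow> 'i \<Rightarrow> int) \<Rightarrow> ('i \<Rightarrow> int) \<Rightarrow>
      ('i option jimbo_gen \<Rightarrow> 'a::complex_algebra_1) \<Rightarrow> ('i drinfeld_gen \<Rightarrow> 'a) \<Rightarrow> bool"
  where "beck_identification C \<theta> J D \<longleftrightarrow>
    (\<forall>i. J (GE (Some i)) = D (GX Plus i 0) \<and> J (GF (Some i)) = D (GX Minus i 0) \<and>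
         J (GK (Some i)) = D (GPhi Plus i 0) \<and> J (GKinv (Some i)) = D (GPhi Minus i 0)) \<and>
    (\<exists>is j \<mu> \<nu>. highest_root_chain C \<theta> is j \<and> \<mu> \<noteq> 0 \<and> \<nu> \<noteq> 0 \<and>
       J (GE None) = \<mu> *\<^sub>C (foldr (twisted_bracket D Minus) is (D (GX Minus j 1)) * J (GK None)) \<and>
       J (GF None) = \<nu> *\<^sub>C (J (GKinv None) * foldr (twisted_bracket D Plus) is (D (GX Plus j (-1)))))"

text \<open>
  The algebra \<^typ>\<open>'a\<close> is the quantum affine algebra, with its Drinfeld--Jimbo generators \<open>J\<close> and
  its Drinfeld generators \<open>D\<close>.
\<close>

definition quantum_affine_algebra ::
    "('i::finite \<Rightarrow> 'i \<Rightarrow> int) \<Rightarrow> ('i \<Rightarrow> int) \<Rightarrow> ('i \<Rightarrow> int) \<Rightarrow> complex \<Rightarrow>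
      ('i option jimbo_gen \<Rightarrow> 'a::complex_algebra_1) \<Rightarrow> ('i drinfeld_gen \<Rightarrow> 'a) \<Rightarrow> bool"
  where "quantum_affine_algebra C d \<theta> q J D \<longleftrightarrow>
    presented_by J (jimbo_relators C d \<theta> q free_var) \<and>
    presented_by D (drinfeld_relators C d q free_var) \<and>
    beck_identification C \<theta> J D"

definition is_coproduct ::
    "('k jimbo_gen \<Rightarrow> 'a::complex_algebra_1) \<Rightarrow> ('a \<Rightarrow> ('a, 'a) tensor) \<Rightarrow> bool"
  where "is_coproduct J \<Delta> \<longleftrightarrow> algebra_hom \<Delta> \<and>
    (\<forall>k. \<Delta> (J (GE k)) = J (GE k) \<otimes>\<^sub>C 1 + J (GK k) \<otimes>\<^sub>C J (GE k) \<and>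
         \<Delta> (J (GF k)) = 1 \<otimes>\<^sub>C J (GF k) + J (GF k) \<otimes>\<^sub>C J (GKinv k) \<and>
         \<Delta> (J (GK k)) = J (GK k) \<otimes>\<^sub>C J (GK k))"


subsection \<open>Gradings and subalgebras\<close>

primrec gen_weight :: "'i drinfeld_gen \<Rightarrow> 'i \<Rightarrow> int" where
  "gen_weight (GX \<sigma> i m) = (\<lambda>j. pm_sign \<sigma> * simple_root i j)"
| "gen_weight (GPhi \<epsilon> i m) = (\<lambda>j. 0)"

primrec gen_degree :: "'i drinfeld_gen \<Rightarrow> int" where
  "gen_degree (GX \<sigma> i m) = m"
| "gen_degree (GPhi \<epsilon> i m) = m"

definition weight_space ::
    "('i drinfeld_gen \<Rightarrow> 'a::complex_algebra_1) \<Rightarrow> ('i \<Rightarrow> int) \<Rightarrow> 'a set"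
  where "weight_space D \<beta> =
    cspan {prod_list (map D gs) |gs. \<forall>i. (\<Sum>g\<leftarrow>gs. gen_weight g i) = \<beta> i}"

definition degree_space ::
    "('i drinfeld_gen \<Rightarrow> 'a::complex_algebra_1) \<Rightarrow> int \<Rightarrow> 'a set"
  where "degree_space D n = cspan {prod_list (map D gs) |gs. (\<Sum>g\<leftarrow>gs. gen_degree g) = n}"

text \<open>The component in \<open>G k\<close> of an element of the direct sum of the subspaces \<open>G\<close>.\<close>

definition graded_component :: "('k \<Rightarrow> 'a::ab_group_add set) \<Rightarrow> 'k \<Rightarrow> 'a \<Rightarrow> 'a"
  where "graded_component G k a =
    (THE b. \<exists>f. finite {j. f j \<noteq> 0} \<and> (\<forall>j. f j \<in> G j) \<and> a = (\<Sum>j | f j \<noteq> 0. f j) \<and> b = f k)"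

definition U_minus :: "('i drinfeld_gen \<Rightarrow> 'a::complex_algebra_1) \<Rightarrow> 'a set"
  where "U_minus D = subalgebra_generated {D (GX Minus i m) |i m. True}"

definition U_plus :: "('i drinfeld_gen \<Rightarrow> 'a::complex_algebra_1) \<Rightarrow> 'a set"
  where "U_plus D = subalgebra_generated {D (GX Plus i m) |i m. True}"

definition U_le :: "('i drinfeld_gen \<Rightarrow> 'a::complex_algebra_1) \<Rightarrow> 'a set"
  where "U_le D = subalgebra_generated
    ({D (GX Minus i m) |i m. True} \<union> {D (GPhi \<epsilon> i m) |\<epsilon> i m. True})"

definition U_ge :: "('i drinfeld_gen \<Rightarrow> 'a::complex_algebra_1) \<Rightarrow> 'a set"
  where "U_ge D = subalgebra_generated
    ({D (GX Plus i m) |i m. True} \<union> {D (GPhi \<epsilon> i m) |\<epsilon> i m. True})"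


subsection \<open>The elements \<open>h\<^sub>i\<^sub>,\<^sub>s\<close>\<close>

text \<open>Meant for series with zero constant term, for which the powers beyond \<open>n\<close> do not contribute.\<close>

definition exp_of_fps :: "'a::complex_algebra_1 fps \<Rightarrow> 'a fps"
  where "exp_of_fps f = Abs_fps (\<lambda>n. \<Sum>k\<le>n. (1 / fact k) *\<^sub>C fps_nth (f ^ k) n)"

text \<open>
  The series with superscript \<open>-\<close> are series in \<open>u\<^sup>-\<^sup>1\<close>, written here in the variable \<open>u\<^sup>-\<^sup>1\<close>. The
  value \<open>h i 0\<close> is irrelevant.
\<close>

definition cartan_currents ::
    "complex \<Rightarrow> ('i drinfeld_gen \<Rightarrow> 'a::complex_algebra_1) \<Rightarrow> ('i \<Rightarrow> int \<Rightarrow> 'a) \<Rightarrow> bool"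
  where "cartan_currents q D h \<longleftrightarrow> (\<forall>i.
    Abs_fps (\<lambda>n. D (GPhi Plus i (int n))) =
      fps_const (D (GPhi Plus i 0)) *
      exp_of_fps (Abs_fps (\<lambda>n. if n = 0 then 0 else (q - inverse q) *\<^sub>C h i (int n))) \<and>
    Abs_fps (\<lambda>n. D (GPhi Minus i (- int n))) =
      fps_const (D (GPhi Minus i 0)) *
      exp_of_fps (Abs_fps (\<lambda>n. if n = 0 then 0 else (- (q - inverse q)) *\<^sub>C h i (- int n))))"


section \<open>The 0-completed tensor square and the unitriangular R-matrices\<close>

text \<open>
  Laurent series in \<open>z\<close> with coefficients in the completed tensor square are families, indexed by
  \<open>\<beta>\<close> in the positive cone \<^typ>\<open>'i \<Rightarrow> nat\<close> of the root lattice, of Laurent series in \<open>z\<close> with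
  coefficients in \<open>U\<^sub>-\<^sub>\<beta> \<otimes> U\<^sub>\<beta>\<close>.
\<close>

definition completed_mult ::
    "(('i::finite \<Rightarrow> nat) \<Rightarrow> 'b::semiring_0) \<Rightarrow> (('i \<Rightarrow> nat) \<Rightarrow> 'b) \<Rightarrow> ('i \<Rightarrow> nat) \<Rightarrow> 'b"
  where "completed_mult A B \<beta> = (\<Sum>\<gamma> | \<gamma> \<le> \<beta>. A \<gamma> * B (\<lambda>i. \<beta> i - \<gamma> i))"

definition in_weight_zero :: "'b::zero \<Rightarrow> ('i \<Rightarrow> nat) \<Rightarrow> 'b"
  where "in_weight_zero t \<beta> = (if \<beta> = (\<lambda>_. 0) then t else 0)"

definition bigraded_part ::
    "('a::complex_algebra_1) set \<Rightarrow> 'a set \<Rightarrow> ('i drinfeld_gen \<Rightarrow> 'a) \<Rightarrow> ('i \<Rightarrow> nat) \<Rightarrow>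
      ('a, 'a) tensor set"
  where "bigraded_part A B D \<beta> =
    tensor_subspace (A \<inter> weight_space D (\<lambda>i. - int (\<beta> i))) (B \<inter> weight_space D (\<lambda>i. int (\<beta> i)))"

definition tensor_weight_component ::
    "('i drinfeld_gen \<Rightarrow> 'a::complex_algebra_1) \<Rightarrow> ('a, 'a) tensor \<Rightarrow> ('i \<Rightarrow> nat) \<Rightarrow>
      ('a, 'a) tensor"
  where "tensor_weight_component D T \<beta> =
    tensor_map (graded_component (weight_space D) (\<lambda>i. - int (\<beta> i)))
      (graded_component (weight_space D) (\<lambda>i. int (\<beta> i))) T"

text \<open>
  \<open>tau_left D e T\<close> and \<open>tau_right D e T\<close> are the images of \<open>T\<close> under \<open>\<tau> \<otimes> Id\<close> and \<open>Id \<otimes> \<tau>\<close> in the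
  completion, where \<open>\<tau>\<close> multiplies elements of degree \<open>n\<close> by \<open>z\<close> to the power \<open>e * n\<close>, for
  \<open>e = 1\<close> or \<open>e = -1\<close>. Hence the coefficient of the \<open>n\<close>-th power of \<open>z\<close> is the component of degree
  \<open>e * n\<close>.
\<close>

definition tau_left ::
    "('i drinfeld_gen \<Rightarrow> 'a::complex_algebra_1) \<Rightarrow> int \<Rightarrow> ('a, 'a) tensor \<Rightarrow> ('i \<Rightarrow> nat) \<Rightarrow>
      ('a, 'a) tensor fls"
  where "tau_left D e T \<beta> =
    Abs_fls (\<lambda>n. tensor_map (graded_component (degree_space D) (e * n)) id
      (tensor_weight_component D T \<beta>))"

definition tau_right ::
    "('i drinfeld_gen \<Rightarrow> 'a::complex_algebra_1) \<Rightarrow> int \<Rightarrow> ('a, 'a) tensor \<Rightarrow> ('i \<Rightarrow> nat) \<Rightarrow>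
      ('a, 'a) tensor fls"
  where "tau_right D e T \<beta> =
    Abs_fls (\<lambda>n. tensor_map id (graded_component (degree_space D) (e * n))
      (tensor_weight_component D T \<beta>))"

text \<open>\<open>monomial_fls t s\<close> is \<open>t z\<^sup>s\<close>.\<close>

definition monomial_fls :: "'b::ring_1 \<Rightarrow> int \<Rightarrow> 'b fls"
  where "monomial_fls t s = fls_const t * fls_X_intpow s"

definition unitriangular ::
    "('i drinfeld_gen \<Rightarrow> 'a::complex_algebra_1) \<Rightarrow> (('i \<Rightarrow> nat) \<Rightarrow> ('a, 'a) tensor fps) \<Rightarrow> bool"
  where "unitriangular D R \<longleftrightarrow>
    (\<forall>\<beta> n. fps_nth (R \<beta>) n \<in> bigraded_part (U_minus D) (U_plus D) D \<beta>) \<and> R (\<lambda>_. 0) = 1"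

definition unitriangular_R_matrices ::
    "('i::finite drinfeld_gen \<Rightarrow> 'a::complex_algebra_1) \<Rightarrow> ('a \<Rightarrow> ('a, 'a) tensor) \<Rightarrow>
      ('i \<Rightarrow> int \<Rightarrow> 'a) \<Rightarrow> (('i \<Rightarrow> nat) \<Rightarrow> ('a, 'a) tensor fps) \<Rightarrow>
      (('i \<Rightarrow> nat) \<Rightarrow> ('a, 'a) tensor fps) \<Rightarrow> bool"
  where "unitriangular_R_matrices D \<Delta> h R_minus R_plus \<longleftrightarrow>
    unitriangular D R_minus \<and> unitriangular D R_plus \<and>
    (\<forall>i s. s \<noteq> 0 \<longrightarrow>
      (let h1 = h i s \<otimes>\<^sub>C 1; h2 = 1 \<otimes>\<^sub>C h i s;
           Rm = (\<lambda>\<beta>. fps_to_fls (R_minus \<beta>)); Rp = (\<lambda>\<beta>. fps_to_fls (R_plus \<beta>)) in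
        \<Delta> (h i s) \<in> cspan (\<Union>\<beta>. bigraded_part (U_le D) (U_ge D) D \<beta>) \<and>
        completed_mult (in_weight_zero (monomial_fls h1 s + monomial_fls h2 0)) Rm =
          completed_mult Rm (tau_left D 1 (\<Delta> (h i s))) \<and>
        completed_mult Rp (in_weight_zero (monomial_fls h1 0 + monomial_fls h2 s)) =
          completed_mult (tau_right D 1 (\<Delta> (h i s))) Rp \<and>
        completed_mult (in_weight_zero (monomial_fls h1 0 + monomial_fls h2 (- s))) Rm =
          completed_mult Rm (tau_right D (-1) (\<Delta> (h i s))) \<and>
        completed_mult Rp (in_weight_zero (monomial_fls h1 (- s) + monomial_fls h2 0)) =
          completed_mult (tau_left D (-1) (\<Delta> (h i s))) Rp))"


section \<open>Representations, evaluation, rational functions\<close>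

definition matrix_representation :: "('a::complex_algebra_1 \<Rightarrow> complex^'n^'n) \<Rightarrow> bool"
  where "matrix_representation \<phi> \<longleftrightarrow>
    \<phi> 1 = mat 1 \<and> (\<forall>x y. \<phi> (x + y) = \<phi> x + \<phi> y) \<and> (\<forall>x y. \<phi> (x * y) = \<phi> x ** \<phi> y) \<and>
    (\<forall>c x. \<phi> (c *\<^sub>C x) = (\<chi> k l. c * \<phi> x $ k $ l))"

definition kronecker ::
    "complex^'n^'n \<Rightarrow> complex^'m^'m \<Rightarrow> complex^('n \<times> 'm)^('n \<times> 'm)"
  where "kronecker A B = (\<chi> k l. A $ fst k $ fst l * B $ snd k $ snd l)"

definition tensor_rep ::
    "('a::complex_algebra_1 \<Rightarrow> complex^'n^'n) \<Rightarrow> ('a \<Rightarrow> complex^'m^'m) \<Rightarrow>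
      ('a, 'a) tensor \<Rightarrow> complex^('n \<times> 'm)^('n \<times> 'm)"
  where "tensor_rep \<phi> \<psi> = tensor_lift (\<lambda>a b. kronecker (\<phi> a) (\<psi> b))"

text \<open>
  Only finitely many weights \<open>\<beta>\<close> contribute, because \<open>\<phi>\<close> and \<open>\<psi>\<close> are finite dimensional, so the sum
  below is a finite one.
\<close>

definition evaluate_R ::
    "('a::complex_algebra_1 \<Rightarrow> complex^'n^'n) \<Rightarrow> ('a \<Rightarrow> complex^'m^'m) \<Rightarrow>
      (('i \<Rightarrow> nat) \<Rightarrow> ('a, 'a) tensor fps) \<Rightarrow> (complex^('n \<times> 'm)^('n \<times> 'm)) fps"
  where "evaluate_R \<phi> \<psi> R =
    Abs_fps (\<lambda>n. \<Sum>\<beta> | tensor_rep \<phi> \<psi> (fps_nth (R \<beta>) n) \<noteq> 0. tensor_rep \<phi> \<psi> (fps_nth (R \<beta>) n))"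

definition rational_matrix_function :: "(complex \<Rightarrow> complex^'n^'n) \<Rightarrow> bool"
  where "rational_matrix_function f \<longleftrightarrow>
    (\<forall>k l. \<exists>p q. q \<noteq> 0 \<and> (\<forall>z. f z $ k $ l = poly p z / poly q z))"

definition rational_with_taylor_expansion ::
    "(complex \<Rightarrow> complex^'n^'n) \<Rightarrow> (complex^'n^'n) fps \<Rightarrow> bool"
  where "rational_with_taylor_expansion f S \<longleftrightarrow> rational_matrix_function f \<and>
    (\<forall>k l. (\<lambda>z. f z $ k $ l) has_fps_expansion Abs_fps (\<lambda>n. fps_nth S n $ k $ l))"

text \<open>
  \<open>a\<close> is a pole of the matrix valued rational function with Taylor expansion \<open>S\<close> at \<open>0\<close>. The value
  of a rational function at its poles, where \<open>x / 0 = 0\<close> applies, does not affect \<^const>\<open>is_pole\<close>.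
\<close>

definition pole_of_expansion :: "(complex^'n^'n) fps \<Rightarrow> complex \<Rightarrow> bool"
  where "pole_of_expansion S a \<longleftrightarrow> (\<exists>f. rational_with_taylor_expansion f S \<and> is_pole f a)"

definition x_minus_positive_part ::
    "('i drinfeld_gen \<Rightarrow> 'a) \<Rightarrow> ('a \<Rightarrow> complex^'n^'n) \<Rightarrow> 'i \<Rightarrow> (complex^'n^'n) fps"
  where "x_minus_positive_part D \<phi> i =
    Abs_fps (\<lambda>n. if n = 0 then 0 else \<phi> (D (GX Minus i (int n))))"

definition x_plus_nonnegative_part ::
    "('i drinfeld_gen \<Rightarrow> 'a) \<Rightarrow> ('a \<Rightarrow> complex^'n^'n) \<Rightarrow> 'i \<Rightarrow> (complex^'n^'n) fps"
  where "x_plus_nonnegative_part D \<psi> i = Abs_fps (\<lambda>n. \<psi> (D (GX Plus i (int n))))"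

end

theory Submission
  imports Defs "HOL-Computational_Algebra.Fundamental_Theorem_Algebra"
begin

text \<open>
  Apply \<open>\<phi> \<otimes> \<psi>\<close> to the relations between \<open>R\<^sup>-\<close>, \<open>R\<^sup>+\<close> and \<open>h\<^sub>i\<^sub>,\<^sub>s\<close>, \<open>s > 0\<close>. In weight \<open>\<beta>\<close> they express the commutator
  of the evaluated component with \<open>y\<^sup>s h\<^sub>i\<^sub>,\<^sub>s \<otimes> 1 + 1 \<otimes> h\<^sub>i\<^sub>,\<^sub>s\<close> through components of smaller weight, where \<open>y = z\<close>
  for \<open>R\<^sup>-\<close> and \<open>y = 1/z\<close> for \<open>R\<^sup>+\<close>. On products of root currents the adjoint action of \<open>h\<^sub>i\<^sub>,\<^sub>s\<close> shifts one index
  by \<open>s\<close>, with a scalar that forms an invertible matrix in \<open>(i, j)\<close> for large \<open>s\<close>. The currents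
  satisfy linear recurrences whose characteristic roots \<open>a\<close> (for \<open>\<phi>(x\<^sub>j\<^sup>-)\<close>) and \<open>b\<close> (for \<open>\<psi>(x\<^sub>j\<^sup>+)\<close>)
  are the inverses of the poles. If \<open>b - y a\<close> is invertible for all such pairs, a Bezout identity gives
  a combination of the commutators which kills the currents of the first factor and fixes those of
  the second one, hence multiplies the component of weight \<open>\<beta>\<close> by its height. Induction on \<open>\<beta>\<close> then shows
  that the component is a rational function of \<open>y\<close> which is regular away from the ratios \<open>b / a\<close>.
\<close>

section \<open>Homogeneous presentations are graded\<close>

text \<open>A combination of the operators ad(\<open>h i s\<close>), with coefficients in any ring
  of series, is a derivation, so its values on generators decide everything: a product of currents
  in the first factor is killed as a whole, one in the second is multiplied by its number of
  letters. The poles in the claim belong to a single node. This comes from the inverse of the matrix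
  of scalars, which decouples the nodes: the currents of node j see only a polynomial F j of their
  own, so only roots a and b of the same node have to be separated. The matrix is inverted only
  beyond some bound \<open>s0\<close>; below it the coefficients of F j are made to vanish, by
  imposing \<open>s0\<close> additional roots 0, which is possible because no b is 0. The induction
  on the weight is carried out separately at each point w, in the ring of rational functions of
  \<open>y\<close> without pole at \<open>y = w\<close>. The point w = 0 is never a ratio b / a and
  yields rationality. Since graded components are given by definite descriptions, the relations can
  be used only once the presentation is known to define gradings by weight and by degree.\<close>

interpretation cvs: vector_space "scaleC :: complex \<Rightarrow> 'a \<Rightarrow> 'a::complex_algebra_1"
  by (rule vector_space_scaleC)

lemma free_algebra_induct [case_names zero single add]:
  fixes p :: "'g free_algebra"
  assumes "P 0" and "\<And>w c. P (Poly_Mapping.single w c)" and "\<And>p q. P p \<Longrightarrow> P q \<Longrightarrow> P (p + q)"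
  shows "P p"
proof -
  have p: "p = (\<Sum>k\<in>Poly_Mapping.keys p. Poly_Mapping.single k (Poly_Mapping.lookup p k))"
    by (rule poly_mapping_eqI) (simp add: lookup_sum lookup_single when_def in_keys_iff)
  have "P (\<Sum>k\<in>S. Poly_Mapping.single k (Poly_Mapping.lookup p k))" if "finite S" for S
    using that by induction (auto intro: assms)
  then show ?thesis by (subst p) simp
qed

definition word_eval :: "('g \<Rightarrow> 'a::complex_algebra_1) \<Rightarrow> 'g word \<Rightarrow> 'a"
  where "word_eval g w = prod_list (map g (letters w))"

lemma word_eval_add: "word_eval g (v + w) = word_eval g v * word_eval g w"
  by (simp add: word_eval_def plus_word_def)

lemma word_eval_zero: "word_eval g 0 = 1"
  by (simp add: word_eval_def zero_word_def)

text \<open>With \<open>Q\<close> true this is \<open>free_eval\<close>; with \<open>Q\<close>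
  selecting the words of one weight or degree it is, on the level of the free algebra, the
  projection to a graded piece.\<close>

definition restricted_eval ::
    "('g word \<Rightarrow> bool) \<Rightarrow> ('g \<Rightarrow> 'a::complex_algebra_1) \<Rightarrow> 'g free_algebra \<Rightarrow> 'a"
  where "restricted_eval Q g p =
    (\<Sum>w\<in>Poly_Mapping.keys p. if Q w then Poly_Mapping.lookup p w *\<^sub>C word_eval g w else 0)"

lemma free_eval_eq_restricted: "free_eval g = restricted_eval (\<lambda>_. True) g"
  by (simp add: fun_eq_iff free_eval_def restricted_eval_def word_eval_def)

lemma restricted_eval_superset:
  assumes "finite S" "Poly_Mapping.keys p \<subseteq> S"
  shows "restricted_eval Q g p =
    (\<Sum>w\<in>S. if Q w then Poly_Mapping.lookup p w *\<^sub>C word_eval g w else 0)"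
  unfolding restricted_eval_def using assms
  by (intro sum.mono_neutral_left) (auto simp: in_keys_iff scaleC_zero_left)

lemma restricted_eval_zero: "restricted_eval Q g 0 = 0"
  by (simp add: restricted_eval_def)

lemma restricted_eval_add:
  "restricted_eval Q g (p + q) = restricted_eval Q g p + restricted_eval Q g q"
proof -
  let ?S = "Poly_Mapping.keys p \<union> Poly_Mapping.keys q"
  have "Poly_Mapping.keys (p + q) \<subseteq> ?S" by (rule Poly_Mapping.keys_add)
  then have "restricted_eval Q g (p + q) =
      (\<Sum>w\<in>?S. if Q w then Poly_Mapping.lookup (p + q) w *\<^sub>C word_eval g w else 0)"
    by (intro restricted_eval_superset) simp_all
  also have "\<dots> = (\<Sum>w\<in>?S. if Q w then Poly_Mapping.lookup p w *\<^sub>C word_eval g w else 0) +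
      (\<Sum>w\<in>?S. if Q w then Poly_Mapping.lookup q w *\<^sub>C word_eval g w else 0)"
    by (auto simp: lookup_add scaleC_add_left simp flip: sum.distrib intro!: sum.cong)
  also have "\<dots> = restricted_eval Q g p + restricted_eval Q g q"
    by (subst (1 2) restricted_eval_superset[where S = ?S]) simp_all
  finally show ?thesis .
qed

lemma restricted_eval_single:
  "restricted_eval Q g (Poly_Mapping.single w c) = (if Q w then c *\<^sub>C word_eval g w else 0)"
  by (cases "c = 0") (simp_all add: restricted_eval_def scaleC_zero_left)

lemma restricted_eval_homogeneous:
  assumes "\<And>w w'. w \<in> Poly_Mapping.keys p \<Longrightarrow> w' \<in> Poly_Mapping.keys p \<Longrightarrow> Q w = Q w'"
    and "free_eval g p = 0"
  shows "restricted_eval Q g p = 0"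
proof (cases "\<exists>w\<in>Poly_Mapping.keys p. Q w")
  case True
  then have "Q w" if "w \<in> Poly_Mapping.keys p" for w using assms(1) that by blast
  then have "restricted_eval Q g p = free_eval g p"
    unfolding free_eval_eq_restricted restricted_eval_def by (intro sum.cong) simp_all
  with assms(2) show ?thesis by simp
next
  case False
  then show ?thesis by (auto simp: restricted_eval_def intro!: sum.neutral)
qed

lemma free_eval_mult: "free_eval g (p * q) = free_eval g p * free_eval g q"
proof (induction p rule: free_algebra_induct)
  case (single w c)
  show ?case
    by (induction q rule: free_algebra_induct)
      (simp_all add: free_eval_eq_restricted restricted_eval_zero restricted_eval_add
        restricted_eval_single mult_single word_eval_add distrib_left mult_scaleC_left
        mult_scaleC_right scaleC_scaleC mult.commute)
qed (simp_all add: free_eval_eq_restricted restricted_eval_zero restricted_eval_add distrib_right)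

lemma free_eval_one: "free_eval g 1 = 1"
  using restricted_eval_single[of "\<lambda>_. True" g 0 1]
  by (simp add: free_eval_eq_restricted word_eval_zero scaleC_one)

lemma free_eval_add: "free_eval g (p + q) = free_eval g p + free_eval g q"
  by (simp add: free_eval_eq_restricted restricted_eval_add)

lemma free_eval_zero: "free_eval g 0 = 0"
  by (simp add: free_eval_eq_restricted restricted_eval_zero)

lemma free_eval_diff: "free_eval g (p - q) = free_eval g p - free_eval g q"
  by (metis add_diff_cancel_right' diff_add_cancel free_eval_add)

lemma free_eval_scaleC: "free_eval g (c *\<^sub>C p) = c *\<^sub>C free_eval g p"
proof -
  have "free_eval g (Poly_Mapping.single 0 (c *\<^sub>C 1)) = c *\<^sub>C 1"
    by (simp add: scaleC_complex_def free_eval_eq_restricted restricted_eval_single word_eval_zero)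
  then show ?thesis by (simp add: scaleC_poly_mapping_def free_eval_mult mult_scaleC_left)
qed

lemma free_eval_free_var: "free_eval g (free_var x) = g x"
  by (simp add: free_var_def free_eval_eq_restricted restricted_eval_single word_eval_def scaleC_one)

lemmas free_eval_simps = free_eval_mult free_eval_one free_eval_add free_eval_zero free_eval_diff
  free_eval_scaleC free_eval_free_var

text \<open>By linearity in \<open>a\<close> and \<open>b\<close>, an element
  \<open>a * r * b\<close> reduces to a relator between two words. All its words extend words of
  \<open>r\<close> by the same prefix and suffix, so \<open>Q\<close> accepts all or none of them,
  and the restricted value is the full value 0 or an empty sum. Hence the projections descend to the
  presented algebra.\<close>

lemma restricted_eval_ideal:
  assumes "p \<in> ideal_generated R"
    and zero: "\<And>r. r \<in> R \<Longrightarrow> free_eval g r = 0"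
    and sat: "\<And>r u v w w'. r \<in> R \<Longrightarrow> w \<in> Poly_Mapping.keys r \<Longrightarrow> w' \<in> Poly_Mapping.keys r \<Longrightarrow>
      Q (u + w + v) = Q (u + w' + v)"
  shows "restricted_eval Q g p = 0"
  using assms(1)
proof induction
  case (gen r a b)
  show ?case
  proof (induction a rule: free_algebra_induct)
    case (single u c)
    show ?case
    proof (induction b rule: free_algebra_induct)
      case (single v e)
      let ?p = "Poly_Mapping.single u c * r * Poly_Mapping.single v e"
      have "Poly_Mapping.keys ?p \<subseteq> {u + w + v |w. w \<in> Poly_Mapping.keys r}"
      proof
        fix x assume "x \<in> Poly_Mapping.keys ?p"
        then obtain y z where "x = y + z" "y \<in> Poly_Mapping.keys (Poly_Mapping.single u c * r)"
          "z \<in> Poly_Mapping.keys (Poly_Mapping.single v e)"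
          using keys_mult by blast
        moreover from this(2) obtain y1 y2 where "y = y1 + y2"
          "y1 \<in> Poly_Mapping.keys (Poly_Mapping.single u c)" "y2 \<in> Poly_Mapping.keys r"
          using keys_mult by blast
        ultimately show "x \<in> {u + w + v |w. w \<in> Poly_Mapping.keys r}"
          by (auto split: if_splits)
      qed
      then have "Q x = Q y" if "x \<in> Poly_Mapping.keys ?p" "y \<in> Poly_Mapping.keys ?p" for x y
        using that sat[OF gen] by blast
      moreover have "free_eval g ?p = 0" by (simp add: free_eval_mult zero gen)
      ultimately show ?case by (rule restricted_eval_homogeneous)
    qed (simp_all add: restricted_eval_zero restricted_eval_add distrib_left)
  qed (simp_all add: restricted_eval_zero restricted_eval_add distrib_right)
qed (simp_all add: restricted_eval_zero restricted_eval_add)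

lemma free_eval_relator:
  assumes "presented_by g R" "r \<in> R"
  shows "free_eval g r = 0"
proof -
  have "1 * r * 1 \<in> ideal_generated R" using assms(2) by (rule ideal_generated.gen)
  then show ?thesis using assms(1) by (auto simp: presented_by_def)
qed

text \<open>The key need not be additive: it is enough that the words of a relator share their key
  inside any surrounding words. This covers weights, which are functions, as well as integer
  degrees.\<close>

locale word_grading =
  fixes g :: "'g \<Rightarrow> 'a::complex_algebra_1" and R :: "'g free_algebra set"
    and key :: "'g word \<Rightarrow> 'k"
  assumes presented: "presented_by g R"
    and key_cong: "\<And>r u v w w'. r \<in> R \<Longrightarrow> w \<in> Poly_Mapping.keys r \<Longrightarrow>
      w' \<in> Poly_Mapping.keys r \<Longrightarrow> key (u + w + v) = key (u + w' + v)"
begin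

definition graded_part :: "'k \<Rightarrow> 'a set"
  where "graded_part k = cspan {word_eval g w |w. key w = k}"

definition proj :: "'k \<Rightarrow> 'a \<Rightarrow> 'a"
  where "proj k a = restricted_eval (\<lambda>w. key w = k) g (SOME p. free_eval g p = a)"

lemma proj_eval: "proj k (free_eval g p) = restricted_eval (\<lambda>w. key w = k) g p"
proof -
  let ?p' = "SOME p'. free_eval g p' = free_eval g p"
  have "free_eval g ?p' = free_eval g p" by (rule someI[of _ p]) simp
  then have "free_eval g (?p' - p) = 0" by (simp add: free_eval_diff)
  then have "?p' - p \<in> ideal_generated R" using presented by (auto simp: presented_by_def)
  then have "restricted_eval (\<lambda>w. key w = k) g (?p' - p) = 0"
    by (rule restricted_eval_ideal) (use free_eval_relator[OF presented] key_cong in metis)+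
  moreover have "restricted_eval (\<lambda>w. key w = k) g ?p' =
      restricted_eval (\<lambda>w. key w = k) g (?p' - p) + restricted_eval (\<lambda>w. key w = k) g p"
    by (simp flip: restricted_eval_add)
  ultimately show ?thesis by (simp add: proj_def)
qed

lemma ex_free_eval: "\<exists>p. a = free_eval g p"
  using presented by (auto simp: presented_by_def surj_def)

lemma proj_add: "proj k (a + b) = proj k a + proj k b"
proof -
  obtain p q where "a = free_eval g p" "b = free_eval g q" using ex_free_eval by metis
  then show ?thesis by (metis proj_eval restricted_eval_add free_eval_add)
qed

lemma proj_scale_word: "proj k (c *\<^sub>C word_eval g w) = (if key w = k then c *\<^sub>C word_eval g w else 0)"
proof -
  have "c *\<^sub>C word_eval g w = free_eval g (Poly_Mapping.single w c)"
    by (simp add: free_eval_eq_restricted restricted_eval_single)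
  then show ?thesis by (simp add: proj_eval restricted_eval_single)
qed

lemma proj_zero: "proj k 0 = 0"
  using proj_add[of k 0 0] by simp

lemma word_induct [case_names zero word add]:
  assumes "P 0" and "\<And>w c. P (c *\<^sub>C word_eval g w)" and "\<And>a b. P a \<Longrightarrow> P b \<Longrightarrow> P (a + b)"
  shows "P a"
proof -
  obtain p where p: "a = free_eval g p" using ex_free_eval by metis
  show ?thesis unfolding p
  proof (induction p rule: free_algebra_induct)
    case (single w c)
    show ?case by (simp add: free_eval_eq_restricted restricted_eval_single assms)
  qed (simp_all add: free_eval_zero free_eval_add assms)
qed

lemma proj_scaleC: "proj k (c *\<^sub>C a) = c *\<^sub>C proj k a"
proof (induction a rule: word_induct)
  case (word w e)
  show ?case
    unfolding scaleC_scaleC proj_scale_word by (simp add: scaleC_zero_right scaleC_scaleC)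
next
  case (add a b)
  then show ?case unfolding scaleC_add_right proj_add by simp
qed (simp add: proj_zero scaleC_zero_right)

lemma finite_proj: "finite {k. proj k a \<noteq> 0}"
proof (induction a rule: word_induct)
  case (word w c)
  have "{k. proj k (c *\<^sub>C word_eval g w) \<noteq> 0} \<subseteq> {key w}"
    by (intro subsetI) (metis (mono_tags, lifting) mem_Collect_eq proj_scale_word singletonI)
  then show ?case by (rule finite_subset) simp
next
  case (add a b)
  have "{k. proj k (a + b) \<noteq> 0} \<subseteq> {k. proj k a \<noteq> 0} \<union> {k. proj k b \<noteq> 0}"
    unfolding proj_add by (intro subsetI) (metis (mono_tags, lifting) Un_iff add.left_neutral mem_Collect_eq)
  then show ?case using add finite_subset by blast
qed (simp add: proj_zero)

lemma sum_proj: "a = (\<Sum>k | proj k a \<noteq> 0. proj k a)"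
proof -
  \<comment> \<open>Strengthened to every finite set containing the support, since the supports of
    \<open>a\<close>, \<open>b\<close> and \<open>a + b\<close> may differ.\<close>
  have "\<forall>S. finite S \<longrightarrow> {k. proj k a \<noteq> 0} \<subseteq> S \<longrightarrow> a = (\<Sum>k\<in>S. proj k a)"
  proof (induction a rule: word_induct)
    case (word w c)
    show ?case
    proof (intro allI impI)
      fix S assume S: "finite S" "{k. proj k (c *\<^sub>C word_eval g w) \<noteq> 0} \<subseteq> S"
      have "(\<Sum>k\<in>S. proj k (c *\<^sub>C word_eval g w)) = (if key w \<in> S then c *\<^sub>C word_eval g w else 0)"
        using S(1) by (simp only: proj_scale_word sum.delta')
      moreover have "c *\<^sub>C word_eval g w = 0" if "key w \<notin> S"
      proof -
        have "proj (key w) (c *\<^sub>C word_eval g w) = 0" using S(2) that by blast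
        then show ?thesis unfolding proj_scale_word by presburger
      qed
      ultimately show "c *\<^sub>C word_eval g w = (\<Sum>k\<in>S. proj k (c *\<^sub>C word_eval g w))"
        by simp
    qed
  next
    case (add a b)
    show ?case
    proof (intro allI impI)
      fix S assume S: "finite S" "{k. proj k (a + b) \<noteq> 0} \<subseteq> S"
      let ?S = "S \<union> {k. proj k a \<noteq> 0} \<union> {k. proj k b \<noteq> 0}"
      have "finite ?S" using S finite_proj by auto
      have "a = (\<Sum>k\<in>?S. proj k a)"
        by (rule add.IH(1)[rule_format, OF \<open>finite ?S\<close>]) blast
      moreover have "b = (\<Sum>k\<in>?S. proj k b)"
        by (rule add.IH(2)[rule_format, OF \<open>finite ?S\<close>]) blast
      ultimately have "a + b = (\<Sum>k\<in>?S. proj k (a + b))"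
        unfolding proj_add sum.distrib by (rule arg_cong2[where f = "(+)"])
      also have "\<dots> = (\<Sum>k\<in>S. proj k (a + b))"
        using S(2) by (intro sum.mono_neutral_right \<open>finite ?S\<close>) blast+
      finally show "a + b = (\<Sum>k\<in>S. proj k (a + b))" .
    qed
  qed (simp add: proj_zero)
  then show ?thesis using finite_proj by simp
qed

lemma proj_in_graded_part: "proj k a \<in> graded_part k"
proof (induction a rule: word_induct)
  case (word w c)
  show ?case
    unfolding graded_part_def proj_scale_word
    using cvs.span_scale[OF cvs.span_base, of "word_eval g w" "{word_eval g v |v. key v = k}" c]
    by (cases "key w = k") (auto simp: cvs.span_zero)
qed (auto simp: proj_zero proj_add graded_part_def cvs.span_zero cvs.span_add)

lemma proj_on_graded_part:
  assumes "a \<in> graded_part k"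
  shows "proj k' a = (if k' = k then a else 0)"
  using assms unfolding graded_part_def
proof (induction rule: cvs.span_induct_alt)
  case base
  show ?case by (simp add: proj_zero)
next
  case (step c x y)
  then obtain w where "x = word_eval g w" "key w = k" by auto
  with step show ?case by (auto simp: proj_add proj_scale_word)
qed

text \<open>The projection applied to any decomposition of \<open>a\<close> picks out its k-th
  member, which is the uniqueness that the definite description requires.\<close>

lemma graded_component_eq_proj: "graded_component graded_part k a = proj k a"
  unfolding graded_component_def
proof (rule the_equality)
  show "\<exists>f. finite {j. f j \<noteq> 0} \<and> (\<forall>j. f j \<in> graded_part j) \<and> a = (\<Sum>j | f j \<noteq> 0. f j) \<and>
    proj k a = f k"
    using finite_proj sum_proj proj_in_graded_part by (intro exI[of _ "\<lambda>j. proj j a"]) blast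
next
  fix b assume "\<exists>f. finite {j. f j \<noteq> 0} \<and> (\<forall>j. f j \<in> graded_part j) \<and> a = (\<Sum>j | f j \<noteq> 0. f j) \<and> b = f k"
  then obtain f where f: "finite {j. f j \<noteq> 0}" "\<And>j. f j \<in> graded_part j" "a = (\<Sum>j | f j \<noteq> 0. f j)" "b = f k"
    by blast
  have "proj k (\<Sum>j\<in>S. f j) = (\<Sum>j\<in>S. if k = j then f j else 0)" if "finite S" for S
    using that by induction (simp_all add: proj_zero proj_add proj_on_graded_part[OF f(2)])
  from this[OF f(1)] show "b = proj k a"
    by (auto simp: f(3,4) f(1) sum.delta')
qed

end

section \<open>Homogeneity of the Drinfeld relators\<close>

definition homogeneous :: "('g \<Rightarrow> int) \<Rightarrow> int \<Rightarrow> 'g free_algebra \<Rightarrow> bool"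
  where "homogeneous \<gamma> k p \<longleftrightarrow> (\<forall>w\<in>Poly_Mapping.keys p. (\<Sum>x\<leftarrow>letters w. \<gamma> x) = k)"

lemma homogeneous_zero: "homogeneous \<gamma> k 0"
  by (simp add: homogeneous_def)

lemma homogeneous_one: "homogeneous \<gamma> 0 1"
  by (simp add: homogeneous_def zero_word_def)

lemma homogeneous_free_var: "homogeneous \<gamma> (\<gamma> x) (free_var x)"
  by (simp add: homogeneous_def free_var_def)

lemma homogeneous_add: "homogeneous \<gamma> k p \<Longrightarrow> homogeneous \<gamma> k q \<Longrightarrow> homogeneous \<gamma> k (p + q)"
  unfolding homogeneous_def using Poly_Mapping.keys_add[of p q] by blast

lemma homogeneous_diff: "homogeneous \<gamma> k p \<Longrightarrow> homogeneous \<gamma> k q \<Longrightarrow> homogeneous \<gamma> k (p - q)"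
  unfolding homogeneous_def using keys_diff[of p q] by blast

lemma homogeneous_mult:
  "homogeneous \<gamma> k p \<Longrightarrow> homogeneous \<gamma> l q \<Longrightarrow> homogeneous \<gamma> (k + l) (p * q)"
  unfolding homogeneous_def using keys_mult[of p q] by (force simp: plus_word_def)

lemma homogeneous_scaleC: "homogeneous \<gamma> k p \<Longrightarrow> homogeneous \<gamma> k (c *\<^sub>C p)"
proof -
  have "homogeneous \<gamma> 0 (Poly_Mapping.single 0 (c *\<^sub>C 1))"
    by (simp add: homogeneous_def zero_word_def)
  then show "homogeneous \<gamma> k p \<Longrightarrow> homogeneous \<gamma> k (c *\<^sub>C p)"
    unfolding scaleC_poly_mapping_def using homogeneous_mult by fastforce
qed

lemma homogeneous_power: "homogeneous \<gamma> k p \<Longrightarrow> homogeneous \<gamma> (int n * k) (p ^ n)"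
  by (induction n) (auto simp: homogeneous_one distrib_right dest: homogeneous_mult)

lemma homogeneous_sum: "(\<And>s. s \<in> S \<Longrightarrow> homogeneous \<gamma> k (f s)) \<Longrightarrow> homogeneous \<gamma> k (sum f S)"
  by (induction S rule: infinite_finite_induct) (auto simp: homogeneous_zero homogeneous_add)

lemma homogeneous_serre:
  assumes "homogeneous \<gamma> k x" "homogeneous \<gamma> l y"
  shows "homogeneous \<gamma> (int (nat (1 - c)) * k + l) (serre_element p c x y)"
proof -
  obtain N where N: "nat (1 - c) = N" by simp
  have "homogeneous \<gamma> (int N * k + l) (x ^ (N - s) * y * x ^ s)" if "s \<le> N" for s
  proof -
    have "homogeneous \<gamma> (int (N - s) * k + l + int s * k) (x ^ (N - s) * y * x ^ s)"
      by (intro homogeneous_mult homogeneous_power assms)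
    moreover have "int N = int (N - s) + int s" using that by simp
    then have "int (N - s) * k + l + int s * k = int N * k + l"
      by (metis add.assoc add.commute distrib_right)
    ultimately show ?thesis by simp
  qed
  then show ?thesis
    unfolding serre_element_def N by (intro homogeneous_sum homogeneous_scaleC) simp
qed

text \<open>The parameters serve two gradings: \<open>w\<close> a coordinate of the simple roots
  with \<open>e = 0\<close> gives one coordinate of the weight, \<open>w = 0\<close> with
  \<open>e = 1\<close> gives the degree.\<close>

lemma drinfeld_relators_homogeneous:
  assumes X: "\<And>\<sigma> i m. \<gamma> (GX \<sigma> i m) = pm_sign \<sigma> * w i + m * e"
    and Phi: "\<And>\<epsilon> i m. \<gamma> (GPhi \<epsilon> i m) = m * e"
    and r: "r \<in> drinfeld_relators C d q free_var"
  shows "\<exists>k. homogeneous \<gamma> k r"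
proof -
  have x: "homogeneous \<gamma> (pm_sign \<sigma> * w i + m * e) (free_var (GX \<sigma> i m))" for \<sigma> i m
    using homogeneous_free_var[of \<gamma> "GX \<sigma> i m"] by (simp add: X)
  have p: "homogeneous \<gamma> (m * e) (free_var (GPhi \<epsilon> i m))" for \<epsilon> i m
    using homogeneous_free_var[of \<gamma> "GPhi \<epsilon> i m"] by (simp add: Phi)
  have xx: "homogeneous \<gamma> k (free_var (GX \<sigma> i m) * free_var (GX \<tau> j n))"
    if "k = pm_sign \<sigma> * w i + m * e + (pm_sign \<tau> * w j + n * e)" for \<sigma> \<tau> i j m n k
    unfolding that by (rule homogeneous_mult[OF x x])
  have xp: "homogeneous \<gamma> k (free_var (GX \<sigma> i m) * free_var (GPhi \<tau> j n))"
    if "k = pm_sign \<sigma> * w i + m * e + n * e" for \<sigma> \<tau> i j m n k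
    unfolding that by (rule homogeneous_mult[OF x p])
  have px: "homogeneous \<gamma> k (free_var (GPhi \<tau> j n) * free_var (GX \<sigma> i m))"
    if "k = n * e + (pm_sign \<sigma> * w i + m * e)" for \<sigma> \<tau> i j m n k
    unfolding that by (rule homogeneous_mult[OF p x])
  have pp: "homogeneous \<gamma> k (free_var (GPhi \<sigma> i m) * free_var (GPhi \<tau> j n))"
    if "k = m * e + n * e" for \<sigma> \<tau> i j m n k
    unfolding that by (rule homogeneous_mult[OF p p])
  have p': "homogeneous \<gamma> k (free_var (GPhi \<epsilon> i m))" if "k = m * e" for \<epsilon> i m k
    unfolding that by (rule p)
  have one': "homogeneous \<gamma> k 1" if "k = 0" for k unfolding that by (rule homogeneous_one)
  note rules = homogeneous_diff homogeneous_scaleC homogeneous_zero xx xp px pp p' one'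
  from r show ?thesis
    unfolding drinfeld_relators_def Let_def
  proof (elim UnE)
    assume "r \<in> {free_var (GPhi Plus i m) |i m. m < 0}"
    then show ?thesis using p by blast
  next
    assume "r \<in> {free_var (GPhi Minus i m) |i m. m > 0}"
    then show ?thesis using p by blast
  next
    assume "r \<in> {free_var (GPhi Plus i 0) * free_var (GPhi Minus i 0) - 1 |i. True}"
    then have "homogeneous \<gamma> 0 r" by (auto intro!: rules)
    then show ?thesis ..
  next
    assume "r \<in> {free_var (GPhi \<epsilon> i m) * free_var (GPhi \<epsilon>' j n) -
      free_var (GPhi \<epsilon>' j n) * free_var (GPhi \<epsilon> i m) |\<epsilon> \<epsilon>' i j m n. True}"
    then show ?thesis
      by (elim CollectE exE conjE, hypsubst) (rule exI, intro rules refl, simp_all add: algebra_simps)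
  next
    assume "r \<in> {free_var (GX Plus i m) * free_var (GX Minus j n) -
      free_var (GX Minus j n) * free_var (GX Plus i m) -
         (if i = j then (1 / (q powi d i - inverse (q powi d i))) *\<^sub>C
            (free_var (GPhi Plus i (m + n)) - free_var (GPhi Minus i (m + n)))
          else 0) |i j m n. True}"
    then obtain i j m n where r: "r = free_var (GX Plus i m) * free_var (GX Minus j n) -
      free_var (GX Minus j n) * free_var (GX Plus i m) -
         (if i = j then (1 / (q powi d i - inverse (q powi d i))) *\<^sub>C
            (free_var (GPhi Plus i (m + n)) - free_var (GPhi Minus i (m + n)))
          else 0)" by blast
    have "homogeneous \<gamma> (w i - w j + (m + n) * e) r"
      unfolding r by (cases "i = j", simp_all only: if_True if_False simp_thms)
        (auto intro!: rules simp: distrib_right)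
    then show ?thesis ..
  next
    assume "r \<in> {free_var (GPhi \<epsilon> i (m + 1)) * free_var (GX \<sigma> j n) -
      q powi (pm_sign \<sigma> * (d i * C i j)) *\<^sub>C (free_var (GPhi \<epsilon> i m) * free_var (GX \<sigma> j (n + 1))) -
      (q powi (pm_sign \<sigma> * (d i * C i j)) *\<^sub>C (free_var (GX \<sigma> j n) * free_var (GPhi \<epsilon> i (m + 1))) -
       free_var (GX \<sigma> j (n + 1)) * free_var (GPhi \<epsilon> i m)) |\<epsilon> \<sigma> i j m n. True}"
    then show ?thesis
      by (elim CollectE exE conjE, hypsubst) (rule exI, intro rules refl, simp_all add: algebra_simps)
  next
    assume "r \<in> {free_var (GX \<sigma> i (m + 1)) * free_var (GX \<sigma> j n) -
      q powi (pm_sign \<sigma> * (d i * C i j)) *\<^sub>C (free_var (GX \<sigma> i m) * free_var (GX \<sigma> j (n + 1))) -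
      (q powi (pm_sign \<sigma> * (d i * C i j)) *\<^sub>C (free_var (GX \<sigma> j n) * free_var (GX \<sigma> i (m + 1))) -
       free_var (GX \<sigma> j (n + 1)) * free_var (GX \<sigma> i m)) |\<sigma> i j m n. True}"
    then show ?thesis
      by (elim CollectE exE conjE, hypsubst) (rule exI, intro rules refl, simp_all add: algebra_simps)
  next
    assume "r \<in> {serre_element (q powi d i) (C i j) (free_var (GX \<sigma> i 0)) (free_var (GX \<sigma> j 0)) |\<sigma> i j. i \<noteq> j}"
    then obtain k where "homogeneous \<gamma> k r"
      using homogeneous_serre[OF x x] by blast
    then show ?thesis ..
  qed
qed

definition word_weight :: "'i drinfeld_gen word \<Rightarrow> 'i \<Rightarrow> int"
  where "word_weight w i = (\<Sum>g\<leftarrow>letters w. gen_weight g i)"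

definition word_degree :: "'i drinfeld_gen word \<Rightarrow> int"
  where "word_degree w = (\<Sum>g\<leftarrow>letters w. gen_degree g)"

lemma word_weight_grading:
  assumes "presented_by D (drinfeld_relators C d q free_var)"
  shows "word_grading D (drinfeld_relators C d q free_var) word_weight"
proof
  fix r u v w w' assume r: "r \<in> drinfeld_relators C d q free_var"
    and w: "w \<in> Poly_Mapping.keys r" "w' \<in> Poly_Mapping.keys r"
  show "word_weight (u + w + v) = word_weight (u + w' + v)"
  proof
    fix i
    from r have "\<exists>k. homogeneous (\<lambda>g. gen_weight g i) k r"
      by (rule drinfeld_relators_homogeneous[rotated 2, where e = 0 and w = "\<lambda>j. simple_root j i"])
        simp_all
    with w have "word_weight w i = word_weight w' i"
      by (auto simp: homogeneous_def word_weight_def)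
    then show "word_weight (u + w + v) i = word_weight (u + w' + v) i"
      by (simp add: word_weight_def plus_word_def)
  qed
qed (rule assms)

lemma word_degree_grading:
  assumes "presented_by D (drinfeld_relators C d q free_var)"
  shows "word_grading D (drinfeld_relators C d q free_var) word_degree"
proof
  fix r u v w w' assume r: "r \<in> drinfeld_relators C d q free_var"
    and w: "w \<in> Poly_Mapping.keys r" "w' \<in> Poly_Mapping.keys r"
  from r have "\<exists>k. homogeneous gen_degree k r"
    by (rule drinfeld_relators_homogeneous[rotated 2, where w = "\<lambda>_. 0" and e = 1]) simp_all
  with w have "word_degree w = word_degree w'"
    by (auto simp: homogeneous_def word_degree_def)
  then show "word_degree (u + w + v) = word_degree (u + w' + v)"
    by (simp add: word_degree_def plus_word_def)
qed (rule assms)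

lemma weight_space_eq:
  assumes "presented_by D (drinfeld_relators C d q free_var)"
  shows "weight_space D = word_grading.graded_part D word_weight"
proof -
  interpret word_grading D "drinfeld_relators C d q free_var" word_weight
    by (rule word_weight_grading[OF assms])
  show ?thesis
    by (auto simp: fun_eq_iff weight_space_def graded_part_def word_weight_def word_eval_def
        intro!: arg_cong[where f = cspan]) (metis word.sel)+
qed

lemma degree_space_eq:
  assumes "presented_by D (drinfeld_relators C d q free_var)"
  shows "degree_space D = word_grading.graded_part D word_degree"
proof -
  interpret word_grading D "drinfeld_relators C d q free_var" word_degree
    by (rule word_degree_grading[OF assms])
  show ?thesis
    by (auto simp: fun_eq_iff degree_space_def graded_part_def word_degree_def word_eval_def
        intro!: arg_cong[where f = cspan]) (metis word.sel)+
qed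

section \<open>Logarithms of commutation relations\<close>

text \<open>The operator u d/du, which differentiates a series without shifting its indices.\<close>

definition euler :: "'a::ring_1 fps \<Rightarrow> 'a fps"
  where "euler f = Abs_fps (\<lambda>n. of_nat n * fps_nth f n)"

lemma euler_nth: "fps_nth (euler f) n = of_nat n * fps_nth f n"
  by (simp add: euler_def)

lemma euler_mult: "euler (f * g) = euler f * g + f * euler g"
proof (rule fps_ext)
  fix n
  have "of_nat n * (fps_nth f i * fps_nth g (n - i)) =
      of_nat i * fps_nth f i * fps_nth g (n - i) + fps_nth f i * (of_nat (n - i) * fps_nth g (n - i))"
    if "i \<in> {0..n}" for i
  proof -
    have "of_nat n = (of_nat i + of_nat (n - i) :: 'a)" using that by (simp flip: of_nat_add)
    moreover have "fps_nth f i * (of_nat (n - i) * x) = of_nat (n - i) * (fps_nth f i * x)" for x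
      by (metis mult.assoc mult_of_nat_commute)
    ultimately show ?thesis by (simp add: distrib_right mult.assoc)
  qed
  then show "fps_nth (euler (f * g)) n = fps_nth (euler f * g + f * euler g) n"
    by (simp add: fps_mult_nth euler_nth sum_distrib_left flip: sum.distrib)
qed

lemma euler_power_Suc:
  assumes "euler f * f = f * euler f"
  shows "euler (f ^ Suc k) = of_nat (Suc k) * (euler f * f ^ k)"
proof (induction k)
  case (Suc k)
  have comm: "f ^ k * euler f = euler f * f ^ k" for k
    
  proof (induction k)
    case (Suc k)
    have "f ^ Suc k * euler f = f * (f ^ k * euler f)" by (simp add: mult.assoc)
    also have "\<dots> = f * euler f * f ^ k" by (simp only: Suc mult.assoc)
    also have "\<dots> = euler f * f ^ Suc k" by (simp only: assms[symmetric] mult.assoc power_Suc)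
    finally show ?case .
  qed simp
  have "euler (f ^ Suc (Suc k)) = euler f * f ^ Suc k + f * euler (f ^ Suc k)"
    by (simp add: euler_mult)
  also have "f * euler (f ^ Suc k) = of_nat (Suc k) * (euler f * f ^ Suc k)"
  proof -
    have "f * (of_nat (Suc k) * y) = of_nat (Suc k) * (f * y)" for y
      by (metis mult.assoc mult_of_nat_commute)
    then have "f * euler (f ^ Suc k) = of_nat (Suc k) * (f * (euler f * f ^ k))" by (simp only: Suc)
    also have "f * (euler f * f ^ k) = euler f * f ^ Suc k"
      by (simp only: mult.assoc[symmetric] assms power_Suc)
    finally show ?thesis .
  qed
  finally show ?case by (simp add: distrib_right)
qed simp

lemma fps_mult_nth_0_low:
  fixes f :: "'a::ring_1 fps"
  assumes "fps_nth f 0 = 0" "n < k"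
  shows "fps_nth (f ^ k) n = 0"
  using assms(2)
proof (induction k arbitrary: n)
  case (Suc k)
  have "fps_nth f i * fps_nth (f ^ k) (n - i) = 0" if "i \<le> n" for i
  proof (cases "i = 0")
    case False
    then have "n - i < k" using that Suc.prems by simp
    then show ?thesis using Suc.IH by simp
  qed (simp add: assms(1))
  then show ?case by (simp add: fps_mult_nth)
qed simp

lemma exp_of_fps_nth_le:
  assumes "fps_nth f 0 = 0" "n \<le> m"
  shows "fps_nth (exp_of_fps f) n = (\<Sum>k\<le>m. (1 / fact k) *\<^sub>C fps_nth (f ^ k) n)"
  unfolding exp_of_fps_def fps_nth_Abs_fps
  using assms by (intro sum.mono_neutral_left) (auto simp: fps_mult_nth_0_low scaleC_zero_right)

lemma exp_of_fps_0: "fps_nth (exp_of_fps f) 0 = 1"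
  by (simp add: exp_of_fps_def scaleC_one)

lemma of_nat_scaleC: "of_nat n * x = of_nat n *\<^sub>C (x::'a::complex_algebra_1)"
  by (induction n) (simp_all add: scaleC_zero_left scaleC_add_left distrib_right scaleC_one)

lemma sum_scaleC: "c *\<^sub>C sum f S = (\<Sum>x\<in>S. c *\<^sub>C (f x :: 'a::complex_algebra_1))"
  by (induction S rule: infinite_finite_induct) (simp_all add: scaleC_zero_right scaleC_add_right)

text \<open>The coefficients live in a noncommutative ring; the usual formula for the derivative of
  \<open>f ^ k\<close> survives because \<open>f\<close> commutes with its own derivative.\<close>

lemma euler_exp_of_fps:
  fixes f :: "'a::complex_algebra_1 fps"
  assumes f0: "fps_nth f 0 = 0" and comm: "euler f * f = f * euler f"
  shows "euler (exp_of_fps f) = euler f * exp_of_fps f"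
proof (rule fps_ext)
  fix n
  show "fps_nth (euler (exp_of_fps f)) n = fps_nth (euler f * exp_of_fps f) n"
  proof (cases n)
    case 0
    then show ?thesis by (simp add: euler_nth)
  next
    case (Suc m)
    have "fps_nth (euler (exp_of_fps f)) n =
        (\<Sum>k\<le>Suc m. (1 / fact k) *\<^sub>C fps_nth (euler (f ^ k)) n)"
      by (simp add: euler_nth exp_of_fps_nth_le[OF f0, of "Suc m" "Suc m"] Suc sum_distrib_left
          mult_scaleC_right del: of_nat_Suc sum.atMost_Suc)
    also have "\<dots> = (\<Sum>k\<le>m. (1 / fact (Suc k)) *\<^sub>C fps_nth (euler (f ^ Suc k)) n)"
      by (subst sum.atMost_Suc_shift) (simp add: euler_nth Suc scaleC_zero_right)
    also have "\<dots> = (\<Sum>k\<le>m. (1 / fact k) *\<^sub>C fps_nth (euler f * f ^ k) n)"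
    proof (rule sum.cong)
      fix k
      have "fps_nth (of_nat (Suc k) * (euler f * f ^ k)) n = of_nat (Suc k) *\<^sub>C fps_nth (euler f * f ^ k) n"
        by (metis fps_mult_left_const_nth fps_of_nat of_nat_scaleC)
      then show "(1 / fact (Suc k)) *\<^sub>C fps_nth (euler (f ^ Suc k)) n =
          (1 / fact k) *\<^sub>C fps_nth (euler f * f ^ k) n"
        by (simp add: euler_power_Suc[OF comm] scaleC_scaleC del: power_Suc of_nat_Suc)
    qed simp
    also have "\<dots> = (\<Sum>k\<le>m. (1 / fact k) *\<^sub>C
        (\<Sum>i\<in>{0..n}. fps_nth (euler f) i * fps_nth (f ^ k) (n - i)))"
      by (simp add: fps_mult_nth)
    also have "\<dots> = (\<Sum>i\<in>{0..n}. fps_nth (euler f) i *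
        (\<Sum>k\<le>m. (1 / fact k) *\<^sub>C fps_nth (f ^ k) (n - i)))"
      by (simp only: sum_scaleC sum_distrib_left mult_scaleC_right) (rule sum.swap)
    \<comment> \<open>The inner sum stops at \<open>m = n - 1\<close>, which is enough for all
      \<open>i > 0\<close>; at \<open>i = 0\<close> the factor \<open>euler f\<close>
      vanishes.\<close>
    also have "\<dots> = (\<Sum>i\<in>{0..n}. fps_nth (euler f) i * fps_nth (exp_of_fps f) (n - i))"
    proof (rule sum.cong)
      fix i assume "i \<in> {0..n}"
      show "fps_nth (euler f) i * (\<Sum>k\<le>m. (1 / fact k) *\<^sub>C fps_nth (f ^ k) (n - i)) =
        fps_nth (euler f) i * fps_nth (exp_of_fps f) (n - i)"
      proof (cases "i = 0")
        case False
        then have "n - i \<le> m" using Suc by simp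
        then show ?thesis by (simp add: exp_of_fps_nth_le[OF f0])
      qed (simp add: euler_nth)
    qed simp
    finally show ?thesis by (simp add: fps_mult_nth)
  qed
qed

lemma fps_mult_right_cancel_unit:
  fixes f g h :: "'a::ring_1 fps"
  assumes "f * h = 0" "fps_nth h 0 = 1"
  shows "f = 0"
proof (rule fps_ext)
  fix n show "fps_nth f n = fps_nth 0 n"
  proof (induction n rule: less_induct)
    case (less n)
    have "0 = (\<Sum>i\<in>{0..n}. fps_nth f i * fps_nth h (n - i))"
      using arg_cong[OF assms(1), of "\<lambda>f. fps_nth f n"] by (simp add: fps_mult_nth)
    also have "\<dots> = (\<Sum>i\<in>{n}. fps_nth f i * fps_nth h (n - i))"
      using less by (intro sum.mono_neutral_right) auto
    finally show ?case using assms(2) by simp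
  qed
qed

text \<open>The n-th coefficient of the exponential is that of \<open>g\<close> plus a polynomial in
  lower coefficients of \<open>g\<close>, so commutation with \<open>x\<close> passes from
  \<open>\<Phi>\<close> to \<open>g\<close> by induction.\<close>

lemma commute_log:
  fixes \<Phi> g :: "'a::complex_algebra_1 fps"
  assumes \<Phi>: "\<Phi> = exp_of_fps g" and g0: "fps_nth g 0 = 0"
    and comm: "\<And>n. x * fps_nth \<Phi> n = fps_nth \<Phi> n * x"
  shows "x * fps_nth g n = fps_nth g n * x"
proof (induction n rule: less_induct)
  case (less n)
  show ?case
  proof (cases "n = 0")
    case False
    have low: "x * fps_nth (g ^ Suc (Suc k)) n = fps_nth (g ^ Suc (Suc k)) n * x" for k
    proof -
      have pw: "x * fps_nth (g ^ k) m = fps_nth (g ^ k) m * x" if "m < n" for k m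
        using that
      proof (induction k arbitrary: m)
        case (Suc k)
        have "x * (fps_nth g i * fps_nth (g ^ k) (m - i)) = fps_nth g i * fps_nth (g ^ k) (m - i) * x"
          if "i \<le> m" for i
        proof -
          have "x * fps_nth g i = fps_nth g i * x" using less that Suc.prems by simp
          moreover have "x * fps_nth (g ^ k) (m - i) = fps_nth (g ^ k) (m - i) * x"
            using Suc.prems by (intro Suc.IH) simp
          ultimately show ?thesis by (metis mult.assoc)
        qed
        then show ?case by (simp add: fps_mult_nth sum_distrib_left sum_distrib_right)
      qed simp
      have "x * (fps_nth g i * fps_nth (g ^ Suc k) (n - i)) = fps_nth g i * fps_nth (g ^ Suc k) (n - i) * x"
        if "i \<le> n" for i
      proof (cases "i = 0 \<or> i = n")
        case True
        then show ?thesis using g0 by (auto simp: fps_mult_nth_0_low)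
      next
        case False
        then have "x * fps_nth g i = fps_nth g i * x" "x * fps_nth (g ^ Suc k) (n - i) = fps_nth (g ^ Suc k) (n - i) * x"
          using that by (auto intro!: less pw simp del: power_Suc)
        then show ?thesis by (metis mult.assoc)
      qed
      then show ?thesis
        by (subst (1 2) power_Suc) (simp add: fps_mult_nth sum_distrib_left sum_distrib_right del: power_Suc)
    qed
    define S where "S = (\<Sum>k\<in>{2..n}. (1 / fact k) *\<^sub>C fps_nth (g ^ k) n)"
    have "{..n} = {0, 1} \<union> {2..n}" using False by auto
    then have "fps_nth \<Phi> n = fps_nth g n + S"
      unfolding \<Phi> S_def exp_of_fps_def fps_nth_Abs_fps
      using False by (subst \<open>{..n} = _\<close>, subst sum.union_disjoint) (auto simp: scaleC_one scaleC_zero_right)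
    moreover have "x * S = S * x"
      unfolding S_def sum_distrib_left sum_distrib_right
    proof (rule sum.cong)
      fix k assume "k \<in> {2..n}"
      then obtain l where "k = Suc (Suc l)" by (metis atLeastAtMost_iff le_Suc_ex add_2_eq_Suc)
      with low[of l] show "x * (1 / fact k) *\<^sub>C fps_nth (g ^ k) n = (1 / fact k) *\<^sub>C fps_nth (g ^ k) n * x"
        by (simp only: mult_scaleC_left mult_scaleC_right)
    qed simp
    ultimately show ?thesis using comm[of n] by (simp add: distrib_left distrib_right)
  qed (simp add: g0)
qed

text \<open>
  The hypothesis \<open>rel\<close> says \<open>\<Phi>(u) x\<^sub>n = G(u T) x\<^sub>n \<Phi>(u)\<close> with \<open>G(y) = (1 - y / Q) / (1 - Q y)\<close> and \<open>T\<close> the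
  shift of the sequence \<open>x\<close>; the conclusion is the coefficientwise logarithm of this identity.
\<close>

lemma commutator_log:
  fixes \<Phi> g :: "'a::complex_algebra_1 fps" and x :: "int \<Rightarrow> 'a"
  assumes \<Phi>: "\<Phi> = exp_of_fps g" and g0: "fps_nth g 0 = 0" and gg: "euler g * g = g * euler g"
    and Q: "Q \<noteq> 0"
    and rel: "\<And>m n. fps_nth \<Phi> (Suc m) * x n - Q *\<^sub>C (fps_nth \<Phi> m * x (n + 1)) =
      x n * fps_nth \<Phi> (Suc m) - inverse Q *\<^sub>C (x (n + 1) * fps_nth \<Phi> m)"
    and N: "N > 0"
  shows "of_nat N *\<^sub>C (fps_nth g N * x n - x n * fps_nth g N) = (Q ^ N - inverse Q ^ N) *\<^sub>C x (n + int N)"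
proof -
  \<comment> \<open>The Taylor coefficients of (1 - y / Q) / (1 - Q y).\<close>
  define G where "G k = (if k = 0 then 1 else (Q - inverse Q) * Q ^ (k - 1))" for k :: nat
  have \<Phi>0: "fps_nth \<Phi> 0 = 1" by (simp add: \<Phi> exp_of_fps_0)
  have G_Suc: "G (Suc k) = Q * G k - (if k = 0 then inverse Q else 0)" for k
    by (cases k) (simp_all add: G_def)
  define Z where "Z n = Abs_fps (\<lambda>k. G k *\<^sub>C x (n + int k))" for n
  have Zn: "fps_nth (Z n) k = G k *\<^sub>C x (n + int k)" for n k by (simp add: Z_def)
  have rel2: "fps_nth \<Phi> m * x n = fps_nth (Z n * \<Phi>) m" for m n
  proof (induction m arbitrary: n)
    case 0
    show ?case by (simp add: \<Phi>0 Zn G_def scaleC_one)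
  next
    case (Suc m)
    have "fps_nth (Z n * \<Phi>) (Suc m) =
        (\<Sum>k\<in>{0..Suc m}. G k *\<^sub>C (x (n + int k) * fps_nth \<Phi> (Suc m - k)))"
      by (simp add: fps_mult_nth Zn mult_scaleC_left del: sum.atLeast0_atMost_Suc)
    also have "\<dots> = x n * fps_nth \<Phi> (Suc m) +
        (\<Sum>k\<in>{0..m}. G (Suc k) *\<^sub>C (x (n + 1 + int k) * fps_nth \<Phi> (m - k)))"
      by (subst sum.atLeast0_atMost_Suc_shift) (simp add: G_def scaleC_one add_ac)
    also have "(\<Sum>k\<in>{0..m}. G (Suc k) *\<^sub>C (x (n + 1 + int k) * fps_nth \<Phi> (m - k))) =
        (\<Sum>k\<in>{0..m}. Q *\<^sub>C G k *\<^sub>C (x (n + 1 + int k) * fps_nth \<Phi> (m - k)) -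
          (if k = 0 then inverse Q *\<^sub>C (x (n + 1) * fps_nth \<Phi> m) else 0))"
    proof (rule sum.cong)
      fix k
      have "(a - b) *\<^sub>C y = a *\<^sub>C y - b *\<^sub>C (y::'a)" for a b y
        using scaleC_add_left[of "a - b" b y] by (simp add: algebra_simps)
      then show "G (Suc k) *\<^sub>C (x (n + 1 + int k) * fps_nth \<Phi> (m - k)) =
        Q *\<^sub>C G k *\<^sub>C (x (n + 1 + int k) * fps_nth \<Phi> (m - k)) -
          (if k = 0 then inverse Q *\<^sub>C (x (n + 1) * fps_nth \<Phi> m) else 0)"
        by (simp add: G_Suc scaleC_scaleC scaleC_zero_left)
    qed simp
    also have "\<dots> = Q *\<^sub>C fps_nth (Z (n + 1) * \<Phi>) m - inverse Q *\<^sub>C (x (n + 1) * fps_nth \<Phi> m)"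
      by (simp add: sum_subtractf sum_scaleC fps_mult_nth Zn mult_scaleC_left)
    finally have "fps_nth (Z n * \<Phi>) (Suc m) = x n * fps_nth \<Phi> (Suc m) +
        (Q *\<^sub>C fps_nth (Z (n + 1) * \<Phi>) m - inverse Q *\<^sub>C (x (n + 1) * fps_nth \<Phi> m))" .
    moreover have "fps_nth \<Phi> (Suc m) * x n = x n * fps_nth \<Phi> (Suc m) +
        (Q *\<^sub>C (fps_nth \<Phi> m * x (n + 1)) - inverse Q *\<^sub>C (x (n + 1) * fps_nth \<Phi> m))"
      using rel[of m n] by (simp add: algebra_simps)
    ultimately show ?case by (simp only: Suc)
  qed
  have "\<Phi> * fps_const (x n) = Z n * \<Phi>" for n
    by (rule fps_ext) (simp add: rel2)
  then have rel3: "\<Phi> * fps_const (x n) = Z n * \<Phi>" for n .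
  define \<Gamma> where "\<Gamma> = euler g"
  have e\<Phi>: "euler \<Phi> = \<Gamma> * \<Phi>" unfolding \<Phi> \<Gamma>_def by (rule euler_exp_of_fps[OF g0 gg])
  \<comment> \<open>Apply \<open>euler\<close> to both sides of \<open>rel3\<close>; the factor
    \<open>\<Phi>\<close> then stands on the right of every term and cancels, leaving a linear
    equation for the commutators with \<open>\<Gamma>\<close>.\<close>
  have "(\<Gamma> * Z n - Z n * \<Gamma> - euler (Z n)) * \<Phi> = 0" for n
  proof -
    have "euler (fps_const c) = 0" for c :: 'a
      by (rule fps_ext) (simp add: euler_nth)
    then have "euler (\<Phi> * fps_const (x n)) = \<Gamma> * (\<Phi> * fps_const (x n))"
      by (simp add: euler_mult e\<Phi> mult.assoc)
    then have "euler (Z n * \<Phi>) = \<Gamma> * (Z n * \<Phi>)" by (simp only: rel3)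
    then show ?thesis by (simp add: euler_mult e\<Phi> algebra_simps)
  qed
  then have Z: "\<Gamma> * Z n - Z n * \<Gamma> - euler (Z n) = 0" for n
    using fps_mult_right_cancel_unit \<Phi>0 by blast
  have key: "(\<Sum>l\<in>{0..M}. G l *\<^sub>C (fps_nth \<Gamma> (M - l) * x (n + int l) - x (n + int l) * fps_nth \<Gamma> (M - l)))
     = (of_nat M * G M) *\<^sub>C x (n + int M)" for M n
  proof -
    have "fps_nth (\<Gamma> * Z n) M = (\<Sum>l\<in>{0..M}. fps_nth \<Gamma> (M - l) * fps_nth (Z n) l)"
      unfolding fps_mult_nth by (rule sum.reindex_bij_witness[of _ "\<lambda>l. M - l" "\<lambda>l. M - l"]) auto
    moreover have "c *\<^sub>C (a - b) = c *\<^sub>C a - c *\<^sub>C (b::'a)" for a b c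
      using scaleC_add_right[of c "a - b" b] by (simp add: algebra_simps)
    ultimately show ?thesis
      using arg_cong[OF Z, of "\<lambda>f. fps_nth f M" n]
      by (simp add: fps_mult_nth[of "Z n"] sum_subtractf Zn euler_nth mult_scaleC_left mult_scaleC_right
          of_nat_scaleC scaleC_scaleC scaleC_complex_def mult.commute)
  qed
  \<comment> \<open>The coefficients of the identity euler G = G * euler (log G), where euler (log
    G) has M-th coefficient \<open>Q ^ M - inverse Q ^ M\<close>. It says that the expected
    commutators solve the convolution equation \<open>key\<close>.\<close>
  have scal: "(\<Sum>l\<in>{1..<M}. G l * (Q ^ (M - l) - inverse Q ^ (M - l))) + (Q ^ M - inverse Q ^ M) = of_nat M * G M"
    if pos: "M > 0" for M
  proof -
    obtain k where M: "M = Suc k" using pos by (cases M) auto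
    have "G l * Q ^ (Suc k - l) = (Q - inverse Q) * Q ^ k" if "l \<in> {1..<Suc k}" for l
    proof -
      have "Q ^ (l - 1) * Q ^ (Suc k - l) = Q ^ k" using that by (simp flip: power_add)
      then show ?thesis using that by (simp add: G_def)
    qed
    then have 1: "(\<Sum>l\<in>{1..<Suc k}. G l * Q ^ (Suc k - l)) = of_nat k * ((Q - inverse Q) * Q ^ k)"
      by simp
    have h: "G l * inverse Q ^ (Suc k - l) = inverse Q ^ Suc k * (G l * Q ^ l)" if "l \<in> {1..<Suc k}" for l
      using that Q by (simp add: power_diff power_inverse field_simps)
    have 2: "(\<Sum>l\<in>{1..<Suc k}. G l * inverse Q ^ (Suc k - l)) =
        inverse Q ^ Suc k * (\<Sum>l\<in>{1..<Suc k}. G l * Q ^ l)"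
      unfolding sum_distrib_left by (rule sum.cong) (simp_all only: h)
    have 3: "(\<Sum>l\<in>{1..<Suc k}. G l * Q ^ l) = Q ^ (2 * k) - 1"
    proof (induction k)
      case (Suc k)
      have "G (Suc k) * Q ^ Suc k = Q ^ (2 * Suc k) - Q ^ (2 * k)"
        using Q by (simp add: G_def field_simps power_add mult_2 mult_2_right)
      moreover have "(\<Sum>l\<in>{1..<Suc (Suc k)}. G l * Q ^ l) = (\<Sum>l\<in>{1..<Suc k}. G l * Q ^ l) + G (Suc k) * Q ^ Suc k"
        by (rule sum.atLeastLessThan_Suc) simp
      ultimately show ?case using Suc by simp
    qed simp
    have 4: "inverse Q ^ Suc k * (Q ^ (2 * k) - 1) = Q ^ k * inverse Q - inverse Q ^ Suc k"
      using Q by (simp add: field_simps mult_2 mult_2_right power_add power_inverse)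
    show ?thesis
      unfolding M right_diff_distrib sum_subtractf 1 2 3 4
      using Q by (simp add: G_def field_simps power_add mult_2 mult_2_right)
  qed
  \<comment> \<open>In \<open>key\<close> the term \<open>l = 0\<close> is the wanted commutator
    because \<open>G 0 = 1\<close>, the term \<open>l = N\<close> is zero, and those in between are
    known by induction.\<close>
  have "fps_nth \<Gamma> N * x n - x n * fps_nth \<Gamma> N = (Q ^ N - inverse Q ^ N) *\<^sub>C x (n + int N)" for n
    using N
  proof (induction N arbitrary: n rule: less_induct)
    case (less N)
    let ?c = "\<lambda>l. G l *\<^sub>C (fps_nth \<Gamma> (N - l) * x (n + int l) - x (n + int l) * fps_nth \<Gamma> (N - l))"
    have "{0..N} = {0, N} \<union> {1..<N}" using less.prems by auto
    then have "(\<Sum>l\<in>{0..N}. ?c l) = ?c 0 + ?c N + (\<Sum>l\<in>{1..<N}. ?c l)"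
      using less.prems by (subst \<open>{0..N} = _\<close>, subst sum.union_disjoint) auto
    moreover have "?c N = 0" by (simp add: \<Gamma>_def euler_nth scaleC_zero_right)
    moreover have "?c l = (G l * (Q ^ (N - l) - inverse Q ^ (N - l))) *\<^sub>C x (n + int N)" if "l \<in> {1..<N}" for l
      using that less.IH[of "N - l" "n + int l"] by (simp add: scaleC_scaleC)
    moreover have "sum f S *\<^sub>C y = (\<Sum>l\<in>S. f l *\<^sub>C (y::'a))" for f :: "nat \<Rightarrow> complex" and S y
      by (induction S rule: infinite_finite_induct) (simp_all add: scaleC_zero_left scaleC_add_left)
    ultimately have "?c 0 + (\<Sum>l\<in>{1..<N}. G l * (Q ^ (N - l) - inverse Q ^ (N - l))) *\<^sub>C x (n + int N) =
        (of_nat N * G N) *\<^sub>C x (n + int N)"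
      using key[of N n] by simp
    then have "?c 0 + (\<Sum>l\<in>{1..<N}. G l * (Q ^ (N - l) - inverse Q ^ (N - l))) *\<^sub>C x (n + int N) =
        (\<Sum>l\<in>{1..<N}. G l * (Q ^ (N - l) - inverse Q ^ (N - l))) *\<^sub>C x (n + int N) +
        (Q ^ N - inverse Q ^ N) *\<^sub>C x (n + int N)"
      by (simp add: scal[OF less.prems, symmetric] scaleC_add_left)
    then show ?case by (simp add: G_def scaleC_one)
  qed
  moreover have "c *\<^sub>C (a - b) = c *\<^sub>C a - c *\<^sub>C (b::'a)" for a b c
    using scaleC_add_right[of c "a - b" b] by (simp add: algebra_simps)
  ultimately show ?thesis by (simp add: \<Gamma>_def euler_nth of_nat_scaleC mult_scaleC_left mult_scaleC_right)
qed

section \<open>Invertibility of the quantized form\<close>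

lemma not_root_of_unity_inj:
  assumes "not_root_of_unity q"
  shows "inj (\<lambda>s::nat. q ^ s)"
proof (rule linorder_injI)
  fix s t :: nat assume "s < t"
  show "q ^ s \<noteq> q ^ t"
  proof
    assume "q ^ s = q ^ t"
    moreover have "q ^ t = q ^ s * q ^ (t - s)" using \<open>s < t\<close> by (simp flip: power_add)
    ultimately have "q ^ (t - s) = 1" using assms by (simp add: not_root_of_unity_def)
    then show False using assms \<open>s < t\<close> by (simp add: not_root_of_unity_def)
  qed
qed

lemma degree_monom_diff:
  assumes "A < B"
  shows "degree (monom 1 B - monom 1 A :: complex poly) = B"
    and "lead_coeff (monom 1 B - monom 1 A :: complex poly) = 1"
proof -
  have "degree (monom 1 B + - monom 1 A :: complex poly) = degree (monom (1 :: complex) B)"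
    by (rule degree_add_eq_left) (simp add: degree_monom_eq assms)
  then show "degree (monom 1 B - monom 1 A :: complex poly) = B" by (simp add: degree_monom_eq)
  with assms show "lead_coeff (monom 1 B - monom 1 A :: complex poly) = 1" by simp
qed

text \<open>The diagonal product has strictly larger degree than all other terms of the determinant.\<close>

lemma det_quantum_form_nonzero:
  fixes b :: "'i::finite \<Rightarrow> 'i \<Rightarrow> int"
  assumes diag: "\<And>i. b i i = 2 * d i" "\<And>i. d i > 0"
    and off: "\<And>i j. i \<noteq> j \<Longrightarrow> \<bar>b i j\<bar> < d i + d j"
    and N: "\<And>i j. \<bar>b i j\<bar> \<le> int N"
  shows "det (\<chi> i j. (monom 1 (nat (int N + b i j)) - monom 1 (nat (int N - b i j)) :: complex poly)) \<noteq> 0"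
proof -
  let ?a = "\<lambda>i j. monom 1 (nat (int N + b i j)) - monom 1 (nat (int N - b i j)) :: complex poly"
  define T where "T = (\<Sum>i\<in>UNIV. nat (int N + 2 * d i))"
  have a_diag: "degree (?a i i) = nat (int N + 2 * d i)" "lead_coeff (?a i i) = 1" for i
  proof -
    have "nat (int N - b i i) < nat (int N + b i i)" using diag[of i] N[of i i] by simp
    from degree_monom_diff[OF this]
    show "degree (?a i i) = nat (int N + 2 * d i)" "lead_coeff (?a i i) = 1"
      by (simp_all only: diag(1))
  qed
  have a_deg: "degree (?a i j) \<le> nat (int N + \<bar>b i j\<bar>)" for i j
    by (rule degree_diff_le) (auto intro!: order_trans[OF degree_monom_le])
  have a_off: "degree (\<Prod>i\<in>UNIV. ?a i (p i)) < T" if p: "p permutes UNIV" "p \<noteq> id" for p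
  proof -
    obtain k where k: "p k \<noteq> k" using p(2) by (metis eq_id_iff)
    have "degree (\<Prod>i\<in>UNIV. ?a i (p i)) \<le> (\<Sum>i\<in>UNIV. degree (?a i (p i)))"
      using degree_prod_sum_le[of UNIV "\<lambda>i. ?a i (p i)"] by (simp add: o_def)
    also have "\<dots> \<le> (\<Sum>i\<in>UNIV. nat (int N + \<bar>b i (p i)\<bar>))"
      by (intro sum_mono a_deg)
    also have "\<dots> < T"
    proof -
      \<comment> \<open>The bound \<open>d i + d (p i)\<close> is attained at fixed points of
        \<open>p\<close> and is strict at a moved index; as \<open>p\<close> is a permutation, its
        sum is twice the sum of \<open>d\<close>.\<close>
      have "(\<Sum>i\<in>UNIV. int N + \<bar>b i (p i)\<bar>) < (\<Sum>i\<in>UNIV. int N + (d i + d (p i)))"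
      proof (rule sum_strict_mono_ex1)
        show "\<forall>i\<in>UNIV. int N + \<bar>b i (p i)\<bar> \<le> int N + (d i + d (p i))"
        proof
          fix i show "int N + \<bar>b i (p i)\<bar> \<le> int N + (d i + d (p i))"
            using diag[of i] off[of i "p i"] by (cases "p i = i") auto
        qed
        show "\<exists>i\<in>UNIV. int N + \<bar>b i (p i)\<bar> < int N + (d i + d (p i))"
          using off[of k "p k"] k by force
      qed simp
      also have "\<dots> = (\<Sum>i\<in>UNIV. int N + d i) + (\<Sum>i\<in>UNIV. d (p i))"
        by (simp add: sum.distrib)
      also have "(\<Sum>i\<in>UNIV. d (p i)) = (\<Sum>i\<in>UNIV. d i)"
        using sum.permute[OF p(1), of d] by (simp add: o_def)
      also have "(\<Sum>i\<in>UNIV. int N + d i) + (\<Sum>i\<in>UNIV. d i) = (\<Sum>i\<in>UNIV. int N + 2 * d i)"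
        by (simp add: sum.distrib flip: sum_distrib_left)
      also have "\<dots> = int T"
        unfolding T_def of_nat_sum using diag(2) by (intro sum.cong) (simp_all add: less_imp_le)
      finally have "int (\<Sum>i\<in>UNIV. nat (int N + \<bar>b i (p i)\<bar>)) < int T" by simp
      then show ?thesis by (simp only: of_nat_less_iff)
    qed
    finally show ?thesis .
  qed
  have "coeff (det (\<chi> i j. ?a i j)) T =
      (\<Sum>p\<in>{p. p permutes UNIV}. coeff (of_int (sign p) * (\<Prod>i\<in>UNIV. ?a i (p i))) T)"
    by (simp add: det_def coeff_sum)
  also have "\<dots> = (\<Sum>p\<in>{id}. coeff (of_int (sign p) * (\<Prod>i\<in>UNIV. ?a i (p i))) T)"
  proof (rule sum.mono_neutral_right)
    show "\<forall>p\<in>{p. p permutes UNIV} - {id}. coeff (of_int (sign p) * (\<Prod>i\<in>UNIV. ?a i (p i))) T = 0"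
    proof
      fix p :: "'i \<Rightarrow> 'i" assume "p \<in> {p. p permutes UNIV} - {id}"
      then have "degree (\<Prod>i\<in>UNIV. ?a i (p i)) < T" using a_off by auto
      then have "coeff (\<Prod>i\<in>UNIV. ?a i (p i)) T = 0" by (rule coeff_eq_0)
      then show "coeff (of_int (sign p) * (\<Prod>i\<in>UNIV. ?a i (p i))) T = 0"
        by (simp add: of_int_poly)
    qed
  qed (simp_all add: permutes_id)
  finally have top: "coeff (det (\<chi> i j. ?a i j)) T = coeff (\<Prod>i\<in>UNIV. ?a i i) T"
    by (simp add: sign_id)
  have T: "T = degree (\<Prod>i\<in>UNIV. ?a i i)"
  proof -
    have nz: "?a i i \<noteq> 0" for i using a_diag(2)[of i] leading_coeff_0_iff[of "?a i i"] by simp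
    have "degree (\<Prod>i\<in>UNIV. ?a i i) = (\<Sum>i\<in>UNIV. degree (?a i i))"
    proof (intro degree_prod_eq_sum_degree ballI)
      fix i show "?a i i \<noteq> 0" by (rule nz)
    qed
    then show ?thesis unfolding T_def a_diag(1) by (rule HOL.sym)
  qed
  have "coeff (\<Prod>i\<in>UNIV. ?a i i) T = lead_coeff (\<Prod>i\<in>UNIV. ?a i i)"
    by (subst T) (rule HOL.refl)
  also have "\<dots> = 1"
    by (simp only: lead_coeff_prod a_diag(2) prod.neutral_const)
  finally have "coeff (det (\<chi> i j. ?a i j)) T = 1" by (simp only: top)
  then show ?thesis by (intro notI) (simp only: coeff_0 zero_neq_one)
qed

text \<open>Multiplication by the N-th power of x turns the entries x^b - x^(-b) into polynomials in
  x. Their determinant is a nonzero polynomial, and \<open>q ^ s\<close> meets its finitely many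
  roots for finitely many \<open>s\<close> only, the powers of \<open>q\<close> being
  distinct.\<close>

lemma quantum_form_left_inverse:
  fixes b :: "'i::finite \<Rightarrow> 'i \<Rightarrow> int"
  assumes q: "not_root_of_unity q"
    and diag: "\<And>i. b i i = 2 * d i" "\<And>i. d i > 0"
    and off: "\<And>i j. i \<noteq> j \<Longrightarrow> \<bar>b i j\<bar> < d i + d j"
  obtains s0 where "\<And>s. s \<ge> s0 \<Longrightarrow> \<exists>B. \<forall>l j.
    (\<Sum>i\<in>UNIV. B l i * (q powi (int s * b i j) - q powi (- (int s * b i j)))) = (if l = j then 1 else 0)"
proof -
  define N where "N = nat (\<Sum>i\<in>UNIV. \<Sum>j\<in>UNIV. \<bar>b i j\<bar>)"
  have N: "\<bar>b i j\<bar> \<le> int N" for i j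
  proof -
    have "\<bar>b i j\<bar> \<le> (\<Sum>j\<in>UNIV. \<bar>b i j\<bar>)" by (rule member_le_sum) simp_all
    also have "\<dots> \<le> (\<Sum>i\<in>UNIV. \<Sum>j\<in>UNIV. \<bar>b i j\<bar>)"
      by (rule member_le_sum) (simp_all add: sum_nonneg)
    finally show ?thesis unfolding N_def by linarith
  qed
  define A where "A = (\<chi> i j. (monom 1 (nat (int N + b i j)) - monom 1 (nat (int N - b i j)) :: complex poly))"
  have "det A \<noteq> 0" unfolding A_def using diag off N by (rule det_quantum_form_nonzero)
  then have "finite {x. poly (det A) x = 0}" by (rule poly_roots_finite)
  then have "finite ((\<lambda>s. q ^ s) -` {x. poly (det A) x = 0})"
    by (rule finite_vimageI) (rule not_root_of_unity_inj[OF q])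
  then obtain s0 where s0: "poly (det A) (q ^ s) \<noteq> 0" if "s \<ge> s0" for s
    by (metis (mono_tags, lifting) finite_nat_set_iff_bounded linorder_not_less mem_Collect_eq vimageI)
  show ?thesis
  proof
    fix s assume "s \<ge> s0"
    define M where "M = (\<chi> i j. poly (A $ i $ j) (q ^ s))"
    have "poly (det A) (q ^ s) = det M"
      by (simp add: det_def M_def poly_sum poly_prod)
    with s0[OF \<open>s \<ge> s0\<close>] have "invertible M" by (simp add: invertible_det_nz)
    then obtain M' where M': "M' ** M = mat 1" by (auto simp: invertible_def)
    have q0: "q \<noteq> 0" using q by (simp add: not_root_of_unity_def)
    have M: "M $ i $ j = q ^ (s * N) * (q powi (int s * b i j) - q powi (- (int s * b i j)))" for i j
    proof -
      have pw: "(q ^ s) ^ nat (int N + c) = q ^ (s * N) * q powi (int s * c)" if "\<bar>c\<bar> \<le> int N" for c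
      proof -
        have "(q ^ s) ^ nat (int N + c) = q powi (int s * int (nat (int N + c)))"
          by (simp only: power_int_of_nat power_mult flip: of_nat_mult)
        also have "int s * int (nat (int N + c)) = int (s * N) + int s * c"
          using that by (simp add: distrib_left)
        finally show ?thesis using q0 by (simp only: power_int_add simp_thms power_int_of_nat)
      qed
      show ?thesis
        using pw[OF N[of i j]] pw[of "- b i j"] N[of i j]
        by (simp add: M_def A_def poly_monom right_diff_distrib)
    qed
    show "\<exists>B. \<forall>l j.
      (\<Sum>i\<in>UNIV. B l i * (q powi (int s * b i j) - q powi (- (int s * b i j)))) = (if l = j then 1 else 0)"
    proof (intro exI allI)
      fix l j
      have "(\<Sum>i\<in>UNIV. M' $ l $ i * q ^ (s * N) * (q powi (int s * b i j) - q powi (- (int s * b i j)))) =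
        (M' ** M) $ l $ j"
        by (simp add: matrix_matrix_mult_def M mult.assoc)
      then show "(\<Sum>i\<in>UNIV. M' $ l $ i * q ^ (s * N) * (q powi (int s * b i j) - q powi (- (int s * b i j)))) =
        (if l = j then 1 else 0)"
        by (simp add: M' mat_def)
    qed
  qed
qed

section \<open>Linear recurrences and interpolation\<close>

text \<open>The variable of the polynomial acts as the shift. The sequences are two-sided, so the
  shift is invertible on them; this is what later excludes the characteristic root 0.\<close>

definition shift_act :: "'f::comm_ring_1 poly \<Rightarrow> (int \<Rightarrow> 'f) \<Rightarrow> int \<Rightarrow> 'f"
  where "shift_act p x m = (\<Sum>k\<le>degree p. coeff p k * x (m + int k))"

lemma shift_act_eq:
  assumes "degree p \<le> n"
  shows "shift_act p x m = (\<Sum>k\<le>n. coeff p k * x (m + int k))"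
  unfolding shift_act_def using assms
  by (intro sum.mono_neutral_left) (auto simp: coeff_eq_0)

lemma shift_act_0: "shift_act 0 x m = 0"
  by (simp add: shift_act_def)

lemma shift_act_add: "shift_act (p + r) x m = shift_act p x m + shift_act r x m"
proof -
  let ?n = "max (degree p) (degree r)"
  have "degree (p + r) \<le> ?n" by (rule degree_add_le_max)
  then show ?thesis
    by (simp add: shift_act_eq[of _ ?n] distrib_right sum.distrib)
qed

lemma shift_act_smult: "shift_act (smult c p) x m = c * shift_act p x m"
  by (subst shift_act_eq[OF degree_smult_le]) (simp add: shift_act_def sum_distrib_left mult.assoc)

lemma shift_act_pCons: "shift_act (pCons c p) x m = c * x m + shift_act p x (m + 1)"
  by (subst shift_act_eq[of _ "Suc (degree p)"])
    (simp_all add: degree_pCons_le sum.atMost_Suc_shift shift_act_def add_ac del: sum.atMost_Suc)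

lemma shift_act_mult: "shift_act (p * r) x = shift_act p (shift_act r x)"
proof (rule ext)
  fix m show "shift_act (p * r) x m = shift_act p (shift_act r x) m"
    by (induction p arbitrary: m)
      (simp_all add: shift_act_0 shift_act_pCons shift_act_add shift_act_smult)
qed

lemma shift_act_zero_seq: "shift_act p (\<lambda>_. 0) m = 0"
  by (simp add: shift_act_def)

lemma shift_act_linear: "shift_act [:- a, 1:] x m = x (m + 1) - a * x m"
  by (simp add: shift_act_pCons shift_act_0)

lemma shift_act_1: "shift_act 1 x = x"
  by (simp add: fun_eq_iff shift_act_def)

lemma shift_act_dvd:
  assumes "shift_act p x = (\<lambda>_. 0)" "p dvd r"
  shows "shift_act r x = (\<lambda>_. 0)"
proof -
  from assms(2) obtain s where "r = s * p" by (metis dvdE mult.commute)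
  then show ?thesis by (simp only: shift_act_mult assms(1)) (simp add: fun_eq_iff shift_act_zero_seq)
qed

definition root_poly :: "'f::comm_ring_1 list \<Rightarrow> 'f poly"
  where "root_poly as = prod_list (map (\<lambda>a. [:- a, 1:]) as)"

lemma root_poly_simps:
  "root_poly [] = 1" "root_poly (a # as) = [:- a, 1:] * root_poly as"
  by (simp_all add: root_poly_def)

lemma root_poly_append: "root_poly (as @ bs) = root_poly as * root_poly bs"
  by (simp add: root_poly_def)

lemma root_poly_remove1:
  "a \<in> set as \<Longrightarrow> root_poly as = [:- a, 1:] * root_poly (remove1 a as)"
proof (induction as)
  case (Cons b as)
  show ?case
  proof (cases "a = b")
    case False
    then have "root_poly (b # as) = [:- b, 1:] * ([:- a, 1:] * root_poly (remove1 a as))"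
      using Cons by (simp only: root_poly_simps) (simp only: set_simps insert_iff simp_thms)
    also have "\<dots> = [:- a, 1:] * ([:- b, 1:] * root_poly (remove1 a as))"
      by (rule mult.left_commute)
    also have "\<dots> = [:- a, 1:] * root_poly (remove1 a (b # as))"
      using False by (simp only: root_poly_simps remove1.simps if_False)
    finally show ?thesis .
  qed (simp add: root_poly_simps)
qed simp

abbreviation annihilates :: "complex list \<Rightarrow> (int \<Rightarrow> complex) \<Rightarrow> bool"
  where "annihilates as x \<equiv> shift_act (root_poly as) x = (\<lambda>_. 0)"

text \<open>A witness that \<open>a\<close> really occurs in \<open>x\<close>: some combination of
  shifts of \<open>x\<close> is a nonzero geometric sequence of ratio \<open>a\<close>. It will
  force a pole of the generating series at \<open>inverse a\<close>.\<close>

abbreviation geometric_root :: "(int \<Rightarrow> complex) \<Rightarrow> complex \<Rightarrow> bool"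
  where "geometric_root x a \<equiv>
    \<exists>r. shift_act r x \<noteq> (\<lambda>_. 0) \<and> (\<forall>m. shift_act r x (m + 1) = a * shift_act r x m)"

text \<open>Factor \<open>p\<close> and take a list of roots of minimal length that annihilates all
  sequences at once. Omitting one root \<open>a\<close> leaves, for some \<open>k\<close>, a nonzero
  sequence, and the omitted factor makes it geometric of ratio \<open>a\<close>.\<close>

lemma minimal_annihilator:
  fixes x :: "'k \<Rightarrow> int \<Rightarrow> complex"
  assumes "p \<noteq> 0" "\<And>k. shift_act p (x k) = (\<lambda>_. 0)"
  obtains as where "\<And>k. annihilates as (x k)" "0 \<notin> set as"
    and "\<And>a. a \<in> set as \<Longrightarrow>
      \<exists>k. geometric_root (x k) a"
proof -
  define P where "P as \<longleftrightarrow> (\<forall>k. annihilates as (x k))" for as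
  obtain A where A: "p = smult (lead_coeff p) (\<Prod>a\<in>#A. [:- a, 1:])"
    using alg_closed_imp_factorization[OF assms(1)] by blast
  obtain as where "mset as = A" using ex_mset by blast
  then have "p = smult (lead_coeff p) (root_poly as)"
    unfolding root_poly_def prod_mset_prod_list[symmetric] using A by simp
  then have "shift_act p (x k) m = lead_coeff p * shift_act (root_poly as) (x k) m" for k m
    by (metis shift_act_smult)
  then have "P as" using assms by (auto simp: P_def fun_eq_iff)
  define bs where "bs = arg_min length P"
  have bs: "P bs" "\<And>cs. P cs \<Longrightarrow> length bs \<le> length cs"
    using arg_min_nat_lemma[of P as length] \<open>P as\<close> by (auto simp: bs_def)
  have short: "\<not> P (remove1 a bs)" if "a \<in> set bs" for a
  proof -
    have "length (remove1 a bs) < length bs"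
      using that length_pos_if_in_set[OF that] by (simp only: length_remove1 if_True)
    then show ?thesis using bs(2) leD by blast
  qed
  have step: "shift_act (root_poly (remove1 a bs)) (x k) (m + 1) = a * shift_act (root_poly (remove1 a bs)) (x k) m"
    if "a \<in> set bs" for a k m
  proof -
    have "shift_act [:- a, 1:] (shift_act (root_poly (remove1 a bs)) (x k)) m = 0"
      using bs(1) root_poly_remove1[OF that] by (simp add: P_def flip: shift_act_mult)
    then show ?thesis by (simp add: shift_act_linear)
  qed
  show ?thesis
  proof
    show "\<And>k. annihilates bs (x k)" using bs by (simp add: P_def)
    show "0 \<notin> set bs"
    proof
      assume 0: "0 \<in> set bs"
      \<comment> \<open>Ratio 0 makes the value at \<open>m\<close> zero times the value at
        \<open>m - 1\<close>, which exists for every integer \<open>m\<close>.\<close>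
      have "shift_act (root_poly (remove1 0 bs)) (x k) m = 0" for k m
        using step[OF 0, of k "m - 1"] by simp
      then show False using short[OF 0] by (auto simp: P_def)
    qed
    show "\<exists>k. geometric_root (x k) a"
      if "a \<in> set bs" for a
      using step[OF that] short[OF that] by (auto simp: P_def)
  qed
qed

locale subring_of_field =
  fixes R :: "'f::field set"
  assumes one_mem: "1 \<in> R"
    and diff_mem: "x \<in> R \<Longrightarrow> y \<in> R \<Longrightarrow> x - y \<in> R"
    and mult_mem: "x \<in> R \<Longrightarrow> y \<in> R \<Longrightarrow> x * y \<in> R"
begin

lemma zero_mem: "0 \<in> R"
  using diff_mem[OF one_mem one_mem] by simp

lemma uminus_mem: "x \<in> R \<Longrightarrow> - x \<in> R"
  using diff_mem[OF zero_mem, of x] by simp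

lemma add_mem: "x \<in> R \<Longrightarrow> y \<in> R \<Longrightarrow> x + y \<in> R"
  using diff_mem[of x "- y"] uminus_mem[of y] by simp

lemma sum_mem: "(\<And>i. i \<in> S \<Longrightarrow> f i \<in> R) \<Longrightarrow> sum f S \<in> R"
  by (induction S rule: infinite_finite_induct) (auto simp: zero_mem add_mem)

lemma power_mem: "x \<in> R \<Longrightarrow> x ^ n \<in> R"
  by (induction n) (auto simp: one_mem mult_mem)

definition polys :: "'f poly set"
  where "polys = {p. \<forall>n. coeff p n \<in> R}"

lemma polys_add: "p \<in> polys \<Longrightarrow> r \<in> polys \<Longrightarrow> p + r \<in> polys"
  by (simp add: polys_def add_mem)

lemma polys_mult: "p \<in> polys \<Longrightarrow> r \<in> polys \<Longrightarrow> p * r \<in> polys"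
  by (simp add: polys_def coeff_mult sum_mem mult_mem)

lemma polys_pCons: "c \<in> R \<Longrightarrow> p \<in> polys \<Longrightarrow> pCons c p \<in> polys"
  by (auto simp: polys_def coeff_pCons split: nat.splits)

lemma polys_0: "0 \<in> polys"
  by (simp add: polys_def zero_mem)

lemma polys_1: "1 \<in> polys"
  using polys_pCons[OF one_mem polys_0] by (simp add: one_pCons)

lemma polys_root_poly: "set as \<subseteq> R \<Longrightarrow> root_poly as \<in> polys"
proof (induction as)
  case (Cons a as)
  then show ?case
    unfolding root_poly_simps by (intro polys_mult polys_pCons uminus_mem one_mem polys_0) simp_all
qed (simp add: root_poly_simps polys_1)

text \<open>The point is that the Bezout coefficients stay in \<open>R\<close>: over the surrounding
  field distinct roots would suffice, over \<open>R\<close> their differences have to be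
  units.\<close>

definition comaximal :: "'f poly \<Rightarrow> 'f poly \<Rightarrow> bool"
  where "comaximal f g \<longleftrightarrow> (\<exists>U\<in>polys. \<exists>V\<in>polys. U * f + V * g = 1)"

lemma comaximal_1: "comaximal f 1"
  unfolding comaximal_def using polys_0 polys_1 by (intro bexI[of _ 0] bexI[of _ 1]) auto

lemma comaximal_commute: "comaximal f g \<Longrightarrow> comaximal g f"
  unfolding comaximal_def using add.commute by metis

lemma comaximal_mult:
  assumes "comaximal f g" "comaximal f h" "f \<in> polys" "g \<in> polys" "h \<in> polys"
  shows "comaximal f (g * h)"
proof -
  obtain U V U' V' where m: "U \<in> polys" "V \<in> polys" "U' \<in> polys" "V' \<in> polys"
    and 1: "U * f + V * g = 1" "U' * f + V' * h = 1"
    using assms by (auto simp: comaximal_def)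
  have "(U * U' * f + U * V' * h + V * U' * g) * f + (V * V') * (g * h) = (U * f + V * g) * (U' * f + V' * h)"
    by (simp add: algebra_simps)
  then have eq: "(U * U' * f + U * V' * h + V * U' * g) * f + (V * V') * (g * h) = 1" by (simp add: 1)
  show ?thesis
    unfolding comaximal_def
  proof (intro bexI)
    show "(U * U' * f + U * V' * h + V * U' * g) * f + (V * V') * (g * h) = 1" by (rule eq)
  qed (intro polys_add polys_mult m assms)+
qed

lemma comaximal_linear:
  assumes "a \<noteq> b" "inverse (b - a) \<in> R"
  shows "comaximal [:- b, 1:] [:- a, 1:]"
  unfolding comaximal_def
proof (intro bexI)
  have "inverse (b - a) * b - inverse (b - a) * a = 1"
    using assms(1) by (simp flip: right_diff_distrib)
  then show "[:- inverse (b - a):] * [:- b, 1:] + [:inverse (b - a):] * [:- a, 1:] = 1"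
    by (simp add: one_pCons mult.commute)
qed (use assms(2) in \<open>auto intro!: polys_pCons polys_0 uminus_mem\<close>)

lemma comaximal_root_poly:
  assumes "set as \<subseteq> R" "set bs \<subseteq> R"
    and "\<And>a b. a \<in> set as \<Longrightarrow> b \<in> set bs \<Longrightarrow> a \<noteq> b \<and> inverse (b - a) \<in> R"
  shows "comaximal (root_poly bs) (root_poly as)"
proof -
  have lin: "[:- b, 1:] \<in> polys" if "b \<in> R" for b
    using that by (intro polys_pCons uminus_mem one_mem polys_0)
  have 1: "comaximal [:- b, 1:] (root_poly as)" if "b \<in> set bs" for b
    using assms(1,3) that
  proof (induction as)
    case (Cons a as)
    then show ?case
      using assms(2)
      by (simp only: root_poly_simps, intro comaximal_mult comaximal_linear lin polys_root_poly) auto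
  qed (simp add: root_poly_simps comaximal_1)
  then have "comaximal (root_poly as) (root_poly bs)"
    using assms(2)
  proof (induction bs)
    case (Cons b bs)
    then show ?case
      using assms(1)
      by (simp only: root_poly_simps, intro comaximal_mult comaximal_commute[OF Cons.prems(1)] lin polys_root_poly) auto
  qed (simp add: root_poly_simps comaximal_1)
  then show ?thesis by (rule comaximal_commute)
qed

end

section \<open>Rational functions among Laurent series\<close>

lemma fls_nth_X_times: "fls_nth (fls_X * f) n = fls_nth f (n - 1)" for f :: "complex fls"
  by (simp add: fls_X_times_conv_shift)

section \<open>Substitution of Laurent series into polynomials\<close>

definition ev :: "complex fls \<Rightarrow> complex poly \<Rightarrow> complex fls"
  where "ev y p = poly (map_poly fls_const p) y"

lemma ev_0: "ev y 0 = 0"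
  by (simp add: ev_def)

lemma ev_pCons: "ev y (pCons c p) = fls_const c + y * ev y p"
  by (simp add: ev_def map_poly_pCons)

lemma ev_const: "ev y [:c:] = fls_const c"
  by (simp add: ev_pCons ev_0)

lemma ev_1: "ev y 1 = 1"
  using ev_const[of y 1] by (simp add: one_pCons)

lemma ev_add: "ev y (p + r) = ev y p + ev y r"
proof (induction p r rule: poly_induct2)
  case (pCons a p b r)
  then show ?case by (simp add: ev_pCons distrib_left flip: fls_plus_const)
qed (simp add: ev_0)

lemma ev_smult: "ev y (smult c p) = fls_const c * ev y p"
proof (induction p)
  case (pCons a p)
  then show ?case by (simp add: ev_pCons distrib_left mult.left_commute flip: fls_const_mult_const)
qed (simp add: ev_0)

lemma ev_mult: "ev y (p * r) = ev y p * ev y r"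
proof (induction p)
  case (pCons a p)
  then show ?case by (simp add: ev_add ev_smult ev_pCons ev_0 algebra_simps)
qed (simp add: ev_0)

lemma ev_diff: "ev y (p - r) = ev y p - ev y r"
  by (metis add_diff_cancel_right' diff_add_cancel ev_add)

lemma ev_power: "ev y (p ^ n) = ev y p ^ n"
  by (induction n) (simp_all add: ev_1 ev_mult)

lemma ev_X_nth: "fls_nth (ev fls_X p) (int n) = coeff p n"
proof (induction p arbitrary: n)
  case (pCons a p)
  show ?case
  proof (cases n)
    case 0
    have "fls_nth (ev fls_X r) (- 1) = 0" for r
    proof -
      have "\<forall>m<0. fls_nth (ev fls_X r) m = 0"
        by (induction r) (simp_all add: ev_0 ev_pCons fls_nth_X_times)
      then show ?thesis by simp
    qed
    with 0 show ?thesis by (simp add: ev_pCons fls_nth_X_times)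
  next
    case (Suc m)
    then show ?thesis using pCons.IH[of m] by (simp add: ev_pCons fls_nth_X_times)
  qed
qed (simp add: ev_0)

lemma ev_X_inj: "ev fls_X p = ev fls_X r \<longleftrightarrow> p = r"
  by (metis ev_X_nth poly_eqI)

lemma ev_X_fps: "ev fls_X p = fps_to_fls (fps_of_poly p)"
proof (rule fls_eqI)
  fix n :: int
  have neg: "fls_nth (ev fls_X p) n = 0" if "n < 0" for n
    using that by (induction p arbitrary: n) (simp_all add: ev_0 ev_pCons fls_nth_X_times)
  show "fls_nth (ev fls_X p) n = fls_nth (fps_to_fls (fps_of_poly p)) n"
    by (cases "n \<ge> 0") (use neg in \<open>auto simp: ev_X_nth dest!: zero_le_imp_eq_int\<close>)
qed

lemma ev_X_inv_reflect: "fls_X ^ degree p * ev fls_X_inv p = ev fls_X (reflect_poly p)"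
proof (cases "p = 0")
  case False
  have deg: "degree (map_poly fls_const p) = degree p"
    by (rule degree_map_poly) (simp add: fls_const_nonzero)
  have "map_poly fls_const (reflect_poly p) = reflect_poly (map_poly fls_const p)"
  proof (rule poly_eqI)
    fix n
    show "coeff (map_poly fls_const (reflect_poly p)) n = coeff (reflect_poly (map_poly fls_const p)) n"
      by (simp add: coeff_map_poly coeff_reflect_poly deg)
  qed
  then show ?thesis
    using poly_reflect_poly_nz[of fls_X "map_poly fls_const p"]
    by (simp add: ev_def deg fls_inverse_X)
qed (simp add: ev_0)

lemma ev_X_inv_eq_0: "ev fls_X_inv p = 0 \<longleftrightarrow> p = 0"
proof
  assume "ev fls_X_inv p = 0"
  then have "ev fls_X (reflect_poly p) = ev fls_X 0"
    using ev_X_inv_reflect[of p] by (simp add: ev_0)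
  then show "p = 0" by (simp only: ev_X_inj) simp
qed (simp add: ev_0)

text \<open>
  Elements of the field of Laurent series that are rational functions of \<open>y\<close> without pole at
  \<open>y = w\<close>. This is used with \<open>y = z\<close> and with \<open>y = 1 / z\<close>; for the latter, \<open>w = 0\<close> is the point
  \<open>z = \<infinity>\<close>.
\<close>

definition regular_at :: "complex fls \<Rightarrow> complex \<Rightarrow> complex fls set"
  where "regular_at y w = {f. \<exists>p r. poly r w \<noteq> 0 \<and> ev y r * f = ev y p}"

lemma regular_atI: "poly r w \<noteq> 0 \<Longrightarrow> ev y r * f = ev y p \<Longrightarrow> f \<in> regular_at y w"
  by (auto simp: regular_at_def)

lemma regular_at_subring: "subring_of_field (regular_at y w)"
proof
  show "1 \<in> regular_at y w" by (rule regular_atI[of 1 _ _ _ 1]) (simp_all add: ev_1)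
next
  fix f g assume "f \<in> regular_at y w" "g \<in> regular_at y w"
  then obtain p r p' r' where r: "poly r w \<noteq> 0" "poly r' w \<noteq> 0"
    and f: "ev y r * f = ev y p" and g: "ev y r' * g = ev y p'"
    by (auto simp: regular_at_def)
  show "f - g \<in> regular_at y w"
  proof (rule regular_atI)
    have "ev y (r * r') * (f - g) = ev y r' * (ev y r * f) - ev y r * (ev y r' * g)"
      by (simp add: ev_mult algebra_simps)
    then show "ev y (r * r') * (f - g) = ev y (r' * p - r * p')" by (simp add: f g ev_mult ev_diff)
  qed (use r in simp)
  show "f * g \<in> regular_at y w"
  proof (rule regular_atI)
    have "ev y (r * r') * (f * g) = (ev y r * f) * (ev y r' * g)"
      by (simp add: ev_mult algebra_simps)
    then show "ev y (r * r') * (f * g) = ev y (p * p')" by (simp add: f g ev_mult)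
  qed (use r in simp)
qed

lemma regular_at_ev: "ev y p \<in> regular_at y w"
  by (rule regular_atI[of 1]) (simp_all add: ev_1)

lemma regular_at_const: "fls_const c \<in> regular_at y w"
  using regular_at_ev[of y "[:c:]"] by (simp add: ev_const)

lemma regular_at_var: "y \<in> regular_at y w"
  using regular_at_ev[of y "[:0, 1:]"] by (simp add: ev_pCons ev_0)

lemma regular_at_inverse_ev:
  assumes "poly r w \<noteq> 0" "ev y r \<noteq> 0"
  shows "inverse (ev y r) \<in> regular_at y w"
  using assms by (intro regular_atI[of r _ _ _ 1]) (simp_all add: ev_1)

lemma eventually_at_notin_finite:
  fixes w :: complex
  assumes "finite S"
  shows "\<forall>\<^sub>F z in at w. z \<notin> S"
  unfolding eventually_at_topological
proof (intro exI conjI)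
  show "open (- (S - {w}))" using assms by (intro open_Compl finite_imp_closed) simp
qed auto

text \<open>The function \<open>z \<mapsto> y\<close>, that is, the identity or the inversion.\<close>

definition var_fun :: "complex fls \<Rightarrow> complex \<Rightarrow> complex"
  where "var_fun y = (if y = fls_X then (\<lambda>z. z) else inverse)"

lemma fls_X_neq_X_inv: "fls_X_inv \<noteq> (fls_X :: complex fls)"
proof
  assume "fls_X_inv = (fls_X :: complex fls)"
  then have "fls_nth fls_X_inv 1 = fls_nth (fls_X :: complex fls) 1" by simp
  then show False by simp
qed

text \<open>Here \<open>z\<close> is the value of \<open>y\<close>, so the series variable takes the
  value \<open>var_fun y z\<close>. For \<open>y = fls_X_inv\<close>, multiplication by powers of
  \<open>fls_X\<close> turns the identity into one of polynomials, which is then evaluated at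
  \<open>inverse z\<close>.\<close>

lemma ev_identity_pointwise:
  assumes y: "y = fls_X \<or> y = fls_X_inv" and z: "z \<noteq> 0"
    and eq: "ev fls_X a * ev y b = ev fls_X c * ev y d"
  shows "poly a (var_fun y z) * poly b z = poly c (var_fun y z) * poly d z"
proof (cases "y = fls_X")
  case True
  with eq have "a * b = c * d" by (simp add: ev_X_inj flip: ev_mult)
  then have "poly (a * b) z = poly (c * d) z" by simp
  then show ?thesis using True by (simp add: var_fun_def)
next
  case False
  with y have y: "y = fls_X_inv" by simp
  let ?x = "inverse z"
  have "ev fls_X (a * reflect_poly b * [:0, 1:] ^ degree d) =
      fls_X ^ degree b * fls_X ^ degree d * (ev fls_X a * ev y b)"
    by (simp add: ev_mult ev_power ev_pCons ev_0 y flip: ev_X_inv_reflect)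
  also have "\<dots> = fls_X ^ degree b * fls_X ^ degree d * (ev fls_X c * ev y d)"
    by (simp only: eq)
  also have "\<dots> = ev fls_X (c * reflect_poly d * [:0, 1:] ^ degree b)"
    by (simp add: ev_mult ev_power ev_pCons ev_0 y flip: ev_X_inv_reflect)
  finally have "a * reflect_poly b * [:0, 1:] ^ degree d = c * reflect_poly d * [:0, 1:] ^ degree b"
    by (simp only: ev_X_inj)
  then have "poly (a * reflect_poly b * [:0, 1:] ^ degree d) ?x = poly (c * reflect_poly d * [:0, 1:] ^ degree b) ?x"
    by simp
  then show ?thesis
    using z False by (simp add: poly_reflect_poly_nz var_fun_def poly_power field_simps)
qed

text \<open>The series has two descriptions as a fraction, one in the series variable and one in
  \<open>y\<close>. They agree off a finite set of points, and the second is continuous at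
  \<open>w\<close>.\<close>

lemma regular_at_limit:
  assumes y: "y = fls_X \<or> y = fls_X_inv" and r: "r \<noteq> 0" "ev fls_X r * f = ev fls_X p"
    and f: "f \<in> regular_at y w"
  shows "\<exists>l. ((\<lambda>z. poly p (var_fun y z) / poly r (var_fun y z)) \<longlongrightarrow> l) (at w)"
proof -
  obtain p' r' where r': "poly r' w \<noteq> 0" "ev y r' * f = ev y p'"
    using f by (auto simp: regular_at_def)
  have "ev fls_X r * ev y p' = ev fls_X p * ev y r'"
    using r(2) r'(2) by (metis mult.assoc mult.commute)
  then have eq: "poly r (var_fun y z) * poly p' z = poly p (var_fun y z) * poly r' z" if "z \<noteq> 0" for z
    using ev_identity_pointwise[OF y that] by blast
  have fin: "finite {z. poly s (var_fun y z) = 0}" if "s \<noteq> 0" for s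
  proof -
    have "inj (var_fun y)" by (auto simp: var_fun_def inj_def)
    then have "finite (var_fun y -` {z. poly s z = 0})"
      using poly_roots_finite[OF that] by (intro finite_vimageI)
    then show ?thesis by (simp add: vimage_def)
  qed
  have ev1: "\<forall>\<^sub>F z in at w. z \<notin> S" if "finite S" for S
    using that by (rule eventually_at_notin_finite)
  have "\<forall>\<^sub>F z in at w. z \<noteq> 0"
    using ev1[of "{0}"] by simp
  moreover have "\<forall>\<^sub>F z in at w. poly r (var_fun y z) \<noteq> 0"
    using ev1[OF fin[OF r(1)]] by simp
  moreover have "\<forall>\<^sub>F z in at w. poly r' z \<noteq> 0"
  proof -
    have "r' \<noteq> 0" using r'(1) by auto
    then show ?thesis using ev1[OF poly_roots_finite[of r']] by simp
  qed
  ultimately have ev: "\<forall>\<^sub>F z in at w. poly p' z / poly r' z = poly p (var_fun y z) / poly r (var_fun y z)"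
    by eventually_elim (use eq in \<open>simp add: field_simps\<close>)
  have "((\<lambda>z. poly p' z / poly r' z) \<longlongrightarrow> poly p' w / poly r' w) (at w)"
    using r'(1) by (intro tendsto_intros)
  then have "((\<lambda>z. poly p (var_fun y z) / poly r (var_fun y z)) \<longlongrightarrow> poly p' w / poly r' w) (at w)"
    using ev by (rule Lim_transform_eventually)
  then show ?thesis by blast
qed

lemma has_fps_expansion_poly: "poly p has_fps_expansion fps_of_poly (p :: complex poly)"
  by (auto simp: has_fps_expansion_def eval_fps_of_poly)

text \<open>Common linear factors are cancelled one by one, with decreasing degree. In lowest terms
  every zero of the denominator is a genuine pole.\<close>

lemma no_common_roots:
  assumes "r \<noteq> 0" "ev fls_X r * f = ev fls_X p"
  obtains p' r' where "r' \<noteq> 0" "ev fls_X r' * f = ev fls_X p'"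
    "\<And>w. poly r' w = 0 \<Longrightarrow> poly p' w \<noteq> 0"
proof -
  have "\<exists>p' r'. r' \<noteq> 0 \<and> ev fls_X r' * f = ev fls_X p' \<and> (\<forall>w. poly r' w = 0 \<longrightarrow> poly p' w \<noteq> 0)"
    using assms
  proof (induction "degree r" arbitrary: p r rule: less_induct)
    case less
    show ?case
    proof (cases "\<exists>w. poly r w = 0 \<and> poly p w = 0")
      case True
      then obtain w r1 p1 where r: "r = [:- w, 1:] * r1" and p: "p = [:- w, 1:] * p1"
        by (metis dvdE poly_eq_0_iff_dvd)
      have "r1 \<noteq> 0" using less.prems(1) r by auto
      then have "degree r1 < degree r" unfolding r by (subst degree_mult_eq) simp_all
      moreover have "ev fls_X [:- w, 1:] \<noteq> 0" using ev_X_inj[of "[:- w, 1:]" 0] by (simp add: ev_0)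
      then have "ev fls_X r1 * f = ev fls_X p1"
        using less.prems(2) unfolding r p ev_mult by (simp add: mult.assoc)
      ultimately show ?thesis using less.hyps \<open>r1 \<noteq> 0\<close> by blast
    qed (use less.prems in blast)
  qed
  then show ?thesis using that by blast
qed

text \<open>For \<open>y = fls_X_inv\<close> the hypothesis concerns infinity and provides only
  rationality. Holomorphy at 0 comes from \<open>f\<close> being a power series.\<close>

lemma regular_fps_rational:
  assumes y: "y = fls_X \<or> y = fls_X_inv" and f: "fps_to_fls f \<in> regular_at y 0"
  obtains p r where "r \<noteq> 0" "\<And>w. poly r w = 0 \<Longrightarrow> poly p w \<noteq> 0" "ev fls_X r * fps_to_fls f = ev fls_X p"
    "(\<lambda>z. poly p z / poly r z) has_fps_expansion f"
proof -
  obtain p1 r1 where 1: "poly r1 0 \<noteq> 0" "ev y r1 * fps_to_fls f = ev y p1"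
    using f by (auto simp: regular_at_def)
  then have "r1 \<noteq> 0" by auto
  obtain p2 r2 where 2: "r2 \<noteq> 0" "ev fls_X r2 * fps_to_fls f = ev fls_X p2"
  proof (cases "y = fls_X")
    case True
    then show ?thesis using that 1 \<open>r1 \<noteq> 0\<close> by blast
  next
    case False
    with y have y: "y = fls_X_inv" by simp
    let ?r = "reflect_poly r1 * [:0, 1:] ^ degree p1" and ?p = "reflect_poly p1 * [:0, 1:] ^ degree r1"
    have "ev fls_X ?r * fps_to_fls f = fls_X ^ degree p1 * fls_X ^ degree r1 * (ev y r1 * fps_to_fls f)"
      by (simp add: ev_mult ev_power ev_pCons ev_0 y flip: ev_X_inv_reflect)
    also have "\<dots> = fls_X ^ degree p1 * fls_X ^ degree r1 * ev y p1" by (simp only: 1)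
    also have "\<dots> = ev fls_X ?p"
      by (simp add: ev_mult ev_power ev_pCons ev_0 y flip: ev_X_inv_reflect)
    finally have "ev fls_X ?r * fps_to_fls f = ev fls_X ?p" .
    then show ?thesis using that[of ?r ?p] \<open>r1 \<noteq> 0\<close> by simp
  qed
  from 2 obtain p r where g0: "r \<noteq> 0" and eq: "ev fls_X r * fps_to_fls f = ev fls_X p"
    and cop: "\<And>w. poly r w = 0 \<Longrightarrow> poly p w \<noteq> 0"
    by (rule no_common_roots) blast
  from eq have "fps_to_fls (fps_of_poly r * f) = fps_to_fls (fps_of_poly p)"
    by (simp only: ev_X_fps fls_times_fps_to_fls)
  then have eq': "fps_of_poly r * f = fps_of_poly p" by (rule fps_to_fls_eq_imp_fps_eq)
  \<comment> \<open>Comparison of constant terms: a zero of the denominator at 0 would be a zero of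
    the numerator as well.\<close>
  have r0: "poly r 0 \<noteq> 0"
  proof
    assume "poly r 0 = 0"
    moreover have "poly p 0 = poly r 0 * fps_nth f 0"
      using arg_cong[OF eq', of "\<lambda>f. fps_nth f 0"] by (simp add: poly_0_coeff_0)
    ultimately show False using cop[of 0] by simp
  qed
  have "(\<lambda>z. poly p z / poly r z) has_fps_expansion fps_of_poly p / fps_of_poly r"
    using r0 by (intro has_fps_expansion_divide' has_fps_expansion_poly) (simp add: poly_0_coeff_0)
  also have "fps_of_poly p / fps_of_poly r = f"
  proof -
    have "fps_of_poly r \<noteq> 0" using g0 by simp
    then show ?thesis unfolding eq'[symmetric] by simp
  qed
  finally show ?thesis using that g0 cop eq by blast
qed

section \<open>Generating series of linear recurrences and their poles\<close>

definition gen_series :: "(int \<Rightarrow> complex) \<Rightarrow> complex fls"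
  where "gen_series x = fps_to_fls (Abs_fps (\<lambda>n. x (int n)))"

lemma gen_series_nth: "fls_nth (gen_series x) n = (if n < 0 then 0 else x n)"
  by (simp add: gen_series_def)

lemma gen_series_shift: "gen_series x = fls_const (x 0) + fls_X * gen_series (\<lambda>m. x (m + 1))"
proof (rule fls_eqI)
  fix n
  show "fls_nth (gen_series x) n = fls_nth (fls_const (x 0) + fls_X * gen_series (\<lambda>m. x (m + 1))) n"
    by (cases "n = 0") (auto simp: gen_series_nth fls_nth_X_times)
qed

lemma gen_series_zero: "gen_series (\<lambda>_. 0) = 0"
  by (rule fls_eqI) (simp add: gen_series_nth)

text \<open>If z is the sequence \<open>shift_act [:- a, 1:] x\<close>, then (1 - a X) times the
  series of \<open>x\<close> is \<open>x 0\<close> plus X times the series of z, and z satisfies the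
  recurrence with one root fewer.\<close>

lemma gen_series_rational:
  "annihilates as x \<Longrightarrow> gen_series x \<in> regular_at fls_X 0"
proof (induction as arbitrary: x)
  case Nil
  then show ?case
    using regular_at_const[of 0 fls_X 0] by (simp add: root_poly_simps shift_act_1 gen_series_zero)
next
  case (Cons a as)
  interpret subring_of_field "regular_at fls_X 0" by (rule regular_at_subring)
  let ?z = "shift_act [:- a, 1:] x"
  have "annihilates as ?z"
    using Cons.prems unfolding root_poly_simps by (simp only: mult.commute[of "[:- a, 1:]"] shift_act_mult)
  then have z: "gen_series ?z \<in> regular_at fls_X 0" by (rule Cons.IH)
  have z_eq: "gen_series ?z = gen_series (\<lambda>m. x (m + 1)) - fls_const a * gen_series x"
    by (rule fls_eqI) (simp add: gen_series_nth shift_act_linear)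
  have "fls_X * gen_series ?z + fls_const (x 0) =
      (fls_const (x 0) + fls_X * gen_series (\<lambda>m. x (m + 1))) - fls_X * (fls_const a * gen_series x)"
    by (simp only: z_eq) (simp add: algebra_simps)
  also have "\<dots> = gen_series x - fls_X * (fls_const a * gen_series x)"
    by (simp only: gen_series_shift[symmetric])
  also have "\<dots> = ev fls_X [:1, - a:] * gen_series x"
    by (simp add: ev_pCons ev_0 algebra_simps fls_const_uminus)
  finally have eq: "gen_series x = inverse (ev fls_X [:1, - a:]) * (fls_X * gen_series ?z + fls_const (x 0))"
    using ev_X_inj[of "[:1, - a:]" 0] by (simp add: ev_0)
  show ?case
    by (subst eq, intro mult_mem add_mem z regular_at_const regular_at_var regular_at_inverse_ev)
      (use ev_X_inj[of "[:1, - a:]" 0] in \<open>simp_all add: ev_0\<close>)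
qed

text \<open>Regularity at \<open>inverse a\<close> would pass to the series of all shifts, as X is
  invertible at that nonzero point, hence to the series of the geometric sequence y. But (1 - a X)
  times the latter is the constant \<open>y 0\<close>, so \<open>y 0 = 0\<close>, and then y
  vanishes in both directions because \<open>a \<noteq> 0\<close>.\<close>

lemma gen_series_pole:
  assumes a: "a \<noteq> 0" and s: "shift_act s x \<noteq> (\<lambda>_. 0)"
    and geom: "\<And>m. shift_act s x (m + 1) = a * shift_act s x m"
  shows "gen_series x \<notin> regular_at fls_X (inverse a)"
proof
  assume reg: "gen_series x \<in> regular_at fls_X (inverse a)"
  interpret subring_of_field "regular_at fls_X (inverse a)" by (rule regular_at_subring)
  have X_inv: "fls_X_inv \<in> regular_at fls_X (inverse a)"
    using regular_at_inverse_ev[of "[:0, 1:]" "inverse a" fls_X] a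
    by (simp add: ev_pCons ev_0 fls_inverse_X)
  have shifted: "gen_series (\<lambda>m. x (m + int k)) \<in> regular_at fls_X (inverse a)" for k
  proof (induction k)
    case (Suc k)
    have "gen_series (\<lambda>m. x (m + int (Suc k))) =
        fls_X_inv * (gen_series (\<lambda>m. x (m + int k)) - fls_const (x (int k)))"
      using gen_series_shift[of "\<lambda>m. x (m + int k)"]
      by (simp add: algebra_simps mult.assoc[symmetric] fls_X_inv_times_conv_shift fls_X_times_conv_shift)
    then show ?case using Suc X_inv by (auto intro!: mult_mem diff_mem regular_at_const)
  qed (simp add: reg)
  define y where "y = shift_act s x"
  have "gen_series y = (\<Sum>k\<le>degree s. fls_const (coeff s k) * gen_series (\<lambda>m. x (m + int k)))"
    by (rule fls_eqI) (simp add: gen_series_nth fls_nth_sum y_def shift_act_def)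
  then have "gen_series y \<in> regular_at fls_X (inverse a)"
    by (simp add: sum_mem mult_mem regular_at_const shifted)
  then obtain p r where r: "poly r (inverse a) \<noteq> 0" "ev fls_X r * gen_series y = ev fls_X p"
    by (auto simp: regular_at_def)
  have y1: "y (m + 1) = a * y m" for m unfolding y_def by (rule geom)
  have "gen_series y = fls_const (y 0) + fls_X * (fls_const a * gen_series y)"
  proof -
    have "gen_series (\<lambda>m. y (m + 1)) = fls_const a * gen_series y"
      by (rule fls_eqI) (simp add: gen_series_nth y1)
    then show ?thesis using gen_series_shift[of y] by simp
  qed
  then have "ev fls_X [:1, - a:] * gen_series y = fls_const (y 0)"
    by (simp add: ev_pCons ev_0 algebra_simps)
  then have "ev fls_X r * fls_const (y 0) = ev fls_X [:1, - a:] * ev fls_X p"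
    by (metis r(2) mult.left_commute)
  then have "ev fls_X (r * [:y 0:]) = ev fls_X ([:1, - a:] * p)" by (simp only: ev_mult ev_const)
  then have "r * [:y 0:] = [:1, - a:] * p" by (simp only: ev_X_inj)
  then have "poly (r * [:y 0:]) (inverse a) = poly ([:1, - a:] * p) (inverse a)" by simp
  then have "y 0 = 0" using r(1) a by (simp add: field_simps)
  have "y m = 0" for m
  proof (induction m rule: int_induct[where k = 0])
    case (step2 i)
    then show ?case using y1[of "i - 1"] a by simp
  qed (simp_all add: \<open>y 0 = 0\<close> y1)
  then show False using s by (auto simp: y_def)
qed

section \<open>Poles of matrix valued rational functions\<close>

definition entry_series :: "(complex^'n^'n) fps \<Rightarrow> 'n \<Rightarrow> 'n \<Rightarrow> complex fls"
  where "entry_series S k l = fps_to_fls (Abs_fps (\<lambda>n. fps_nth S n $ k $ l))"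

lemma rational_matrix_of_entries:
  fixes S :: "(complex^'n^'n) fps"
  assumes y: "y = fls_X \<or> y = fls_X_inv" and S: "\<And>k l. entry_series S k l \<in> regular_at y 0"
  obtains f p r where "rational_with_taylor_expansion f S"
    "\<And>k l. r k l \<noteq> 0" "\<And>k l w. poly (r k l) w = 0 \<Longrightarrow> poly (p k l) w \<noteq> 0"
    "\<And>k l. ev fls_X (r k l) * entry_series S k l = ev fls_X (p k l)"
    "\<And>z k l. f z $ k $ l = poly (p k l) z / poly (r k l) z"
proof -
  define Q where "Q k l pr \<longleftrightarrow> snd pr \<noteq> 0 \<and>
    (\<forall>w. poly (snd pr) w = 0 \<longrightarrow> poly (fst pr) w \<noteq> 0) \<and>
    ev fls_X (snd pr) * entry_series S k l = ev fls_X (fst pr) \<and>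
    (\<lambda>z. poly (fst pr) z / poly (snd pr) z) has_fps_expansion Abs_fps (\<lambda>n. fps_nth S n $ k $ l)" for k l pr
  have "\<exists>pr. Q k l pr" for k l
  proof -
    obtain p r where "r \<noteq> 0" "\<And>w. poly r w = 0 \<Longrightarrow> poly p w \<noteq> 0"
      "ev fls_X r * fps_to_fls (Abs_fps (\<lambda>n. fps_nth S n $ k $ l)) = ev fls_X p"
      "(\<lambda>z. poly p z / poly r z) has_fps_expansion Abs_fps (\<lambda>n. fps_nth S n $ k $ l)"
      by (rule regular_fps_rational[OF y S[of k l, unfolded entry_series_def]], rule that)
    then have "Q k l (p, r)" by (simp add: Q_def entry_series_def)
    then show ?thesis ..
  qed
  then have someQ: "Q k l (SOME pr. Q k l pr)" for k l by (rule someI_ex)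
  define p where "p k l = fst (SOME pr. Q k l pr)" for k l
  define r where "r k l = snd (SOME pr. Q k l pr)" for k l
  have pr: "r k l \<noteq> 0" "\<And>w. poly (r k l) w = 0 \<Longrightarrow> poly (p k l) w \<noteq> 0"
      "ev fls_X (r k l) * entry_series S k l = ev fls_X (p k l)"
      "(\<lambda>z. poly (p k l) z / poly (r k l) z) has_fps_expansion Abs_fps (\<lambda>n. fps_nth S n $ k $ l)" for k l
    using someQ[of k l] unfolding Q_def p_def r_def by blast+
  define f where "f z = (\<chi> k l. poly (p k l) z / poly (r k l) z)" for z
  have "rational_with_taylor_expansion f S"
    unfolding rational_with_taylor_expansion_def rational_matrix_function_def
  proof (intro conjI allI)
    show "\<exists>a b. b \<noteq> 0 \<and> (\<forall>z. f z $ k $ l = poly a z / poly b z)" for k l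
      using pr(1)[of k l] by (intro exI[of _ "p k l"] exI[of _ "r k l"]) (simp add: f_def)
    show "(\<lambda>z. f z $ k $ l) has_fps_expansion Abs_fps (\<lambda>n. fps_nth S n $ k $ l)" for k l
      using pr(4)[of k l] by (simp add: f_def)
  qed
  then show ?thesis by (rule that) (use pr(1-3) in \<open>simp_all add: f_def\<close>)
qed

text \<open>In lowest terms the denominator of the singular entry vanishes at \<open>w\<close> and
  its numerator does not, so this entry tends to infinity; the norm of a matrix dominates that of
  each entry.\<close>

lemma pole_of_singular_entry:
  fixes S :: "(complex^'n^'n) fps"
  assumes S: "\<And>k l. entry_series S k l \<in> regular_at fls_X 0"
    and sing: "entry_series S k l \<notin> regular_at fls_X w"
  shows "pole_of_expansion S w"
proof -
  obtain f p r where f: "rational_with_taylor_expansion f S"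
    "\<And>k l. r k l \<noteq> 0" "\<And>k l w. poly (r k l) w = 0 \<Longrightarrow> poly (p k l) w \<noteq> 0"
    "\<And>k l. ev fls_X (r k l) * entry_series S k l = ev fls_X (p k l)"
    "\<And>z k l. f z $ k $ l = poly (p k l) z / poly (r k l) z"
    by (rule rational_matrix_of_entries[of fls_X S, OF disjI1 S], rule HOL.refl, rule that)
  have r0: "poly (r k l) w = 0" using sing regular_atI[OF _ f(4)[of k l]] by auto
  then have p0: "poly (p k l) w \<noteq> 0" by (rule f(3))
  have "is_pole (\<lambda>z. poly (p k l) z / poly (r k l) z) w"
  proof (rule is_pole_divide)
    show "isCont (poly (p k l)) w" by simp
    have "\<forall>\<^sub>F z in at w. poly (r k l) z \<noteq> 0"
      using eventually_at_notin_finite[OF poly_roots_finite[OF f(2)[of k l]]] by simp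
    moreover have "(poly (r k l) \<longlongrightarrow> poly (r k l) w) (at w)" by (rule isContD) simp
    ultimately show "filterlim (poly (r k l)) (at 0) (at w)" by (simp add: filterlim_at r0)
  qed (rule p0)
  then have "filterlim (\<lambda>z. norm (f z $ k $ l)) at_top (at w)"
    unfolding is_pole_def f(5) by (rule filterlim_at_infinity_imp_norm_at_top)
  then have "filterlim (\<lambda>z. norm (f z)) at_top (at w)"
  proof (rule filterlim_at_top_mono)
    have "norm (f z $ k $ l) \<le> norm (f z)" for z
      using Finite_Cartesian_Product.norm_nth_le[of "f z $ k" l] Finite_Cartesian_Product.norm_nth_le[of "f z" k]
      by linarith
    then show "\<forall>\<^sub>F z in at w. norm (f z $ k $ l) \<le> norm (f z)" by simp
  qed
  then have "is_pole f w" unfolding is_pole_def by (rule filterlim_norm_at_top_imp_at_infinity)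
  with f(1) show ?thesis by (auto simp: pole_of_expansion_def)
qed

text \<open>Off \<open>B\<close> every entry has a finite limit, so the matrix converges and cannot
  have a pole. The point 0 has to lie outside \<open>B\<close> since rationality is read off from
  regularity at \<open>y = 0\<close>.\<close>

lemma rational_matrix_not_pole:
  fixes S :: "(complex^'n^'n) fps"
  assumes y: "y = fls_X \<or> y = fls_X_inv"
    and S: "\<And>w k l. w \<notin> B \<Longrightarrow> entry_series S k l \<in> regular_at y w" and B: "0 \<notin> B"
  obtains f where "rational_with_taylor_expansion f S" "\<And>w. is_pole (\<lambda>z. f (var_fun y z)) w \<Longrightarrow> w \<in> B"
proof -
  obtain f p r where f: "rational_with_taylor_expansion f S"
    "\<And>k l. r k l \<noteq> 0" "\<And>k l w. poly (r k l) w = 0 \<Longrightarrow> poly (p k l) w \<noteq> 0"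
    "\<And>k l. ev fls_X (r k l) * entry_series S k l = ev fls_X (p k l)"
    "\<And>z k l. f z $ k $ l = poly (p k l) z / poly (r k l) z"
    by (rule rational_matrix_of_entries[OF y S[OF B]], rule that)
  have "w \<in> B" if pole: "is_pole (\<lambda>z. f (var_fun y z)) w" for w
  proof (rule ccontr)
    assume "w \<notin> B"
    define L where "L k l = (SOME l'. ((\<lambda>z. f (var_fun y z) $ k $ l) \<longlongrightarrow> l') (at w))" for k l
    have "\<exists>l'. ((\<lambda>z. f (var_fun y z) $ k $ l) \<longlongrightarrow> l') (at w)" for k l
      unfolding f(5) by (rule regular_at_limit[OF y f(2) f(4) S[OF \<open>w \<notin> B\<close>]])
    then have L: "((\<lambda>z. f (var_fun y z) $ k $ l) \<longlongrightarrow> L k l) (at w)" for k l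
      unfolding L_def by (rule someI_ex)
    have "((\<lambda>z. f (var_fun y z)) \<longlongrightarrow> (\<chi> k l. L k l)) (at w)"
      by (intro vec_tendstoI) (simp add: L)
    then show False
      using pole[unfolded is_pole_def] by (rule not_tendsto_and_filterlim_at_infinity[OF at_neq_bot])
  qed
  with f(1) show ?thesis by (rule that)
qed

section \<open>Linear algebra of matrix spaces\<close>

lemma vec_linear_expand:
  fixes f :: "complex^'n^'n \<Rightarrow> complex^'n^'n"
  assumes add: "\<And>x y. f (x + y) = f x + f y"
    and scale: "\<And>c x. f (\<chi> k l. c * x $ k $ l) = (\<chi> k l. c * f x $ k $ l)"
  shows "f x $ k $ l = (\<Sum>a\<in>UNIV. \<Sum>b\<in>UNIV. x $ a $ b * f (\<chi> k l. if k = a \<and> l = b then 1 else 0) $ k $ l)"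
proof -
  let ?E = "\<lambda>a b. (\<chi> k l. if k = a \<and> l = b then 1 else 0) :: complex^'n^'n"
  have 0: "f 0 = 0" using add[of 0 0] by simp
  have sum: "f (sum g S) = (\<Sum>i\<in>S. f (g i))" for g :: "'n \<Rightarrow> complex^'n^'n" and S
    by (induction S rule: infinite_finite_induct) (simp_all add: 0 add)
  have "x = (\<Sum>a\<in>UNIV. \<Sum>b\<in>UNIV. (\<chi> k l. x $ a $ b * ?E a b $ k $ l))"
  proof -
    have "(\<Sum>b\<in>UNIV. x $ a $ b * ?E a b $ k $ l) = (if k = a then x $ a $ l else 0)" for a k l
      by (cases "k = a") (simp_all add: mult_delta_right)
    then have "(\<Sum>a\<in>UNIV. \<Sum>b\<in>UNIV. x $ a $ b * ?E a b $ k $ l) = x $ k $ l" for k l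
      by simp
    then show ?thesis by (simp only: vec_eq_iff sum_component vec_lambda_beta) simp
  qed
  then have "f x = f (\<Sum>a\<in>UNIV. \<Sum>b\<in>UNIV. (\<chi> k l. x $ a $ b * ?E a b $ k $ l))"
    by (rule arg_cong)
  also have "\<dots> = (\<Sum>a\<in>UNIV. \<Sum>b\<in>UNIV. (\<chi> k l. x $ a $ b * f (?E a b) $ k $ l))"
    by (simp only: sum scale)
  finally have "f x = (\<Sum>a\<in>UNIV. \<Sum>b\<in>UNIV. (\<chi> k l. x $ a $ b * f (?E a b) $ k $ l))" .
  then show ?thesis by simp
qed

lemma real_dependence:
  fixes v :: "nat \<Rightarrow> 'a::euclidean_space"
  shows "\<exists>c. (\<exists>k\<le>DIM('a). c k \<noteq> 0) \<and> (\<Sum>k\<le>DIM('a). c k *\<^sub>R v k) = 0"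
proof (cases "inj_on v {..DIM('a)}")
  case True
  then have "card (v ` {..DIM('a)}) > DIM('a)" by (simp add: card_image)
  then have "dependent (v ` {..DIM('a)})" by (intro dependent_biggerset) simp
  then obtain u where u: "\<exists>x\<in>v ` {..DIM('a)}. u x \<noteq> 0" "(\<Sum>x\<in>v ` {..DIM('a)}. u x *\<^sub>R x) = 0"
    by (subst (asm) real_vector.dependent_finite) auto
  have "(\<Sum>k\<le>DIM('a). u (v k) *\<^sub>R v k) = 0"
    using u(2) by (simp add: sum.reindex[OF True] o_def)
  with u(1) show ?thesis by (intro exI[of _ "\<lambda>k. u (v k)"]) auto
next
  case False
  then obtain i j where ij: "i \<le> DIM('a)" "j \<le> DIM('a)" "i \<noteq> j" "v i = v j"
    by (auto simp: inj_on_def)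
  let ?c = "\<lambda>k. if k = i then 1 else if k = j then - 1 else 0 :: real"
  have "(\<Sum>k\<le>DIM('a). ?c k *\<^sub>R v k) = (\<Sum>k\<in>{i, j}. ?c k *\<^sub>R v k)"
    using ij by (intro sum.mono_neutral_right) auto
  also have "\<dots> = 0" using ij by simp
  finally show ?thesis using ij by (intro exI[of _ ?c]) auto
qed

text \<open>An operator is encoded by its values on the matrix units. These tuples form a finite
  dimensional real vector space, so the powers of \<open>A\<close> satisfy a linear relation, even
  with real coefficients.\<close>

lemma linear_operator_annihilator:
  fixes A :: "complex^'n^'n \<Rightarrow> complex^'n^'n"
  assumes add: "\<And>x y. A (x + y) = A x + A y"
    and scale: "\<And>c x. A (\<chi> k l. c * x $ k $ l) = (\<chi> k l. c * A x $ k $ l)"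
  shows "\<exists>p::complex poly. p \<noteq> 0 \<and> (\<forall>x a b. (\<Sum>k\<le>degree p. coeff p k * (A ^^ k) x $ a $ b) = 0)"
proof -
  let ?E = "\<lambda>a b. (\<chi> k l. if k = a \<and> l = b then 1 else 0) :: complex^'n^'n"
  define N where "N = DIM((complex^'n^'n)^('n \<times> 'n))"
  define v :: "nat \<Rightarrow> (complex^'n^'n)^('n \<times> 'n)" where "v k = (\<chi> e. (A ^^ k) (?E (fst e) (snd e)))" for k
  obtain c where c: "\<exists>k\<le>N. c k \<noteq> 0" "(\<Sum>k\<le>N. c k *\<^sub>R v k) = 0"
    using real_dependence[of v] unfolding N_def by blast
  define p where "p = (\<Sum>k\<le>N. monom (complex_of_real (c k)) k)"
  have coeff_p: "coeff p k = (if k \<le> N then complex_of_real (c k) else 0)" for k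
    by (simp add: p_def coeff_sum coeff_monom)
  have lin: "(A ^^ k) (x + y) = (A ^^ k) x + (A ^^ k) y"
    "(A ^^ k) (\<chi> i j. c * x $ i $ j) = (\<chi> i j. c * (A ^^ k) x $ i $ j)" for k x y c
    by (induction k) (simp_all add: add scale)
  have expand: "(A ^^ k) x $ a $ b = (\<Sum>a'\<in>UNIV. \<Sum>b'\<in>UNIV. x $ a' $ b' * (A ^^ k) (?E a' b') $ a $ b)"
    for k x a b by (rule vec_linear_expand) (rule lin)+
  have "(\<Sum>k\<le>N. coeff p k * (A ^^ k) x $ a $ b) = 0" for x a b
  proof -
    have "(\<Sum>k\<le>N. c k *\<^sub>R v k) $ (a', b') $ a $ b = 0" for a' b' by (simp add: c(2))
    then have E: "(\<Sum>k\<le>N. complex_of_real (c k) * (A ^^ k) (?E a' b') $ a $ b) = 0" for a' b'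
      by (simp add: v_def scaleR_conv_of_real[symmetric])
    have "(\<Sum>k\<le>N. coeff p k * (A ^^ k) x $ a $ b) =
        (\<Sum>k\<le>N. \<Sum>a'\<in>UNIV. \<Sum>b'\<in>UNIV. x $ a' $ b' * (complex_of_real (c k) * (A ^^ k) (?E a' b') $ a $ b))"
      by (subst expand) (simp add: coeff_p sum_distrib_left mult_ac)
    also have "\<dots> = (\<Sum>a'\<in>UNIV. \<Sum>b'\<in>UNIV. \<Sum>k\<le>N. x $ a' $ b' * (complex_of_real (c k) * (A ^^ k) (?E a' b') $ a $ b))"
      by (subst sum.swap, intro sum.cong[OF HOL.refl] sum.swap)
    also have "\<dots> = 0" by (simp add: E flip: sum_distrib_left)
    finally show ?thesis .
  qed
  moreover have "degree p \<le> N" by (rule degree_le) (simp add: coeff_p)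
  then have "(\<Sum>k\<le>N. coeff p k * (A ^^ k) x $ a $ b) = (\<Sum>k\<le>degree p. coeff p k * (A ^^ k) x $ a $ b)" for x a b
    by (intro sum.mono_neutral_right) (auto simp: coeff_eq_0)
  moreover have "p \<noteq> 0" using c(1) coeff_p by (metis coeff_0 of_real_eq_0_iff)
  ultimately show ?thesis by auto
qed

text \<open>The vectors \<open>P f\<close> are the images of the standard basis under a projection
  onto \<open>W\<close>. They are fixed once for all, so a whole series of vectors of
  \<open>W\<close> can be expanded in them with its own entries as coefficients.\<close>

lemma subspace_projection:
  fixes W :: "(complex^'e) set"
  assumes "vec.subspace W"
  shows "\<exists>P. (\<forall>f. P f \<in> W) \<and> (\<forall>w\<in>W. \<forall>e. w $ e = (\<Sum>f\<in>UNIV. w $ f * P f $ e))"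
proof -
  have "Vector_Spaces.linear (*s) (*s) (\<lambda>x::complex^'e. x)" by (rule vec.linear_ident)
  from vec.linear_exists_left_inverse_on[OF this assms] obtain g :: "complex^'e \<Rightarrow> complex^'e"
    where g: "range g \<subseteq> W" "Vector_Spaces.linear (*s) (*s) g" "\<forall>w\<in>W. g w = w"
    by auto
  interpret g: Vector_Spaces.linear "(*s)" "(*s)" g by (rule g(2))
  have "w $ e = (\<Sum>f\<in>UNIV. w $ f * g (axis f 1) $ e)" if "w \<in> W" for w e
  proof -
    have "w = g (\<Sum>f\<in>UNIV. w $ f *s axis f 1)" using g(3) that by (simp add: basis_expansion)
    also have "\<dots> = (\<Sum>f\<in>UNIV. w $ f *s g (axis f 1))" by (simp add: g.sum g.scale)
    finally have "w $ e = (\<Sum>f\<in>UNIV. w $ f *s g (axis f 1)) $ e" by (rule arg_cong)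
    then show ?thesis by (simp only: sum_component vector_smult_component)
  qed
  with g(1) show ?thesis by (intro exI[of _ "\<lambda>f. g (axis f 1)"]) auto
qed

section \<open>Tensor products and evaluation\<close>

lemma tensor_lift_abs:
  fixes f :: "'a::complex_algebra_1 \<Rightarrow> 'b::complex_algebra_1 \<Rightarrow> 'c::ab_group_add"
  assumes "\<And>a a' b. f (a + a') b = f a b + f a' b"
    and "\<And>a b b'. f a (b + b') = f a b + f a b'"
    and "\<And>c a b. f (c *\<^sub>C a) b = f a (c *\<^sub>C b)"
  shows "tensor_lift f (abs_tensor M) = (\<Sum>(a, b)\<in>#M. f a b)"
proof -
  have "tensor_eq (rep_tensor (abs_tensor M)) M"
    by (metis Quotient3_rep_abs Quotient3_tensor tensor_eq.refl)
  from tensor_eq_bilinear[OF assms this] show ?thesis by (simp add: tensor_lift_def)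
qed

lemma ex_abs_tensor: "\<exists>M. T = abs_tensor M"
  by (metis Quotient3_abs_rep Quotient3_tensor)

lemma tensor_lift_add:
  fixes f :: "'a::complex_algebra_1 \<Rightarrow> 'b::complex_algebra_1 \<Rightarrow> 'c::ab_group_add"
  assumes "\<And>a a' b. f (a + a') b = f a b + f a' b"
    and "\<And>a b b'. f a (b + b') = f a b + f a b'"
    and "\<And>c a b. f (c *\<^sub>C a) b = f a (c *\<^sub>C b)"
  shows "tensor_lift f (S + T) = tensor_lift f S + tensor_lift f T"
proof -
  obtain M N where "S = abs_tensor M" "T = abs_tensor N" using ex_abs_tensor by metis
  then show ?thesis by (simp add: plus_tensor.abs_eq tensor_lift_abs[OF assms])
qed

lemma tensor_induct [case_names zero pure add]:
  assumes "P 0" and "\<And>a b. P (a \<otimes>\<^sub>C b)" and "\<And>S T. P S \<Longrightarrow> P T \<Longrightarrow> P (S + T)"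
  shows "P T"
proof -
  obtain M where M: "T = abs_tensor M" using ex_abs_tensor by metis
  have "P (abs_tensor M)"
  proof (induction M)
    case empty
    then show ?case using assms(1) by (simp add: zero_tensor_def)
  next
    case (add x M)
    have "abs_tensor (add_mset x M) = fst x \<otimes>\<^sub>C snd x + abs_tensor M"
      by (simp add: pure_tensor.abs_eq plus_tensor.abs_eq)
    then show ?case using add assms by simp
  qed
  then show ?thesis by (simp add: M)
qed

lemma pure_tensor_add_left: "(a + a') \<otimes>\<^sub>C b = a \<otimes>\<^sub>C b + a' \<otimes>\<^sub>C b"
  by transfer (simp, metis add_mset_commute tensor_eq.add_left)

lemma pure_tensor_add_right: "a \<otimes>\<^sub>C (b + b') = a \<otimes>\<^sub>C b + a \<otimes>\<^sub>C b'"
  by transfer (simp, metis add_mset_commute tensor_eq.add_right)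

lemma pure_tensor_scale: "(c *\<^sub>C a) \<otimes>\<^sub>C b = a \<otimes>\<^sub>C (c *\<^sub>C b)"
  by transfer (rule tensor_eq.scale)

lemma pure_tensor_zero_left: "0 \<otimes>\<^sub>C b = 0"
  using pure_tensor_add_left[of 0 0 b] by simp

lemma pure_tensor_scaleC: "c *\<^sub>C (a \<otimes>\<^sub>C b) = (c *\<^sub>C a) \<otimes>\<^sub>C b"
  by transfer (simp add: tensor_eq.refl)

lemma pure_tensor_mult: "(a \<otimes>\<^sub>C b) * (a' \<otimes>\<^sub>C b') = (a * a') \<otimes>\<^sub>C (b * b')"
  by transfer (simp add: tensor_eq.refl)

lemma pure_tensor_one: "1 = 1 \<otimes>\<^sub>C 1"
  by transfer (simp add: tensor_eq.refl)

locale linear_pair =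
  fixes f :: "'a::complex_algebra_1 \<Rightarrow> 'c::complex_algebra_1"
    and g :: "'b::complex_algebra_1 \<Rightarrow> 'd::complex_algebra_1"
  assumes f_add: "f (a + a') = f a + f a'" and f_scale: "f (c *\<^sub>C a) = c *\<^sub>C f a"
    and g_add: "g (b + b') = g b + g b'" and g_scale: "g (c *\<^sub>C b) = c *\<^sub>C g b"
begin

lemma bilinear:
  "f (a + a') \<otimes>\<^sub>C g b = f a \<otimes>\<^sub>C g b + f a' \<otimes>\<^sub>C g b"
  "f a \<otimes>\<^sub>C g (b + b') = f a \<otimes>\<^sub>C g b + f a \<otimes>\<^sub>C g b'"
  "f (c *\<^sub>C a) \<otimes>\<^sub>C g b = f a \<otimes>\<^sub>C g (c *\<^sub>C b)"
  by (simp_all add: f_add f_scale g_add g_scale pure_tensor_add_left pure_tensor_add_right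
      pure_tensor_scale)

lemma tensor_map_add: "tensor_map f g (S + T) = tensor_map f g S + tensor_map f g T"
  unfolding tensor_map_def by (rule tensor_lift_add) (rule bilinear)+

lemma tensor_map_pure: "tensor_map f g (a \<otimes>\<^sub>C b) = f a \<otimes>\<^sub>C g b"
  unfolding tensor_map_def by (rule tensor_lift_pure) (rule bilinear)+

lemma tensor_map_zero: "tensor_map f g 0 = 0"
  using tensor_map_add[of 0 0] by simp

end

context word_grading
begin

lemma linear_pair_proj_id: "linear_pair (proj k) id"
  by unfold_locales (simp_all add: proj_add proj_scaleC)

lemma finite_tensor_proj: "finite {k. tensor_map (proj k) id T \<noteq> 0}"
proof (induction T rule: tensor_induct)
  case zero
  show ?case unfolding linear_pair.tensor_map_zero[OF linear_pair_proj_id] by simp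
next
  case (pure a b)
  have "tensor_map (proj k) id (a \<otimes>\<^sub>C b) = 0" if "proj k a = 0" for k
    by (simp add: linear_pair.tensor_map_pure[OF linear_pair_proj_id] that pure_tensor_zero_left)
  then have "{k. tensor_map (proj k) id (a \<otimes>\<^sub>C b) \<noteq> 0} \<subseteq> {k. proj k a \<noteq> 0}" by blast
  then show ?case using finite_proj by (rule finite_subset)
next
  case (add S T)
  have "tensor_map (proj k) id (S + T) = 0"
    if "tensor_map (proj k) id S = 0" "tensor_map (proj k) id T = 0" for k
    by (simp add: linear_pair.tensor_map_add[OF linear_pair_proj_id] that)
  then have "{k. tensor_map (proj k) id (S + T) \<noteq> 0} \<subseteq>
      {k. tensor_map (proj k) id S \<noteq> 0} \<union> {k. tensor_map (proj k) id T \<noteq> 0}" by blast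
  then show ?case using add by (meson finite_Un finite_subset)
qed

end

text \<open>\<open>Abs_fls\<close> returns the given coefficients only if these vanish far below. A
  tensor has finitely many components with respect to the degree of its first factor, which settles
  both signs.\<close>

lemma tau_left_nth:
  assumes "presented_by D (drinfeld_relators C d q free_var)"
  obtains K :: "int \<Rightarrow> ('a, 'a::complex_algebra_1) tensor" where "finite {n. K n \<noteq> 0}"
    "\<And>n. fls_nth (tau_left D 1 T \<beta>) n = K n" "\<And>n. fls_nth (tau_left D (-1) T \<beta>) n = K (- n)"
proof -
  interpret word_grading D "drinfeld_relators C d q free_var" word_degree
    by (rule word_degree_grading[OF assms])
  define K where "K n = tensor_map (graded_component (degree_space D) n) id (tensor_weight_component D T \<beta>)" for n
  have "graded_component (degree_space D) n = proj n" for n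
    by (rule ext) (simp add: degree_space_eq[OF assms] graded_component_eq_proj)
  then have fin: "finite {n. K n \<noteq> 0}" by (simp add: K_def finite_tensor_proj)
  have nth: "fls_nth (Abs_fls (\<lambda>n. K (e * n))) n = K (e * n)" if e: "e = 1 \<or> e = -1" for e n
  proof -
    have "finite ((\<lambda>n. e * n) -` {n. K n \<noteq> 0})"
      using e by (intro finite_vimageI fin) (auto simp: inj_def)
    then obtain N where N: "\<And>n. K (e * n) \<noteq> 0 \<Longrightarrow> N \<le> n"
      unfolding vimage_def by (metis (mono_tags, lifting) bdd_below_finite bdd_below.unfold mem_Collect_eq)
    show ?thesis
      by (rule nth_Abs_fls_lower_bound[of N]) (use N in force)
  qed
  show ?thesis
  proof (rule that[of K])
    show "fls_nth (tau_left D 1 T \<beta>) n = K n" for n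
      using nth[of 1 n] by (simp add: tau_left_def K_def)
    show "fls_nth (tau_left D (-1) T \<beta>) n = K (- n)" for n
      using nth[of "-1" n] by (simp add: tau_left_def K_def)
  qed (rule fin)
qed

lemma laurent_polynomial_regular:
  fixes f :: "complex fls"
  assumes fin: "finite {n. fls_nth f n \<noteq> 0}"
    and y: "y = fls_X \<and> (\<forall>n<0. fls_nth f n = 0) \<or> y = fls_X_inv \<and> (\<forall>n>0. fls_nth f n = 0)"
  shows "f \<in> regular_at y w"
proof -
  interpret subring_of_field "regular_at y w" by (rule regular_at_subring)
  define e :: int where "e = (if y = fls_X then 1 else -1)"
  obtain N where N: "\<And>n. fls_nth f n \<noteq> 0 \<Longrightarrow> \<bar>n\<bar> \<le> int N"
  proof -
    have "finite (abs ` {n. fls_nth f n \<noteq> 0})" using fin by simp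
    then obtain B where "\<And>n. fls_nth f n \<noteq> 0 \<Longrightarrow> \<bar>n\<bar> \<le> B"
      by (metis (mono_tags, lifting) bdd_above_finite bdd_above.unfold image_eqI mem_Collect_eq)
    then show ?thesis using that[of "nat B"] by force
  qed
  have y_nth: "fls_nth (y ^ n) m = (if m = e * int n then 1 else 0)" for n m
  proof (cases "y = fls_X")
    case True
    then show ?thesis by (simp add: e_def fls_X_power_nth)
  next
    case False
    then have "y = fls_X_inv" using y by blast
    then show ?thesis using False by (simp add: e_def fls_X_inv_power_nth)
  qed
  have supp: "fls_nth f m = 0" if "\<And>n. n \<le> N \<Longrightarrow> m \<noteq> e * int n" for m
  proof (rule ccontr)
    assume nz: "fls_nth f m \<noteq> 0"
    then have "\<bar>m\<bar> \<le> int N" by (rule N)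
    moreover have "m = e * \<bar>m\<bar>"
      using y nz fls_X_neq_X_inv by (auto simp: e_def abs_if) (metis not_less_iff_gr_or_eq)+
    ultimately show False using that[of "nat \<bar>m\<bar>"] by (simp add: nat_le_iff)
  qed
  have "f = (\<Sum>n\<le>N. fls_const (fls_nth f (e * int n)) * y ^ n)"
  proof (rule fls_eqI)
    fix m
    have "fls_nth (\<Sum>n\<le>N. fls_const (fls_nth f (e * int n)) * y ^ n) m =
        (\<Sum>n\<le>N. if m = e * int n then fls_nth f m else 0)"
      by (simp add: fls_nth_sum y_nth mult_delta_right if_distrib cong: if_cong)
    also have "\<dots> = fls_nth f m"
    proof (cases "\<exists>n\<le>N. m = e * int n")
      case True
      then obtain n where n: "n \<le> N" "m = e * int n" by blast
      have "(\<Sum>n\<le>N. if m = e * int n then fls_nth f m else 0) = (\<Sum>k\<le>N. if k = n then fls_nth f m else 0)"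
        using n(2) by (intro sum.cong) (auto simp: e_def split: if_splits)
      then show ?thesis using n(1) by simp
    next
      case False
      then show ?thesis using supp[of m] by (simp add: sum.neutral)
    qed
    finally show "fls_nth f m = fls_nth (\<Sum>n\<le>N. fls_const (fls_nth f (e * int n)) * y ^ n) m" by simp
  qed
  then show ?thesis
    by (metis (no_types, lifting) sum_mem mult_mem regular_at_const power_mem regular_at_var)
qed

text \<open>The bounds need not be the subdegrees: a representation may kill leading coefficients,
  so that the subdegree rises after evaluation.\<close>

lemma fls_times_nth_bounds:
  fixes f g :: "'a::semiring_0 fls"
  assumes "\<And>i. i < a \<Longrightarrow> fls_nth f i = 0" "\<And>i. i < b \<Longrightarrow> fls_nth g i = 0"
  shows "fls_nth (f * g) n = (\<Sum>i=a..n-b. fls_nth f i * fls_nth g (n - i))"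
proof (cases "f = 0 \<or> g = 0")
  case False
  then have "a \<le> fls_subdegree f" "b \<le> fls_subdegree g"
    using assms by (auto intro!: fls_subdegree_geI)
  then show ?thesis
    unfolding fls_times_nth(2)
    by (intro sum.mono_neutral_left) (auto simp: fls_eq0_below_subdegree)
qed auto

lemma kronecker_nth: "kronecker A B $ k $ l = A $ fst k $ fst l * B $ snd k $ snd l"
  by (simp add: kronecker_def)

lemma kronecker_mult: "kronecker A B ** kronecker A' B' = kronecker (A ** A') (B ** B')"
proof -
  have "(\<Sum>e\<in>UNIV. A $ k1 $ fst e * B $ k2 $ snd e * (A' $ fst e $ l1 * B' $ snd e $ l2)) =
      (\<Sum>e\<in>UNIV. A $ k1 $ e * A' $ e $ l1) * (\<Sum>e\<in>UNIV. B $ k2 $ e * B' $ e $ l2)" for k1 k2 l1 l2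
    by (simp add: sum_product sum.cartesian_product UNIV_Times_UNIV[symmetric] case_prod_unfold mult_ac
        del: UNIV_Times_UNIV)
  then show ?thesis by (simp add: vec_eq_iff matrix_matrix_mult_def kronecker_nth)
qed

lemma kronecker_mat_1: "kronecker (mat 1) (mat 1) = mat 1"
  by (auto simp: vec_eq_iff kronecker_nth mat_def prod_eq_iff)

section \<open>Evaluation of tensors in a pair of representations\<close>

locale representation_pair =
  fixes \<phi> :: "'u::complex_algebra_1 \<Rightarrow> complex^'n^'n" and \<psi> :: "'u \<Rightarrow> complex^'m^'m"
  assumes \<phi>: "matrix_representation \<phi>" and \<psi>: "matrix_representation \<psi>"
begin

lemma \<phi>_simps: "\<phi> 1 = mat 1" "\<phi> (x + y) = \<phi> x + \<phi> y" "\<phi> (x * y) = \<phi> x ** \<phi> y"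
    "\<phi> (c *\<^sub>C x) $ k $ l = c * \<phi> x $ k $ l"
  using \<phi> by (simp_all add: matrix_representation_def)

lemma \<psi>_simps: "\<psi> 1 = mat 1" "\<psi> (x + y) = \<psi> x + \<psi> y" "\<psi> (x * y) = \<psi> x ** \<psi> y"
    "\<psi> (c *\<^sub>C x) $ k $ l = c * \<psi> x $ k $ l"
  using \<psi> by (simp_all add: matrix_representation_def)

lemma bilinear:
  "kronecker (\<phi> (a + a')) (\<psi> b) = kronecker (\<phi> a) (\<psi> b) + kronecker (\<phi> a') (\<psi> b)"
  "kronecker (\<phi> a) (\<psi> (b + b')) = kronecker (\<phi> a) (\<psi> b) + kronecker (\<phi> a) (\<psi> b')"
  "kronecker (\<phi> (c *\<^sub>C a)) (\<psi> b) = kronecker (\<phi> a) (\<psi> (c *\<^sub>C b))"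
  by (simp_all add: vec_eq_iff kronecker_nth \<phi>_simps \<psi>_simps algebra_simps)

abbreviation "\<rho> \<equiv> tensor_rep \<phi> \<psi>"

lemma \<rho>_add: "\<rho> (S + T) = \<rho> S + \<rho> T"
  unfolding tensor_rep_def by (rule tensor_lift_add) (rule bilinear)+

lemma \<rho>_pure: "\<rho> (a \<otimes>\<^sub>C b) = kronecker (\<phi> a) (\<psi> b)"
  unfolding tensor_rep_def by (rule tensor_lift_pure) (rule bilinear)+

lemma \<rho>_zero: "\<rho> 0 = 0"
  using \<rho>_add[of 0 0] by simp

lemma \<rho>_one: "\<rho> 1 = mat 1"
  by (simp add: pure_tensor_one \<rho>_pure \<phi>_simps \<psi>_simps kronecker_mat_1)

lemma \<rho>_scale: "\<rho> (c *\<^sub>C T) $ k $ l = c * \<rho> T $ k $ l"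
proof (induction T rule: tensor_induct)
  case (pure a b)
  show ?case by (simp add: pure_tensor_scaleC \<rho>_pure kronecker_nth \<phi>_simps)
qed (simp_all add: scaleC_zero_right scaleC_add_right \<rho>_zero \<rho>_add distrib_left)

lemma \<rho>_mult: "\<rho> (S * T) = \<rho> S ** \<rho> T"
proof (induction S rule: tensor_induct)
  case (pure a b)
  show ?case
  proof (induction T rule: tensor_induct)
    case (pure a' b')
    show ?case by (simp add: pure_tensor_mult \<rho>_pure \<phi>_simps \<psi>_simps kronecker_mult)
  qed (simp_all add: \<rho>_zero \<rho>_add distrib_left matrix_add_ldistrib)
qed (simp_all add: \<rho>_zero \<rho>_add distrib_right vec_eq_iff matrix_matrix_mult_def sum.distrib)

lemma \<rho>_sum: "\<rho> (sum f S) = (\<Sum>i\<in>S. \<rho> (f i))"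
  by (induction S rule: infinite_finite_induct) (simp_all add: \<rho>_zero \<rho>_add)

definition \<rho>_fls :: "('u, 'u) tensor fls \<Rightarrow> (complex fls)^('n \<times> 'm)^('n \<times> 'm)"
  where "\<rho>_fls f = (\<chi> k l. Abs_fls (\<lambda>n. \<rho> (fls_nth f n) $ k $ l))"

lemma \<rho>_fls_nth: "fls_nth (\<rho>_fls f $ k $ l) n = \<rho> (fls_nth f n) $ k $ l"
  unfolding \<rho>_fls_def vec_lambda_beta
  by (rule nth_Abs_fls_lower_bound[of "fls_subdegree f"]) (simp add: \<rho>_zero)

lemma \<rho>_fls_add: "\<rho>_fls (f + g) = \<rho>_fls f + \<rho>_fls g"
  by (simp add: vec_eq_iff fls_eq_iff \<rho>_fls_nth \<rho>_add)

lemma \<rho>_fls_zero: "\<rho>_fls 0 = 0"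
  by (simp add: vec_eq_iff fls_eq_iff \<rho>_fls_nth \<rho>_zero)

lemma \<rho>_fls_sum: "\<rho>_fls (sum f S) = (\<Sum>i\<in>S. \<rho>_fls (f i))"
  by (induction S rule: infinite_finite_induct) (simp_all add: \<rho>_fls_zero \<rho>_fls_add)

lemma \<rho>_fls_mult: "\<rho>_fls (f * g) = \<rho>_fls f ** \<rho>_fls g"
proof -
  let ?a = "fls_subdegree f" and ?b = "fls_subdegree g"
  have "fls_nth (\<rho>_fls (f * g) $ k $ l) n = fls_nth ((\<rho>_fls f ** \<rho>_fls g) $ k $ l) n" for k l n
  proof -
    have "fls_nth (\<rho>_fls (f * g) $ k $ l) n =
        (\<Sum>i=?a..n-?b. \<Sum>e\<in>UNIV. \<rho> (fls_nth f i) $ k $ e * \<rho> (fls_nth g (n - i)) $ e $ l)"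
      by (simp add: \<rho>_fls_nth fls_times_nth(2) \<rho>_sum \<rho>_mult matrix_matrix_mult_def sum_component)
    also have "\<dots> = (\<Sum>e\<in>UNIV. \<Sum>i=?a..n-?b. \<rho> (fls_nth f i) $ k $ e * \<rho> (fls_nth g (n - i)) $ e $ l)"
      by (rule sum.swap)
    also have "\<dots> = (\<Sum>e\<in>UNIV. fls_nth (\<rho>_fls f $ k $ e * \<rho>_fls g $ e $ l) n)"
      by (subst fls_times_nth_bounds[of ?a _ ?b]) (simp_all add: \<rho>_fls_nth \<rho>_zero)
    finally show ?thesis by (simp add: matrix_matrix_mult_def fls_nth_sum)
  qed
  then show ?thesis by (simp add: vec_eq_iff fls_eq_iff)
qed

end

section \<open>Commutators of Cartan and root currents\<close>

text \<open>The scalar in \<open>[h\<^sub>i\<^sub>,\<^sub>s, x\<^sub>j\<^sub>,\<^sub>n]\<close>, for \<open>b = b\<^sub>i\<^sub>j\<close>.\<close>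

definition h_scalar :: "complex \<Rightarrow> int \<Rightarrow> nat \<Rightarrow> complex"
  where "h_scalar q b s = (q powi (int s * b) - q powi (- (int s * b))) / (of_nat s * (q - inverse q))"

lemma not_root_of_unity_simps:
  assumes "not_root_of_unity q"
  shows "q \<noteq> 0" "q - inverse q \<noteq> 0"
proof -
  show q: "q \<noteq> 0" using assms by (simp add: not_root_of_unity_def)
  have "q ^ 2 \<noteq> 1" using assms by (simp add: not_root_of_unity_def)
  with q show "q - inverse q \<noteq> 0" by (auto simp: field_simps power2_eq_square)
qed

locale drinfeld_algebra =
  fixes C :: "'i::finite \<Rightarrow> 'i \<Rightarrow> int" and d :: "'i \<Rightarrow> int" and q :: complex
    and D :: "'i drinfeld_gen \<Rightarrow> 'u::complex_algebra_1"
  assumes presented: "presented_by D (drinfeld_relators C d q free_var)"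
    and q: "not_root_of_unity q"
begin

abbreviation "bform i j \<equiv> d i * C i j"

lemma phi_commute: "D (GPhi \<epsilon> i m) * D (GPhi \<epsilon>' j n) = D (GPhi \<epsilon>' j n) * D (GPhi \<epsilon> i m)"
proof -
  have "free_var (GPhi \<epsilon> i m) * free_var (GPhi \<epsilon>' j n) - free_var (GPhi \<epsilon>' j n) * free_var (GPhi \<epsilon> i m)
    \<in> drinfeld_relators C d q free_var"
    unfolding drinfeld_relators_def Let_def
    by (rule UnI1, rule UnI1, rule UnI1, rule UnI1, rule UnI2, intro CollectI exI conjI TrueI, rule HOL.refl)
  from free_eval_relator[OF presented this] show ?thesis by (simp add: free_eval_simps)
qed

lemma phi_0_inverse:
  "D (GPhi Plus i 0) * D (GPhi Minus i 0) = 1" "D (GPhi Minus i 0) * D (GPhi Plus i 0) = 1"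
proof -
  have "free_var (GPhi Plus i 0) * free_var (GPhi Minus i 0) - 1 \<in> drinfeld_relators C d q free_var"
    unfolding drinfeld_relators_def Let_def
    by (rule UnI1, rule UnI1, rule UnI1, rule UnI1, rule UnI1, rule UnI2, intro CollectI exI conjI TrueI, rule HOL.refl)
  from free_eval_relator[OF presented this] show "D (GPhi Plus i 0) * D (GPhi Minus i 0) = 1"
    by (simp add: free_eval_simps)
  then show "D (GPhi Minus i 0) * D (GPhi Plus i 0) = 1" by (simp only: phi_commute)
qed

lemma phi_x_relation:
  "D (GPhi Plus i (m + 1)) * D (GX \<sigma> j n) - q powi (pm_sign \<sigma> * bform i j) *\<^sub>C (D (GPhi Plus i m) * D (GX \<sigma> j (n + 1))) =
   q powi (pm_sign \<sigma> * bform i j) *\<^sub>C (D (GX \<sigma> j n) * D (GPhi Plus i (m + 1))) - D (GX \<sigma> j (n + 1)) * D (GPhi Plus i m)"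
proof -
  have "free_var (GPhi Plus i (m + 1)) * free_var (GX \<sigma> j n) -
      q powi (pm_sign \<sigma> * bform i j) *\<^sub>C (free_var (GPhi Plus i m) * free_var (GX \<sigma> j (n + 1))) -
      (q powi (pm_sign \<sigma> * bform i j) *\<^sub>C (free_var (GX \<sigma> j n) * free_var (GPhi Plus i (m + 1))) -
       free_var (GX \<sigma> j (n + 1)) * free_var (GPhi Plus i m)) \<in> drinfeld_relators C d q free_var"
    unfolding drinfeld_relators_def Let_def
    by (rule UnI1, rule UnI1, rule UnI2, intro CollectI exI conjI TrueI, rule HOL.refl)
  from free_eval_relator[OF presented this] show ?thesis by (simp add: free_eval_simps)
qed

lemma phi_neg:
  assumes "m < 0"
  shows "D (GPhi Plus i m) = 0"
proof -
  have "free_var (GPhi Plus i m) \<in> {free_var (GPhi Plus i m) |i m. m < 0}" using assms by blast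
  then have "free_var (GPhi Plus i m) \<in> drinfeld_relators C d q free_var"
    unfolding drinfeld_relators_def Let_def by (intro UnI1)
  from free_eval_relator[OF presented this] show ?thesis by (simp add: free_eval_simps)
qed

text \<open>The relation at \<open>m = -1\<close>, where both terms with index -1 vanish.\<close>

lemma phi_0_x: "D (GPhi Plus i 0) * D (GX \<sigma> j n) = q powi (pm_sign \<sigma> * bform i j) *\<^sub>C (D (GX \<sigma> j n) * D (GPhi Plus i 0))"
  using phi_x_relation[of i "-1" \<sigma> j n] by (simp add: phi_neg scaleC_zero_right)

lemma phi_0_conj:
  "D (GPhi Minus i 0) * D (GX \<sigma> j n) * D (GPhi Plus i 0) = inverse (q powi (pm_sign \<sigma> * bform i j)) *\<^sub>C D (GX \<sigma> j n)"
proof -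
  let ?Q = "q powi (pm_sign \<sigma> * bform i j)"
  have Q: "?Q \<noteq> 0" using not_root_of_unity_simps[OF q] by simp
  have "D (GX \<sigma> j n) = D (GPhi Minus i 0) * (D (GPhi Plus i 0) * D (GX \<sigma> j n))"
    by (simp add: phi_0_inverse flip: mult.assoc)
  also have "\<dots> = ?Q *\<^sub>C (D (GPhi Minus i 0) * D (GX \<sigma> j n) * D (GPhi Plus i 0))"
    by (simp add: phi_0_x mult_scaleC_right mult.assoc)
  finally have "inverse ?Q *\<^sub>C D (GX \<sigma> j n) =
      inverse ?Q *\<^sub>C ?Q *\<^sub>C (D (GPhi Minus i 0) * D (GX \<sigma> j n) * D (GPhi Plus i 0))"
    by (rule arg_cong)
  then show ?thesis using Q by (simp add: scaleC_scaleC scaleC_one)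
qed

text \<open>Dividing the Cartan current by its constant term gives the exponential of
  \<open>g\<close>. The Drinfeld relation, conjugated accordingly, has the form required by
  \<open>commutator_log\<close>, and the coefficient of \<open>g\<close> at \<open>s\<close> is
  \<open>(q - inverse q) *\<^sub>C h i (int s)\<close>.\<close>

lemma h_x_commutator:
  assumes h: "cartan_currents q D h" and s: "s > 0"
  shows "h i (int s) * D (GX \<sigma> j n) - D (GX \<sigma> j n) * h i (int s) =
    (of_int (pm_sign \<sigma>) * h_scalar q (bform i j) s) *\<^sub>C D (GX \<sigma> j (n + int s))"
proof -
  let ?Q = "q powi (pm_sign \<sigma> * bform i j)" and ?K = "D (GPhi Minus i 0)"
  note q0 = not_root_of_unity_simps[OF q]
  define g where "g = Abs_fps (\<lambda>n. if n = 0 then 0 else (q - inverse q) *\<^sub>C h i (int n))"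
  define \<Phi> where "\<Phi> = fps_const ?K * Abs_fps (\<lambda>n. D (GPhi Plus i (int n)))"
  have "Abs_fps (\<lambda>n. D (GPhi Plus i (int n))) = fps_const (D (GPhi Plus i 0)) * exp_of_fps g"
    using h by (simp add: cartan_currents_def g_def)
  then have \<Phi>: "\<Phi> = exp_of_fps g"
    by (simp add: \<Phi>_def phi_0_inverse mult.assoc[symmetric])
  have \<Phi>_nth: "fps_nth \<Phi> n = ?K * D (GPhi Plus i (int n))" for n by (simp add: \<Phi>_def)
  have g0: "fps_nth g 0 = 0" by (simp add: g_def)
  \<comment> \<open>Two applications of \<open>commute_log\<close>: from commuting coefficients of
    \<open>\<Phi>\<close> one factor at a time is replaced by a coefficient of
    \<open>g\<close>.\<close>
  have "D (GPhi \<epsilon> i m) * fps_nth \<Phi> n = fps_nth \<Phi> n * D (GPhi \<epsilon> i m)" for \<epsilon> m n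
    unfolding \<Phi>_nth by (metis phi_commute mult.assoc)
  then have phi_g: "D (GPhi \<epsilon> i m) * fps_nth g n = fps_nth g n * D (GPhi \<epsilon> i m)" for \<epsilon> m n
    by (rule commute_log[OF \<Phi> g0])
  have "fps_nth g m * fps_nth \<Phi> n = fps_nth \<Phi> n * fps_nth g m" for m n
    unfolding \<Phi>_nth by (metis phi_g mult.assoc)
  then have gg: "fps_nth g m * fps_nth g n = fps_nth g n * fps_nth g m" for m n
    by (rule commute_log[OF \<Phi> g0])
  have euler_g: "euler g * g = g * euler g"
  proof (rule fps_ext)
    fix n
    have "fps_nth (euler g * g) n = (\<Sum>k\<in>{0..n}. fps_nth (euler g) k * fps_nth g (n - k))"
      by (simp add: fps_mult_nth)
    also have "\<dots> = (\<Sum>k\<in>{0..n}. fps_nth (euler g) (n - k) * fps_nth g k)"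
      by (rule sum.reindex_bij_witness[of _ "\<lambda>k. n - k" "\<lambda>k. n - k"]) auto
    also have "\<dots> = (\<Sum>k\<in>{0..n}. fps_nth g k * fps_nth (euler g) (n - k))"
    proof (rule sum.cong)
      fix k
      show "fps_nth (euler g) (n - k) * fps_nth g k = fps_nth g k * fps_nth (euler g) (n - k)"
        by (simp add: euler_nth of_nat_scaleC mult_scaleC_left mult_scaleC_right gg)
    qed simp
    finally show "fps_nth (euler g * g) n = fps_nth (g * euler g) n"
      by (simp add: fps_mult_nth)
  qed
  have Q0: "?Q \<noteq> 0" using q0 by simp
  have rel: "fps_nth \<Phi> (Suc m) * D (GX \<sigma> j n) - ?Q *\<^sub>C (fps_nth \<Phi> m * D (GX \<sigma> j (n + 1))) =
      D (GX \<sigma> j n) * fps_nth \<Phi> (Suc m) - inverse ?Q *\<^sub>C (D (GX \<sigma> j (n + 1)) * fps_nth \<Phi> m)" for m n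
  proof -
    \<comment> \<open>Moving \<open>?K\<close> past a root current costs \<open>inverse ?Q\<close>.
      On the right of the relation this cancels one factor \<open>?Q\<close> and puts
      \<open>inverse ?Q\<close> on the other term.\<close>
    have conj: "?K * (D (GX \<sigma> j n) * D (GPhi Plus i m)) = inverse ?Q *\<^sub>C (D (GX \<sigma> j n) * (?K * D (GPhi Plus i m)))" for n m
    proof -
      have "?K * (D (GX \<sigma> j n) * D (GPhi Plus i m)) = ?K * D (GX \<sigma> j n) * (D (GPhi Plus i 0) * ?K) * D (GPhi Plus i m)"
        by (simp add: phi_0_inverse mult.assoc)
      also have "\<dots> = (?K * D (GX \<sigma> j n) * D (GPhi Plus i 0)) * (?K * D (GPhi Plus i m))"
        by (simp add: mult.assoc)
      finally show ?thesis by (simp only: phi_0_conj mult_scaleC_left)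
    qed
    have "?K * (D (GPhi Plus i (int m + 1)) * D (GX \<sigma> j n) - ?Q *\<^sub>C (D (GPhi Plus i (int m)) * D (GX \<sigma> j (n + 1)))) =
      ?K * (?Q *\<^sub>C (D (GX \<sigma> j n) * D (GPhi Plus i (int m + 1))) - D (GX \<sigma> j (n + 1)) * D (GPhi Plus i (int m)))"
      by (simp only: phi_x_relation)
    then have "?K * D (GPhi Plus i (int m + 1)) * D (GX \<sigma> j n) - ?Q *\<^sub>C (?K * D (GPhi Plus i (int m)) * D (GX \<sigma> j (n + 1))) =
      ?Q *\<^sub>C inverse ?Q *\<^sub>C (D (GX \<sigma> j n) * (?K * D (GPhi Plus i (int m + 1)))) -
        inverse ?Q *\<^sub>C (D (GX \<sigma> j (n + 1)) * (?K * D (GPhi Plus i (int m))))"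
      by (simp only: right_diff_distrib mult_scaleC_right conj) (simp only: mult.assoc)
    moreover have "?Q *\<^sub>C inverse ?Q *\<^sub>C y = y" for y :: 'u
      using Q0 by (simp only: scaleC_scaleC) (simp add: scaleC_one)
    moreover have "int (Suc m) = int m + 1" by simp
    ultimately show ?thesis by (simp only: \<Phi>_nth)
  qed
  have c1: "of_nat s *\<^sub>C (fps_nth g s * D (GX \<sigma> j n) - D (GX \<sigma> j n) * fps_nth g s) =
      (?Q ^ s - inverse ?Q ^ s) *\<^sub>C D (GX \<sigma> j (n + int s))"
    by (rule commutator_log[OF \<Phi> g0 euler_g Q0 _ s]) (rule rel)
  have c2: "fps_nth g s = (q - inverse q) *\<^sub>C h i (int s)" using s by (simp add: g_def)
  have c3: "?Q ^ s - inverse ?Q ^ s =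
      of_int (pm_sign \<sigma>) * (q powi (int s * bform i j) - q powi (- (int s * bform i j)))"
  proof -
    have "?Q ^ s = q powi (pm_sign \<sigma> * (int s * bform i j))"
      by (simp add: mult_ac flip: power_int_of_nat power_int_mult)
    moreover have "inverse ?Q ^ s = q powi (- (pm_sign \<sigma> * (int s * bform i j)))"
      using \<open>?Q ^ s = _\<close> by (simp add: power_inverse power_int_minus)
    ultimately show ?thesis by (cases \<sigma>) simp_all
  qed
  have eq: "(of_nat s * (q - inverse q)) *\<^sub>C (h i (int s) * D (GX \<sigma> j n) - D (GX \<sigma> j n) * h i (int s)) =
      (of_int (pm_sign \<sigma>) * (q powi (int s * bform i j) - q powi (- (int s * bform i j)))) *\<^sub>C D (GX \<sigma> j (n + int s))"
  proof -
    have dist: "c *\<^sub>C (x - y) = c *\<^sub>C x - c *\<^sub>C (y::'u)" for c x y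
      using scaleC_add_right[of c "x - y" y] by (simp add: algebra_simps)
    show ?thesis
      using c1 unfolding c2 c3 by (simp only: mult_scaleC_left mult_scaleC_right scaleC_scaleC dist)
  qed
  have nz: "of_nat s * (q - inverse q) \<noteq> 0" using s q0 by simp
  have "x = inverse c *\<^sub>C y" if "c *\<^sub>C x = y" "c \<noteq> 0" for c and x y :: 'u
    using that by (auto simp: scaleC_scaleC scaleC_one)
  from this[OF eq nz] show ?thesis
    unfolding scaleC_scaleC h_scalar_def divide_inverse by (simp only: mult_ac)
qed

end

section \<open>Root data and derivations\<close>

text \<open>For \<open>i \<noteq> j\<close> the form is positive at the sum of the two simple roots:
  2 d_i + 2 d_j + 2 b_ij > 0, and b_ij is not positive.\<close>

lemma simple_cartan_datum_bounds:
  assumes "simple_cartan_datum C d"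
  shows "d i * C i i = 2 * d i" "d i > 0" "i \<noteq> j \<Longrightarrow> \<bar>d i * C i j\<bar> < d i + d j"
proof -
  show di: "d i * C i i = 2 * d i" "d i > 0" for i
    using assms by (simp_all add: simple_cartan_datum_def)
  show "\<bar>d i * C i j\<bar> < d i + d j" if "i \<noteq> j"
  proof -
    have C: "C i j \<le> 0" and sym: "d i * C i j = d j * C j i"
      using assms that by (simp_all add: simple_cartan_datum_def)
    define v :: "'a \<Rightarrow> real" where "v k = (if k = i \<or> k = j then 1 else 0)" for k
    have "v i \<noteq> 0" by (simp add: v_def)
    then have "v \<noteq> (\<lambda>_. 0)" by auto
    then have pos: "(\<Sum>k\<in>UNIV. \<Sum>l\<in>UNIV. v k * of_int (d k * C k l) * v l) > 0"
      using assms unfolding simple_cartan_datum_def by blast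
    have "(\<Sum>l\<in>UNIV. v k * of_int (d k * C k l) * v l) = (\<Sum>l\<in>{i, j}. v k * of_int (d k * C k l) * v l)" for k
      by (rule sum.mono_neutral_right) (auto simp: v_def)
    then have "(\<Sum>k\<in>UNIV. \<Sum>l\<in>UNIV. v k * of_int (d k * C k l) * v l) =
        (\<Sum>k\<in>UNIV. \<Sum>l\<in>{i, j}. v k * of_int (d k * C k l) * v l)" by simp
    also have "\<dots> = (\<Sum>k\<in>{i, j}. \<Sum>l\<in>{i, j}. v k * of_int (d k * C k l) * v l)"
      by (rule sum.mono_neutral_right) (auto simp: v_def)
    also have "\<dots> = of_int (d i * C i i + d i * C i j + (d j * C j i + d j * C j j))"
      using that by (simp add: v_def)
    finally have "(0::real) < of_int (d i * C i i + d i * C i j + (d j * C j i + d j * C j j))"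
      using pos by simp
    then have "0 < d i * C i i + d i * C i j + (d j * C j i + d j * C j j)" by (simp only: of_int_0_less_iff)
    moreover have "d i * C i j \<le> 0" using C di(2)[of i] by (simp add: mult_nonneg_nonpos)
    ultimately show ?thesis using sym di(1)[of i] di(1)[of j] by linarith
  qed
qed

text \<open>The difference of two weights with the same image pairs to zero with all simple roots,
  hence with itself, and the form is positive definite.\<close>

lemma simple_cartan_datum_form_inj:
  assumes "simple_cartan_datum C d"
  shows "inj (\<lambda>\<beta> i. \<Sum>j\<in>UNIV. d i * C i j * int (\<beta> j))"
proof (rule injI)
  fix \<beta> \<gamma> :: "'a \<Rightarrow> nat"
  assume eq: "(\<lambda>i. \<Sum>j\<in>UNIV. d i * C i j * int (\<beta> j)) = (\<lambda>i. \<Sum>j\<in>UNIV. d i * C i j * int (\<gamma> j))"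
  define v :: "'a \<Rightarrow> int" where "v i = int (\<beta> i) - int (\<gamma> i)" for i
  have 0: "(\<Sum>j\<in>UNIV. d i * C i j * v j) = 0" for i
    using fun_cong[OF eq, of i] by (simp add: v_def right_diff_distrib sum_subtractf)
  have "(\<Sum>i\<in>UNIV. \<Sum>j\<in>UNIV. real_of_int (v i) * of_int (d i * C i j) * real_of_int (v j)) =
      of_int (\<Sum>i\<in>UNIV. v i * (\<Sum>j\<in>UNIV. d i * C i j * v j))"
    by (simp add: sum_distrib_left mult.assoc)
  also have "\<dots> = 0" by (simp only: 0) simp
  finally have "\<not> (\<Sum>i\<in>UNIV. \<Sum>j\<in>UNIV. real_of_int (v i) * of_int (d i * C i j) * real_of_int (v j)) > 0"
    by simp
  then have "(\<lambda>i. real_of_int (v i)) = (\<lambda>_. 0)"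
    using assms unfolding simple_cartan_datum_def by blast
  then have "v i = 0" for i by (metis of_int_eq_0_iff)
  then show "\<beta> = \<gamma>" by (auto simp: v_def)
qed

lemma not_root_of_unity_powi_inj:
  assumes "not_root_of_unity q"
  shows "inj (\<lambda>n::int. q powi n)"
proof (rule linorder_injI)
  note q0 = not_root_of_unity_simps(1)[OF assms]
  fix m n :: int assume "m < n"
  show "q powi m \<noteq> q powi n"
  proof
    assume eq: "q powi m = q powi n"
    have "q powi n = q powi m * q powi (n - m)" using q0 by (simp flip: power_int_add)
    then have "q powi (n - m) = 1" using eq q0 by simp
    then have "q ^ nat (n - m) = 1" using \<open>m < n\<close> by (simp add: power_int_def)
    moreover have "nat (n - m) > 0" using \<open>m < n\<close> by simp
    ultimately show False using assms unfolding not_root_of_unity_def by blast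
  qed
qed

lemma h_scalar_1_nonzero:
  assumes "not_root_of_unity q" "b \<noteq> 0"
  shows "h_scalar q b 1 \<noteq> 0"
proof -
  have "q powi b \<noteq> q powi (- b)"
    using injD[OF not_root_of_unity_powi_inj[OF assms(1)], of b "- b"] assms(2) by auto
  then show ?thesis using not_root_of_unity_simps[OF assms(1)] by (simp add: h_scalar_def)
qed

lemma matrix_representation_simps:
  assumes "matrix_representation \<xi>"
  shows "\<xi> 1 = mat 1" "\<xi> (x + y) = \<xi> x + \<xi> y" "\<xi> (x * y) = \<xi> x ** \<xi> y"
    "\<xi> (c *\<^sub>C x) $ k $ l = c * \<xi> x $ k $ l" "\<xi> 0 = 0" "\<xi> (x - y) = \<xi> x - \<xi> y"
    "\<xi> (c *\<^sub>C x) = (\<chi> k l. c * \<xi> x $ k $ l)"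
proof -
  show add: "\<xi> (x + y) = \<xi> x + \<xi> y" for x y
    using assms by (simp add: matrix_representation_def)
  show "\<xi> 0 = 0" using add[of 0 0] by simp
  show "\<xi> (x - y) = \<xi> x - \<xi> y" using add[of "x - y" y] by simp
qed (use assms in \<open>simp_all add: matrix_representation_def\<close>)

text \<open>Let \<open>B\<close> have the roots b, and let \<open>A\<close> have the roots y a and
  \<open>s0\<close> times 0. A Bezout identity U B + V A = 1 over \<open>R\<close> gives F = V A = 1
  - U B: the second form shows that F is the identity on sequences killed by \<open>B\<close>, the
  first that it kills what \<open>A\<close> kills.\<close>

lemma interpolation:
  fixes R :: "complex fls set" and as bs :: "complex list"
  assumes R: "subring_of_field R" and const: "\<And>c. fls_const c \<in> R" and y: "y \<in> R" "y \<noteq> 0"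
    and bs: "0 \<notin> set bs"
    and unit: "\<And>a b. a \<in> set as \<Longrightarrow> b \<in> set bs \<Longrightarrow>
      fls_const b \<noteq> y * fls_const a \<and> inverse (fls_const b - y * fls_const a) \<in> R"
  obtains F where "\<And>n. coeff F n \<in> R" "\<And>n. n < s0 \<Longrightarrow> coeff F n = 0"
    "\<And>x m. annihilates bs x \<Longrightarrow>
      shift_act F (\<lambda>m. fls_const (x m)) m = fls_const (x m)"
    "\<And>x m. annihilates as x \<Longrightarrow>
      (\<Sum>s\<le>degree F. coeff F s * (y ^ s * fls_const (x (m + int s)))) = 0"
proof -
  interpret subring_of_field R by (rule R)
  \<comment> \<open>The additional zeros make F divisible by the \<open>s0\<close>-th power of the
    variable; \<open>0 \<notin> set bs\<close> keeps them apart from the roots of the other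
    polynomial.\<close>
  let ?as = "as @ replicate s0 0"
  define A where "A = root_poly (map (\<lambda>a. y * fls_const a) ?as)"
  define B where "B = root_poly (map fls_const bs)"
  have "comaximal B A"
    unfolding A_def B_def
  proof (rule comaximal_root_poly)
    show "set (map (\<lambda>a. y * fls_const a) ?as) \<subseteq> R" "set (map fls_const bs) \<subseteq> R"
      using const y zero_mem by (auto intro!: mult_mem)
    fix a b assume a: "a \<in> set (map (\<lambda>a. y * fls_const a) ?as)" and b: "b \<in> set (map fls_const bs)"
    from a obtain a' where a': "a = y * fls_const a'" "a' \<in> set ?as" unfolding set_map by blast
    from b obtain b' where b': "b = fls_const b'" "b' \<in> set bs" unfolding set_map by blast
    have "a' \<in> set as \<or> a' = 0" using a'(2) by (auto split: if_splits)
    note ab = a'(1) b' this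
    show "a \<noteq> b \<and> inverse (b - a) \<in> R"
    proof (cases "a' = 0")
      case True
      have "b' \<noteq> 0" using ab(3) bs by auto
      moreover have "inverse (fls_const b') = fls_const (inverse b')" by (simp add: fls_inverse_const)
      ultimately show ?thesis using True ab const zero_mem by (auto simp: fls_const_nonzero)
    next
      case False
      then show ?thesis using ab unit[of a' b'] by metis
    qed
  qed
  then obtain U V where UV: "U \<in> polys" "V \<in> polys" "U * B + V * A = 1"
    by (auto simp: comaximal_def)
  define F where "F = V * A"
  have "A \<in> polys" unfolding A_def using const y zero_mem by (intro polys_root_poly) (auto intro!: mult_mem)
  then have "F \<in> polys" unfolding F_def using UV by (intro polys_mult)
  have F1: "F = 1 - U * B" using UV(3) by (simp add: F_def algebra_simps)
  have act_B: "shift_act (root_poly (map fls_const bs)) (\<lambda>m. fls_const (x m)) m =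
      fls_const (shift_act (root_poly bs) x m)" for x m and bs :: "complex list"
  proof (induction bs arbitrary: x m)
    case (Cons b bs)
    have "shift_act (root_poly (map fls_const (b # bs))) (\<lambda>m. fls_const (x m)) =
        shift_act (root_poly (map fls_const bs)) (shift_act [:- fls_const b, 1:] (\<lambda>m. fls_const (x m)))"
      unfolding list.map root_poly_simps mult.commute[of "[:- fls_const b, 1:]"] shift_act_mult ..
    also have "shift_act [:- fls_const b, 1:] (\<lambda>m. fls_const (x m)) = (\<lambda>m. fls_const (shift_act [:- b, 1:] x m))"
      by (rule ext) (simp add: shift_act_linear fls_minus_const fls_const_mult_const)
    finally show ?case
      by (simp only: Cons.IH root_poly_simps mult.commute[of "[:- b, 1:]"] shift_act_mult)
  qed (simp add: root_poly_simps shift_act_1)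
  \<comment> \<open>Multiplying a sequence by \<open>y powi m\<close> moves each characteristic root
    \<open>a\<close> to \<open>y * fls_const a\<close>.\<close>
  have act_A: "shift_act (root_poly (map (\<lambda>a. y * fls_const a) as)) (\<lambda>m. y powi m * fls_const (x m)) m =
      y powi (m + int (length as)) * fls_const (shift_act (root_poly as) x m)" for x m and as :: "complex list"
  proof (induction as arbitrary: m)
    case (Cons a as)
    let ?p = "shift_act (root_poly (map (\<lambda>a. y * fls_const a) as)) (\<lambda>m. y powi m * fls_const (x m))"
    let ?r = "shift_act (root_poly as) x"
    have "shift_act (root_poly (map (\<lambda>a. y * fls_const a) (a # as))) (\<lambda>m. y powi m * fls_const (x m)) m =
        ?p (m + 1) - y * fls_const a * ?p m"
      by (simp only: list.map root_poly_simps shift_act_mult shift_act_linear)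
    also have "\<dots> = y powi (m + 1 + int (length as)) * fls_const (?r (m + 1)) -
        y * fls_const a * (y powi (m + int (length as)) * fls_const (?r m))"
      by (simp only: Cons.IH)
    also have "\<dots> = y powi (m + 1 + int (length as)) * (fls_const (?r (m + 1)) - fls_const a * fls_const (?r m))"
      using y(2) by (simp add: power_int_add algebra_simps)
    also have "\<dots> = y powi (m + int (length (a # as))) * fls_const (?r (m + 1) - a * ?r m)"
      by (simp add: fls_minus_const fls_const_mult_const add_ac)
    finally show ?case by (simp only: root_poly_simps shift_act_mult shift_act_linear)
  qed (simp add: root_poly_simps shift_act_1)
  show ?thesis
  proof (rule that[of F])
    show "coeff F n \<in> R" for n using \<open>F \<in> polys\<close> by (simp add: polys_def)
    have "root_poly (replicate s0 0) = monom (1 :: complex fls) s0"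
      by (induction s0) (simp_all add: root_poly_simps monom_Suc monom_0 one_pCons)
    then have "monom 1 s0 dvd F"
      unfolding F_def A_def by (simp add: root_poly_append)
    then show "coeff F n = 0" if "n < s0" for n
      using that by (simp add: monom_1_dvd_iff')
    show "shift_act F (\<lambda>m. fls_const (x m)) m = fls_const (x m)"
      if "annihilates bs x" for x m
    proof -
      have "shift_act B (\<lambda>m. fls_const (x m)) = (\<lambda>_. 0)"
        unfolding B_def using that by (simp add: fun_eq_iff act_B)
      then have 0: "shift_act (U * B) (\<lambda>m. fls_const (x m)) = (\<lambda>_. 0)"
        by (rule shift_act_dvd) simp
      have "fls_const (x m) = shift_act (F + U * B) (\<lambda>m. fls_const (x m)) m"
        by (simp add: F1 shift_act_1)
      then show ?thesis by (simp add: shift_act_add 0)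
    qed
    show "(\<Sum>s\<le>degree F. coeff F s * (y ^ s * fls_const (x (m + int s)))) = 0"
      if x: "annihilates as x" for x m
    proof -
      have "shift_act (root_poly (map (\<lambda>a. y * fls_const a) as)) (\<lambda>m. y powi m * fls_const (x m)) = (\<lambda>_. 0)"
        by (rule ext) (simp add: act_A x)
      then have "shift_act F (\<lambda>m. y powi m * fls_const (x m)) = (\<lambda>_. 0)"
        by (rule shift_act_dvd) (simp add: F_def A_def root_poly_append)
      then have "shift_act F (\<lambda>m. y powi m * fls_const (x m)) m = 0" by simp
      moreover have "shift_act F (\<lambda>m. y powi m * fls_const (x m)) m =
          y powi m * (\<Sum>s\<le>degree F. coeff F s * (y ^ s * fls_const (x (m + int s))))"
        using y(2) by (simp add: shift_act_def sum_distrib_left power_int_add power_int_of_nat algebra_simps)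
      ultimately show ?thesis using y(2) by simp
    qed
  qed
qed

text \<open>The combination of the inner derivations ad(\<open>H p\<close>) with coefficients
  \<open>c p\<close>, followed by \<open>\<xi>\<close>. It obeys the Leibniz rule along
  \<open>\<xi>\<close>, so its values on generators determine it on the subalgebra they
  generate.\<close>

definition ad_sum ::
    "('a::complex_algebra_1 \<Rightarrow> complex^'n^'n) \<Rightarrow> 'p set \<Rightarrow> ('p \<Rightarrow> complex fls) \<Rightarrow> ('p \<Rightarrow> 'a) \<Rightarrow> 'a \<Rightarrow>
      (complex fls)^'n^'n"
  where "ad_sum \<xi> P c H a = (\<chi> k l. \<Sum>p\<in>P. c p * fls_const (\<xi> (H p * a - a * H p) $ k $ l))"

definition const_matrix :: "complex^'n^'m \<Rightarrow> (complex fls)^'n^'m"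
  where "const_matrix A = (\<chi> k l. fls_const (A $ k $ l))"

lemma const_matrix_nth: "const_matrix A $ k $ l = fls_const (A $ k $ l)"
  by (simp add: const_matrix_def)

lemma fls_const_sum: "fls_const (sum f S) = (\<Sum>i\<in>S. fls_const (f i :: complex))"
  by (induction S rule: infinite_finite_induct) (simp_all flip: fls_plus_const)

lemma const_matrix_mult: "const_matrix (A ** B) = const_matrix A ** const_matrix B"
  by (simp add: vec_eq_iff const_matrix_nth matrix_matrix_mult_def fls_const_sum fls_const_mult_const)

context
  fixes \<xi> :: "'a::complex_algebra_1 \<Rightarrow> complex^'n^'n"
  assumes \<xi>: "matrix_representation \<xi>"
begin

lemmas \<xi>_simps = matrix_representation_simps[OF \<xi>]

lemma ad_sum_nth: "ad_sum \<xi> P c H a $ k $ l = (\<Sum>p\<in>P. c p * fls_const (\<xi> (H p * a - a * H p) $ k $ l))"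
  by (simp add: ad_sum_def)

lemma ad_sum_one: "ad_sum \<xi> P c H 1 = 0"
  by (simp add: vec_eq_iff ad_sum_nth \<xi>_simps)

lemma ad_sum_zero: "ad_sum \<xi> P c H 0 = 0"
  by (simp add: vec_eq_iff ad_sum_nth \<xi>_simps)

lemma ad_sum_add: "ad_sum \<xi> P c H (a + b) = ad_sum \<xi> P c H a + ad_sum \<xi> P c H b"
proof -
  have "H p * (a + b) - (a + b) * H p = (H p * a - a * H p) + (H p * b - b * H p)" for p
    by (simp add: algebra_simps)
  then have "fls_const (\<xi> (H p * (a + b) - (a + b) * H p) $ k $ l) =
      fls_const (\<xi> (H p * a - a * H p) $ k $ l) + fls_const (\<xi> (H p * b - b * H p) $ k $ l)" for p k l
    by (simp only: \<xi>_simps(2) vector_add_component fls_plus_const)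
  then show ?thesis
    by (simp only: vec_eq_iff ad_sum_nth vector_add_component distrib_left sum.distrib) simp
qed

lemma ad_sum_scale: "ad_sum \<xi> P c H (z *\<^sub>C a) $ k $ l = fls_const z * ad_sum \<xi> P c H a $ k $ l"
proof -
  have "H p * z *\<^sub>C a - z *\<^sub>C a * H p = z *\<^sub>C (H p * a - a * H p)" for p
    using scaleC_add_right[of z "H p * a - a * H p" "a * H p"]
    by (simp add: mult_scaleC_left mult_scaleC_right algebra_simps)
  then have "fls_const (\<xi> (H p * z *\<^sub>C a - z *\<^sub>C a * H p) $ k $ l) =
      fls_const z * fls_const (\<xi> (H p * a - a * H p) $ k $ l)" for p
    by (simp only: \<xi>_simps(4) fls_const_mult_const)
  then show ?thesis
    by (simp only: ad_sum_nth sum_distrib_left mult.left_commute[of "c _"])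
qed

lemma ad_sum_mult:
  "ad_sum \<xi> P c H (a * b) = ad_sum \<xi> P c H a ** const_matrix (\<xi> b) + const_matrix (\<xi> a) ** ad_sum \<xi> P c H b"
proof -
  have "fls_const (\<xi> (H p * (a * b) - a * b * H p) $ k $ l) =
      (\<Sum>e\<in>UNIV. fls_const (\<xi> (H p * a - a * H p) $ k $ e) * fls_const (\<xi> b $ e $ l)) +
      (\<Sum>e\<in>UNIV. fls_const (\<xi> a $ k $ e) * fls_const (\<xi> (H p * b - b * H p) $ e $ l))" for p k l
  proof -
    have "H p * (a * b) - a * b * H p = (H p * a - a * H p) * b + a * (H p * b - b * H p)"
      by (simp add: algebra_simps)
    then have "\<xi> (H p * (a * b) - a * b * H p) = \<xi> (H p * a - a * H p) ** \<xi> b + \<xi> a ** \<xi> (H p * b - b * H p)"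
      by (simp only: \<xi>_simps(2,3))
    then show ?thesis
      by (simp add: matrix_matrix_mult_def fls_const_sum fls_const_mult_const flip: fls_plus_const)
  qed
  then have "ad_sum \<xi> P c H (a * b) $ k $ l =
      (\<Sum>p\<in>P. \<Sum>e\<in>UNIV. c p * fls_const (\<xi> (H p * a - a * H p) $ k $ e) * fls_const (\<xi> b $ e $ l)) +
      (\<Sum>p\<in>P. \<Sum>e\<in>UNIV. fls_const (\<xi> a $ k $ e) * (c p * fls_const (\<xi> (H p * b - b * H p) $ e $ l)))" for k l
    by (simp add: ad_sum_nth distrib_left sum.distrib sum_distrib_left mult_ac)
  also have "\<dots> k l = (\<Sum>e\<in>UNIV. ad_sum \<xi> P c H a $ k $ e * fls_const (\<xi> b $ e $ l)) +
      (\<Sum>e\<in>UNIV. fls_const (\<xi> a $ k $ e) * ad_sum \<xi> P c H b $ e $ l)" for k l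
    unfolding ad_sum_nth sum_distrib_left sum_distrib_right
    by (rule arg_cong2[where f = "(+)"]; rule sum.swap)
  finally show ?thesis
    by (simp add: vec_eq_iff matrix_matrix_mult_def const_matrix_nth)
qed

end

section \<open>The commutator equation\<close>

context drinfeld_algebra
begin

abbreviation current :: "('u \<Rightarrow> complex^'k^'k) \<Rightarrow> pm \<Rightarrow> 'i \<Rightarrow> 'k \<Rightarrow> 'k \<Rightarrow> int \<Rightarrow> complex"
  where "current \<xi> \<sigma> j k l \<equiv> (\<lambda>m. \<xi> (D (GX \<sigma> j m)) $ k $ l)"

text \<open>Up to the nonzero scalar \<open>c\<close>, the commutator with \<open>h j 1\<close>
  shifts the current of node \<open>j\<close> by one index. It acts on the finite dimensional space
  of matrices, and a polynomial annihilating this operator is a recurrence for the current.\<close>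

lemma current_roots:
  fixes \<xi> :: "'u \<Rightarrow> complex^'k^'k"
  assumes datum: "simple_cartan_datum C d" and h: "cartan_currents q D h"
    and \<xi>: "matrix_representation \<xi>"
  obtains as where "\<And>k l. annihilates as (current \<xi> \<sigma> j k l)" "0 \<notin> set as"
    "\<And>a. a \<in> set as \<Longrightarrow> \<exists>k l. geometric_root (current \<xi> \<sigma> j k l) a"
proof -
  note \<xi>_simps = matrix_representation_simps[OF \<xi>]
  define c where "c = of_int (pm_sign \<sigma>) * h_scalar q (bform j j) 1"
  have "d j * C j j \<noteq> 0" using simple_cartan_datum_bounds(1,2)[OF datum, of j] by simp
  then have "h_scalar q (bform j j) 1 \<noteq> 0" by (rule h_scalar_1_nonzero[OF q])
  then have c0: "c \<noteq> 0" by (cases \<sigma>) (simp_all add: c_def)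
  define H where "H = \<xi> (h j 1)"
  define A where "A X = (\<chi> k l. inverse c * (H ** X - X ** H) $ k $ l)" for X
  have A_add: "A (X + Y) = A X + A Y" for X Y
    by (simp add: A_def vec_eq_iff matrix_matrix_mult_def distrib_left distrib_right sum.distrib)
      (simp add: algebra_simps)
  have A_scale: "A (\<chi> k l. z * X $ k $ l) = (\<chi> k l. z * A X $ k $ l)" for z X
    by (simp add: A_def vec_eq_iff matrix_matrix_mult_def sum_distrib_left algebra_simps)
  have A_x: "A (\<xi> (D (GX \<sigma> j m))) = \<xi> (D (GX \<sigma> j (m + 1)))" for m
  proof -
    have "H ** \<xi> (D (GX \<sigma> j m)) - \<xi> (D (GX \<sigma> j m)) ** H = \<xi> (c *\<^sub>C D (GX \<sigma> j (m + 1)))"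
      using arg_cong[OF h_x_commutator[OF h, of 1 j \<sigma> j m], of \<xi>] by (simp add: \<xi>_simps(3,6) H_def c_def)
    then show ?thesis using c0 by (simp add: A_def vec_eq_iff \<xi>_simps(4))
  qed
  then have A_pow: "(A ^^ k) (\<xi> (D (GX \<sigma> j m))) = \<xi> (D (GX \<sigma> j (m + int k)))" for k m
    by (induction k) (simp_all add: add_ac)
  obtain p :: "complex poly" where p: "p \<noteq> 0" "\<And>x a b. (\<Sum>k\<le>degree p. coeff p k * (A ^^ k) x $ a $ b) = 0"
    using linear_operator_annihilator[OF A_add A_scale] by blast
  \<comment> \<open>All entries are treated as one family, so that a single list of roots serves the
    whole matrix.\<close>
  define x where "x = (\<lambda>(k, l) m. \<xi> (D (GX \<sigma> j m)) $ k $ l)"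
  have ann: "shift_act p (x e) = (\<lambda>_. 0)" for e
    by (rule ext) (use p(2)[of "\<xi> (D (GX \<sigma> j _))" "fst e" "snd e"] in
      \<open>simp add: shift_act_def x_def case_prod_unfold A_pow\<close>)
  obtain as where as: "\<And>e. annihilates as (x e)" "0 \<notin> set as"
    "\<And>a. a \<in> set as \<Longrightarrow>
      \<exists>e. geometric_root (x e) a"
    by (rule minimal_annihilator[OF p(1) ann], rule that)
  show ?thesis
  proof (rule that[of as])
    show "annihilates as (current \<xi> \<sigma> j k l)" for k l
      using as(1)[of "(k, l)"] by (simp add: x_def)
    fix a assume "a \<in> set as"
    then obtain e r where "shift_act r (x e) \<noteq> (\<lambda>_. 0)" "\<forall>m. shift_act r (x e) (m + 1) = a * shift_act r (x e) m"
      using as(3) by blast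
    then show "\<exists>k l. geometric_root (current \<xi> \<sigma> j k l) a"
      by (intro exI[of _ "fst e"] exI[of _ "snd e"] exI[of _ r]) (simp add: x_def case_prod_unfold)
  qed (rule as(2))
qed

lemma x_plus_pole:
  fixes \<xi> :: "'u \<Rightarrow> complex^'k^'k"
  assumes as: "\<And>k l. annihilates as (current \<xi> Plus j k l)" and a: "a \<noteq> 0"
    and pole: "\<exists>k l. geometric_root (current \<xi> Plus j k l) a"
  shows "pole_of_expansion (x_plus_nonnegative_part D \<xi> j) (inverse a)"
proof -
  have eq: "entry_series (x_plus_nonnegative_part D \<xi> j) k l = gen_series (current \<xi> Plus j k l)" for k l
    by (simp add: entry_series_def x_plus_nonnegative_part_def gen_series_def)
  obtain k l r where "shift_act r (current \<xi> Plus j k l) \<noteq> (\<lambda>_. 0)"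
    "\<And>m. shift_act r (current \<xi> Plus j k l) (m + 1) =
         a * shift_act r (current \<xi> Plus j k l) m"
    using pole by blast
  from gen_series_pole[OF a this] have "entry_series (x_plus_nonnegative_part D \<xi> j) k l \<notin> regular_at fls_X (inverse a)"
    by (simp add: eq)
  with gen_series_rational[OF as] show ?thesis
    by (intro pole_of_singular_entry) (simp_all add: eq)
qed

text \<open>The series without its constant term differs from \<open>gen_series\<close> by a
  constant, which changes neither rationality nor poles.\<close>

lemma x_minus_pole:
  fixes \<xi> :: "'u \<Rightarrow> complex^'k^'k"
  assumes as: "\<And>k l. annihilates as (current \<xi> Minus j k l)" and a: "a \<noteq> 0"
    and pole: "\<exists>k l. geometric_root (current \<xi> Minus j k l) a"
  shows "pole_of_expansion (x_minus_positive_part D \<xi> j) (inverse a)"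
proof -
  let ?x = "current \<xi> Minus j"
  have eq: "entry_series (x_minus_positive_part D \<xi> j) k l = gen_series (?x k l) - fls_const (?x k l 0)" for k l
    by (rule fls_eqI) (auto simp: entry_series_def x_minus_positive_part_def gen_series_nth not_less)
  obtain k l r where "shift_act r (?x k l) \<noteq> (\<lambda>_. 0)"
    "\<And>m. shift_act r (?x k l) (m + 1) = a * shift_act r (?x k l) m"
    using pole by blast
  from gen_series_pole[OF a this] have sing: "gen_series (?x k l) \<notin> regular_at fls_X (inverse a)" .
  show ?thesis
  proof (rule pole_of_singular_entry)
    show "entry_series (x_minus_positive_part D \<xi> j) k l \<in> regular_at fls_X 0" for k l
      unfolding eq using gen_series_rational[OF as] regular_at_const
      by (rule subring_of_field.diff_mem[OF regular_at_subring])
    show "entry_series (x_minus_positive_part D \<xi> j) k l \<notin> regular_at fls_X (inverse a)"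
    proof
      assume "entry_series (x_minus_positive_part D \<xi> j) k l \<in> regular_at fls_X (inverse a)"
      then have "entry_series (x_minus_positive_part D \<xi> j) k l + fls_const (?x k l 0) \<in> regular_at fls_X (inverse a)"
        using regular_at_const by (rule subring_of_field.add_mem[OF regular_at_subring])
      then show False using sing by (simp add: eq)
    qed
  qed
qed

end

lemma sum_fun_less:
  fixes \<beta> \<gamma> :: "'i::finite \<Rightarrow> nat"
  assumes "\<gamma> \<le> \<beta>" "\<gamma> \<noteq> \<beta>"
  shows "(\<Sum>i\<in>UNIV. \<gamma> i) < (\<Sum>i\<in>UNIV. \<beta> i)"
proof -
  obtain i where "\<gamma> i \<noteq> \<beta> i" using assms(2) by auto
  then have "\<gamma> i < \<beta> i" using assms(1) by (simp add: le_fun_def le_neq_implies_less)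
  then show ?thesis using assms(1) by (intro sum_strict_mono_ex1) (auto simp: le_fun_def)
qed

lemma cspan_mult_closed:
  assumes T: "\<And>x y. x \<in> T \<Longrightarrow> y \<in> T \<Longrightarrow> x * y \<in> T" and a: "a \<in> cspan T" and b: "b \<in> cspan T"
  shows "a * b \<in> cspan T"
  using a
proof (induction rule: cvs.span_induct_alt)
  case base
  show ?case by (simp add: cvs.span_zero)
next
  case (step c x a)
  have "x * b \<in> cspan T"
    using b
  proof (induction rule: cvs.span_induct_alt)
    case base
    show ?case by (simp add: cvs.span_zero)
  next
    case (step c y b)
    then show ?case using T[OF \<open>x \<in> T\<close>]
      by (simp add: distrib_left mult_scaleC_right cvs.span_add cvs.span_scale cvs.span_base)
  qed
  then show ?case using step
    by (simp add: distrib_right mult_scaleC_left cvs.span_add cvs.span_scale)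
qed

definition positive_word :: "'i drinfeld_gen word \<Rightarrow> bool"
  where "positive_word w \<longleftrightarrow> (\<forall>g\<in>set (letters w). \<exists>i m. g = GX Plus i m)"

lemma U_plus_span:
  fixes D :: "'i drinfeld_gen \<Rightarrow> 'u::complex_algebra_1"
  assumes "b \<in> U_plus D"
  shows "b \<in> cspan {word_eval D w |w. positive_word w}"
  using assms unfolding U_plus_def
proof induction
  case (gen x)
  then obtain i m where "x = word_eval D (Word [GX Plus i m])" by (auto simp: word_eval_def)
  moreover have "positive_word (Word [GX Plus i m])" by (simp add: positive_word_def)
  ultimately show ?case by (blast intro: cvs.span_base)
next
  case one
  have "1 = word_eval D 0" "positive_word (0 :: 'i drinfeld_gen word)"
    by (simp_all add: word_eval_zero) (simp add: positive_word_def zero_word_def)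
  then show ?case by (blast intro: cvs.span_base)
next
  case (mult x y)
  show ?case
  proof (rule cspan_mult_closed[OF _ mult.IH])
    fix x y assume "x \<in> {word_eval D w |w. positive_word w}" "y \<in> {word_eval D w |w. positive_word w}"
    then obtain v w where "x = word_eval D v" "positive_word v" "y = word_eval D w" "positive_word w" by blast
    then have "x * y = word_eval D (v + w)" "positive_word (v + w)"
      by (simp_all add: word_eval_add) (auto simp: positive_word_def Defs.plus_word_def)
    then show "x * y \<in> {word_eval D w |w. positive_word w}" by blast
  qed
qed (auto intro: cvs.span_add cvs.span_scale)

context drinfeld_algebra
begin

lemma ad_sum_U_minus:
  fixes \<xi> :: "'u \<Rightarrow> complex^'k^'k"
  assumes \<xi>: "matrix_representation \<xi>"
    and ann: "\<And>j m. ad_sum \<xi> P c H (D (GX Minus j m)) = 0" and a: "a \<in> U_minus D"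
  shows "ad_sum \<xi> P c H a = 0"
  using a unfolding U_minus_def
proof induction
  case (gen x)
  then obtain j m where x: "x = D (GX Minus j m)" by blast
  show ?case unfolding x by (rule ann)
next
  case one
  show ?case by (rule ad_sum_one[OF \<xi>])
next
  case (add x z)
  then show ?case by (simp add: ad_sum_add[OF \<xi>])
next
  case (mult x z)
  then show ?case by (simp add: ad_sum_mult[OF \<xi>])
next
  case (scale x z)
  then show ?case by (simp add: vec_eq_iff ad_sum_scale[OF \<xi>])
qed

lemma ad_sum_positive_word:
  fixes \<xi> :: "'u \<Rightarrow> complex^'k^'k"
  assumes \<xi>: "matrix_representation \<xi>"
    and gen: "\<And>j m. ad_sum \<xi> P c H (D (GX Plus j m)) = const_matrix (\<xi> (D (GX Plus j m)))"
    and gs: "positive_word (Word gs)"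
  shows "ad_sum \<xi> P c H (word_eval D (Word gs)) $ k $ l =
    of_nat (length gs) * const_matrix (\<xi> (word_eval D (Word gs))) $ k $ l"
  using gs
proof (induction gs arbitrary: k l)
  case Nil
  show ?case by (simp add: word_eval_def ad_sum_one[OF \<xi>])
next
  case (Cons g gs)
  then obtain i m where g: "g = GX Plus i m" and gs: "positive_word (Word gs)"
    by (auto simp: positive_word_def)
  let ?w = "word_eval D (Word gs)"
  have w: "word_eval D (Word (g # gs)) = D (GX Plus i m) * ?w" by (simp add: word_eval_def g)
  have "(const_matrix (\<xi> (D (GX Plus i m))) ** ad_sum \<xi> P c H ?w) $ k $ l =
      of_nat (length gs) * (const_matrix (\<xi> (D (GX Plus i m))) ** const_matrix (\<xi> ?w)) $ k $ l"
    by (simp add: matrix_matrix_mult_def Cons.IH[OF gs] sum_distrib_left mult.left_commute)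
  then show ?case
    unfolding w ad_sum_mult[OF \<xi>] gen matrix_representation_simps(3)[OF \<xi>] const_matrix_mult by (simp add: distrib_right)
qed

text \<open>
  The height of the weight counts the generators in a word, whence the eigenvalue. The words of other
  weights in an expansion of \<open>b\<close> are removed by the weight projection.
\<close>

lemma ad_sum_U_plus:
  fixes \<xi> :: "'u \<Rightarrow> complex^'k^'k" and \<beta> :: "'i \<Rightarrow> nat"
  assumes \<xi>: "matrix_representation \<xi>"
    and gen: "\<And>j m. ad_sum \<xi> P c H (D (GX Plus j m)) = const_matrix (\<xi> (D (GX Plus j m)))"
    and b: "b \<in> U_plus D" "b \<in> weight_space D (\<lambda>i. int (\<beta> i))"
  shows "ad_sum \<xi> P c H b $ k $ l = of_nat (\<Sum>i\<in>UNIV. \<beta> i) * const_matrix (\<xi> b) $ k $ l"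
proof -
  interpret wg: word_grading D "drinfeld_relators C d q free_var" word_weight
    by (rule word_weight_grading[OF presented])
  define \<kappa> where "\<kappa> = (\<lambda>i. int (\<beta> i))"
  have "ad_sum \<xi> P c H (wg.proj \<kappa> b) $ k $ l = of_nat (\<Sum>i\<in>UNIV. \<beta> i) * const_matrix (\<xi> (wg.proj \<kappa> b)) $ k $ l"
    using U_plus_span[OF b(1)]
  proof (induction rule: cvs.span_induct_alt)
    case base
    show ?case
      by (simp add: wg.proj_zero ad_sum_zero[OF \<xi>] const_matrix_nth matrix_representation_simps(5)[OF \<xi>])
  next
    case (step z x b)
    then obtain w where x: "x = word_eval D w" and w: "positive_word w" by blast
    have len: "length (letters w) = (\<Sum>i\<in>UNIV. \<beta> i)" if "word_weight w = \<kappa>"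
    proof -
      have "(\<Sum>i\<in>UNIV. \<Sum>g\<leftarrow>gs. gen_weight g i) = int (length gs)" if "\<forall>g\<in>set gs. \<exists>i m. g = GX Plus i m" for gs :: "'i drinfeld_gen list"
        using that by (induction gs) (auto simp: sum.distrib simple_root_def)
      from this[of "letters w"] w have "(\<Sum>i\<in>UNIV. word_weight w i) = int (length (letters w))"
        by (simp add: word_weight_def positive_word_def)
      then show ?thesis unfolding that \<kappa>_def by (simp flip: of_nat_sum)
    qed
    have word: "ad_sum \<xi> P c H (wg.proj \<kappa> (z *\<^sub>C x)) $ k $ l =
        of_nat (\<Sum>i\<in>UNIV. \<beta> i) * const_matrix (\<xi> (wg.proj \<kappa> (z *\<^sub>C x))) $ k $ l"
    proof (cases "word_weight w = \<kappa>")
      case True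
      have "ad_sum \<xi> P c H (word_eval D w) $ k $ l = of_nat (\<Sum>i\<in>UNIV. \<beta> i) * const_matrix (\<xi> (word_eval D w)) $ k $ l"
        using ad_sum_positive_word[OF \<xi> gen, of "letters w"] w len[OF True] by simp
      then show ?thesis using True
        by (simp add: x wg.proj_scale_word ad_sum_scale[OF \<xi>] const_matrix_nth matrix_representation_simps(4)[OF \<xi>] mult.left_commute
            flip: fls_const_mult_const)
    next
      case False
      then show ?thesis
        by (simp add: x wg.proj_scale_word ad_sum_zero[OF \<xi>] const_matrix_nth matrix_representation_simps(5)[OF \<xi>])
    qed
    show ?case
      unfolding wg.proj_add ad_sum_add[OF \<xi>] vector_add_component word step.IH
      by (simp add: const_matrix_nth matrix_representation_simps(2)[OF \<xi>] distrib_left flip: fls_plus_const)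
  qed
  moreover have "wg.proj \<kappa> b = b"
    using b(2) wg.proj_on_graded_part[of b \<kappa> \<kappa>] unfolding weight_space_eq[OF presented] \<kappa>_def by simp
  ultimately show ?thesis by simp
qed

end

locale evaluation = drinfeld_algebra C d q D + representation_pair \<phi> \<psi>
  for C :: "'i::finite \<Rightarrow> 'i \<Rightarrow> int" and d :: "'i \<Rightarrow> int" and q :: complex
    and D :: "'i drinfeld_gen \<Rightarrow> 'u::complex_algebra_1"
    and \<phi> :: "'u \<Rightarrow> complex^'n^'n" and \<psi> :: "'u \<Rightarrow> complex^'m^'m" +
  fixes h :: "'i \<Rightarrow> int \<Rightarrow> 'u"
  assumes datum: "simple_cartan_datum C d" and currents: "cartan_currents q D h"
begin

text \<open>The image under \<open>\<phi> \<otimes> \<psi>\<close> of y^s \<open>h i s\<close> in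
  the first factor plus \<open>h i s\<close> in the second.\<close>

definition H_mat :: "complex fls \<Rightarrow> 'i \<Rightarrow> nat \<Rightarrow> (complex fls)^('n \<times> 'm)^('n \<times> 'm)"
  where "H_mat y i s = (\<chi> k l. y ^ s * fls_const (kronecker (\<phi> (h i (int s))) (\<psi> 1) $ k $ l) +
    fls_const (kronecker (\<phi> 1) (\<psi> (h i (int s))) $ k $ l))"

lemma H_mat_commutator_pure:
  "(H_mat y i s ** const_matrix (\<rho> (a \<otimes>\<^sub>C b)) - const_matrix (\<rho> (a \<otimes>\<^sub>C b)) ** H_mat y i s) $ k $ l =
    y ^ s * fls_const (\<phi> (h i (int s) * a - a * h i (int s)) $ fst k $ fst l) * fls_const (\<psi> b $ snd k $ snd l) +
    fls_const (\<phi> a $ fst k $ fst l) * fls_const (\<psi> (h i (int s) * b - b * h i (int s)) $ snd k $ snd l)"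
proof -
  let ?h = "h i (int s)"
  have l: "(H_mat y i s ** const_matrix X) $ k $ l =
      y ^ s * fls_const ((kronecker (\<phi> ?h) (\<psi> 1) ** X) $ k $ l) + fls_const ((kronecker (\<phi> 1) (\<psi> ?h) ** X) $ k $ l)" for X
    by (simp add: H_mat_def matrix_matrix_mult_def const_matrix_nth fls_const_sum distrib_right sum.distrib
        sum_distrib_left mult.assoc fls_const_mult_const)
  have r: "(const_matrix X ** H_mat y i s) $ k $ l =
      y ^ s * fls_const ((X ** kronecker (\<phi> ?h) (\<psi> 1)) $ k $ l) + fls_const ((X ** kronecker (\<phi> 1) (\<psi> ?h)) $ k $ l)" for X
    by (simp add: H_mat_def matrix_matrix_mult_def const_matrix_nth fls_const_sum distrib_left sum.distrib
        sum_distrib_left mult.left_commute[of _ "y ^ s"] fls_const_mult_const)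
  have "\<phi> (?h * a - a * ?h) = \<phi> (?h * a) - \<phi> (a * ?h)" "\<psi> (?h * b - b * ?h) = \<psi> (?h * b) - \<psi> (b * ?h)"
    by (simp_all only: matrix_representation_simps(6)[OF \<phi>] matrix_representation_simps(6)[OF \<psi>])
  then show ?thesis
    by (simp add: l r \<rho>_pure kronecker_mult kronecker_nth flip: \<phi>_simps(3) \<psi>_simps(3) fls_minus_const fls_const_mult_const)
      (simp add: algebra_simps)
qed

definition h_at :: "'i \<times> nat \<Rightarrow> 'u"
  where "h_at p = h (fst p) (int (snd p))"

definition commutator_sum :: "complex fls \<Rightarrow> ('i \<times> nat) set \<Rightarrow> ('i \<times> nat \<Rightarrow> complex fls) \<Rightarrow>
    (complex fls)^('n \<times> 'm)^('n \<times> 'm) \<Rightarrow> (complex fls)^('n \<times> 'm)^('n \<times> 'm)"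
  where "commutator_sum y P t X = (\<chi> k l. \<Sum>p\<in>P. t p *
    (H_mat y (fst p) (snd p) ** X - X ** H_mat y (fst p) (snd p)) $ k $ l)"

lemma commutator_sum_add:
  "commutator_sum y P t (X + Y) $ k $ l = commutator_sum y P t X $ k $ l + commutator_sum y P t Y $ k $ l"
  by (simp add: commutator_sum_def matrix_matrix_mult_def distrib_left distrib_right sum.distrib
      right_diff_distrib sum_subtractf)

text \<open>On a pure tensor the sum of commutators splits into \<open>ad_sum\<close> of the first
  factor, with coefficients \<open>t p * y ^ snd p\<close>, and \<open>ad_sum\<close> of the second,
  with coefficients \<open>t p\<close>. The former is zero, the latter gives the height.\<close>

lemma commutator_sum_bigraded:
  assumes minus: "\<And>a. a \<in> U_minus D \<Longrightarrow> ad_sum \<phi> P (\<lambda>p. t p * y ^ snd p) h_at a = 0"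
    and plus: "\<And>b k l. b \<in> U_plus D \<Longrightarrow> b \<in> weight_space D (\<lambda>i. int (\<beta> i)) \<Longrightarrow>
      ad_sum \<psi> P t h_at b $ k $ l = of_nat (\<Sum>i\<in>UNIV. \<beta> i) * const_matrix (\<psi> b) $ k $ l"
    and r: "r \<in> bigraded_part (U_minus D) (U_plus D) D \<beta>"
  shows "commutator_sum y P t (const_matrix (\<rho> r)) $ k $ l =
    of_nat (\<Sum>i\<in>UNIV. \<beta> i) * const_matrix (\<rho> r) $ k $ l"
  using r unfolding bigraded_part_def tensor_subspace_def
proof (induction rule: cvs.span_induct_alt)
  case base
  show ?case by (simp add: commutator_sum_def \<rho>_zero const_matrix_nth matrix_matrix_mult_def)
next
  case (step c x z)
  then obtain a b where x: "x = a \<otimes>\<^sub>C b" and a: "a \<in> U_minus D"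
    and b: "b \<in> U_plus D" "b \<in> weight_space D (\<lambda>i. int (\<beta> i))" by blast
  \<comment> \<open>The scalar is absorbed into the second factor, so each summand of the span is
    again a pure tensor.\<close>
  have cx: "c *\<^sub>C x = a \<otimes>\<^sub>C (c *\<^sub>C b)" by (simp add: x pure_tensor_scaleC pure_tensor_scale)
  have b': "ad_sum \<psi> P t h_at (c *\<^sub>C b) $ k $ l = of_nat (\<Sum>i\<in>UNIV. \<beta> i) * const_matrix (\<psi> (c *\<^sub>C b)) $ k $ l" for k l
    by (simp add: ad_sum_scale[OF \<psi>] plus[OF b] const_matrix_nth \<psi>_simps(4) mult.left_commute flip: fls_const_mult_const)
  let ?B = "c *\<^sub>C b"
  have "commutator_sum y P t (const_matrix (\<rho> (a \<otimes>\<^sub>C ?B))) $ k $ l =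
      ad_sum \<phi> P (\<lambda>p. t p * y ^ snd p) h_at a $ fst k $ fst l * fls_const (\<psi> ?B $ snd k $ snd l) +
      fls_const (\<phi> a $ fst k $ fst l) * ad_sum \<psi> P t h_at ?B $ snd k $ snd l"
    unfolding commutator_sum_def vec_lambda_beta H_mat_commutator_pure ad_sum_nth[OF \<phi>] ad_sum_nth[OF \<psi>]
    by (simp add: h_at_def case_prod_unfold sum_distrib_left sum_distrib_right distrib_left sum.distrib mult_ac)
  also have "\<dots> = of_nat (\<Sum>i\<in>UNIV. \<beta> i) * const_matrix (\<rho> (a \<otimes>\<^sub>C ?B)) $ k $ l"
    by (simp add: minus[OF a] b' const_matrix_nth \<rho>_pure kronecker_nth mult.left_commute flip: fls_const_mult_const)
  finally have 1: "commutator_sum y P t (const_matrix (\<rho> (c *\<^sub>C x))) $ k $ l = of_nat (\<Sum>i\<in>UNIV. \<beta> i) * const_matrix (\<rho> (c *\<^sub>C x)) $ k $ l"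
    by (simp only: cx)
  have cm_add: "const_matrix (\<rho> (c *\<^sub>C x + z)) = const_matrix (\<rho> (c *\<^sub>C x)) + const_matrix (\<rho> z)"
    by (simp add: vec_eq_iff const_matrix_nth \<rho>_add flip: fls_plus_const)
  show ?case unfolding cm_add commutator_sum_add 1 step.IH by (simp add: distrib_left)
qed

text \<open>
  The coefficients of \<open>M\<close> lie in a finite dimensional space, so that \<open>M\<close> is a finite combination of
  constant matrices.
\<close>

lemma commutator_sum_component:
  assumes eigen: "\<And>r k l. r \<in> bigraded_part (U_minus D) (U_plus D) D \<beta> \<Longrightarrow>
      commutator_sum y P t (const_matrix (\<rho> r)) $ k $ l = z * const_matrix (\<rho> r) $ k $ l"
    and M: "\<And>n. \<exists>r\<in>bigraded_part (U_minus D) (U_plus D) D \<beta>. \<forall>k l. fls_nth (M $ k $ l) n = \<rho> r $ k $ l"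
  shows "commutator_sum y P t M $ k $ l = z * M $ k $ l"
proof -
  let ?W = "bigraded_part (U_minus D) (U_plus D) D \<beta>"
  define W where "W = {v :: complex^(('n \<times> 'm) \<times> ('n \<times> 'm)). \<exists>r\<in>?W. \<forall>k l. v $ (k, l) = \<rho> r $ k $ l}"
  have "vec.subspace W"
    unfolding vec.subspace_def
  proof (intro conjI ballI allI)
    show "0 \<in> W" unfolding W_def bigraded_part_def tensor_subspace_def
      by (intro CollectI bexI[of _ 0]) (simp_all add: \<rho>_zero cvs.span_zero)
  next
    fix v w assume "v \<in> W" "w \<in> W"
    then obtain r r' where "r \<in> ?W" "r' \<in> ?W" "\<forall>k l. v $ (k, l) = \<rho> r $ k $ l" "\<forall>k l. w $ (k, l) = \<rho> r' $ k $ l"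
      by (auto simp: W_def)
    then show "v + w \<in> W" unfolding W_def bigraded_part_def tensor_subspace_def
      by (intro CollectI bexI[of _ "r + r'"]) (simp_all add: \<rho>_add cvs.span_add)
  next
    fix v c assume "v \<in> W"
    then obtain r where "r \<in> ?W" "\<forall>k l. v $ (k, l) = \<rho> r $ k $ l" by (auto simp: W_def)
    then show "c *s v \<in> W" unfolding W_def bigraded_part_def tensor_subspace_def
      by (intro CollectI bexI[of _ "c *\<^sub>C r"]) (simp_all add: \<rho>_scale cvs.span_scale)
  qed
  from subspace_projection[OF this] obtain Q where Q: "\<And>f. Q f \<in> W"
    "\<And>w e. w \<in> W \<Longrightarrow> w $ e = (\<Sum>f\<in>UNIV. w $ f * Q f $ e)" by blast
  have "\<exists>r. r \<in> ?W \<and> (\<forall>k l. Q f $ (k, l) = \<rho> r $ k $ l)" for f using Q(1)[of f] by (auto simp: W_def)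
  then obtain r where r: "\<And>f. r f \<in> ?W" "\<And>f k l. Q f $ (k, l) = \<rho> (r f) $ k $ l" by metis
  \<comment> \<open>Each coefficient of \<open>M\<close> lies in \<open>W\<close> and expands in the
    vectors \<open>Q f\<close> with its own entries as coordinates; collecting the coefficients
    turns these coordinates into the entries of \<open>M\<close>.\<close>
  have M_eq: "M $ k $ l = (\<Sum>f\<in>UNIV. M $ fst f $ snd f * const_matrix (\<rho> (r f)) $ k $ l)" for k l
  proof (rule fls_eqI)
    fix n
    obtain r' where r': "r' \<in> ?W" "\<And>k l. fls_nth (M $ k $ l) n = \<rho> r' $ k $ l" using M by blast
    define v where "v = (\<chi> e. \<rho> r' $ fst e $ snd e)"
    have "v \<in> W" using r'(1) by (auto simp: W_def v_def)
    from Q(2)[OF this, of "(k, l)"]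
    show "fls_nth (M $ k $ l) n = fls_nth (\<Sum>f\<in>UNIV. M $ fst f $ snd f * const_matrix (\<rho> (r f)) $ k $ l) n"
      by (simp add: fls_nth_sum const_matrix_nth r' r(2) v_def)
  qed
  have Ml: "(X ** M) $ k $ l = (\<Sum>f\<in>UNIV. M $ fst f $ snd f * (X ** const_matrix (\<rho> (r f))) $ k $ l)" for X k l
  proof -
    have "(X ** M) $ k $ l = (\<Sum>e\<in>UNIV. \<Sum>f\<in>UNIV. M $ fst f $ snd f * (X $ k $ e * const_matrix (\<rho> (r f)) $ e $ l))"
      unfolding matrix_matrix_mult_def vec_lambda_beta
      by (subst M_eq) (simp add: sum_distrib_left mult.left_commute)
    then show ?thesis by (subst (asm) sum.swap) (simp add: matrix_matrix_mult_def sum_distrib_left)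
  qed
  have Mr: "(M ** X) $ k $ l = (\<Sum>f\<in>UNIV. M $ fst f $ snd f * (const_matrix (\<rho> (r f)) ** X) $ k $ l)" for X k l
  proof -
    have "(M ** X) $ k $ l = (\<Sum>e\<in>UNIV. \<Sum>f\<in>UNIV. M $ fst f $ snd f * (const_matrix (\<rho> (r f)) $ k $ e * X $ e $ l))"
      unfolding matrix_matrix_mult_def vec_lambda_beta
      by (subst M_eq) (simp add: sum_distrib_right mult.assoc)
    then show ?thesis by (subst (asm) sum.swap) (simp add: matrix_matrix_mult_def sum_distrib_left)
  qed
  have "commutator_sum y P t M $ k $ l = (\<Sum>p\<in>P. \<Sum>f\<in>UNIV. M $ fst f $ snd f *
      (t p * (H_mat y (fst p) (snd p) ** const_matrix (\<rho> (r f)) - const_matrix (\<rho> (r f)) ** H_mat y (fst p) (snd p)) $ k $ l))"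
    unfolding commutator_sum_def vec_lambda_beta
  proof (rule sum.cong)
    fix p
    let ?H = "H_mat y (fst p) (snd p)"
    have "(?H ** M - M ** ?H) $ k $ l = (\<Sum>f\<in>UNIV. M $ fst f $ snd f *
        (?H ** const_matrix (\<rho> (r f)) - const_matrix (\<rho> (r f)) ** ?H) $ k $ l)"
      by (simp only: vector_minus_component Ml Mr right_diff_distrib sum_subtractf)
    then show "t p * (?H ** M - M ** ?H) $ k $ l = (\<Sum>f\<in>UNIV. M $ fst f $ snd f *
        (t p * (?H ** const_matrix (\<rho> (r f)) - const_matrix (\<rho> (r f)) ** ?H) $ k $ l))"
      by (simp only: sum_distrib_left mult.left_commute)
  qed simp
  also have "\<dots> = (\<Sum>f\<in>UNIV. M $ fst f $ snd f * commutator_sum y P t (const_matrix (\<rho> (r f))) $ k $ l)"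
    by (subst sum.swap) (simp add: commutator_sum_def sum_distrib_left)
  also have "\<dots> = z * M $ k $ l"
    by (subst (2) M_eq) (simp add: eigen[OF r(1)] sum_distrib_left mult.left_commute)
  finally show ?thesis .
qed

text \<open>Take an interpolating polynomial \<open>F j\<close> for each node and weight its
  coefficients with the inverse of the matrix of scalars. The commutators at index \<open>s\<close>
  then add up, on the currents of node \<open>j\<close>, to \<open>coeff (F j) s\<close> times a
  shift by \<open>s\<close>, without interference between nodes.\<close>

lemma interpolating_combination:
  fixes R :: "complex fls set" and as bs :: "'i \<Rightarrow> complex list"
  assumes R: "subring_of_field R" and const: "\<And>c. fls_const c \<in> R" and y: "y \<in> R" "y \<noteq> 0"
    and as: "\<And>j k l. annihilates (as j) (current \<phi> Minus j k l)"
    and bs: "\<And>j k l. annihilates (bs j) (current \<psi> Plus j k l)"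
      "\<And>j. 0 \<notin> set (bs j)"
    and unit: "\<And>j a b. a \<in> set (as j) \<Longrightarrow> b \<in> set (bs j) \<Longrightarrow>
      fls_const b \<noteq> y * fls_const a \<and> inverse (fls_const b - y * fls_const a) \<in> R"
  obtains P t where "\<And>p. t p \<in> R" "\<And>p. p \<in> P \<Longrightarrow> snd p > 0"
    "\<And>j m. ad_sum \<phi> P (\<lambda>p. t p * y ^ snd p) h_at (D (GX Minus j m)) = 0"
    "\<And>j m. ad_sum \<psi> P t h_at (D (GX Plus j m)) = const_matrix (\<psi> (D (GX Plus j m)))"
proof -
  interpret subring_of_field R by (rule R)
  note bounds = simple_cartan_datum_bounds[OF datum]
  obtain s1 where s1: "\<And>s. s \<ge> s1 \<Longrightarrow> \<exists>B. \<forall>l j.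
    (\<Sum>i\<in>UNIV. B l i * (q powi (int s * bform i j) - q powi (- (int s * bform i j)))) = (if l = j then 1 else 0)"
    by (rule quantum_form_left_inverse[of q bform d]) (use q bounds in auto)
  define s0 where "s0 = max 1 s1"
  define Binv where "Binv s = (SOME B. \<forall>l j. (\<Sum>i\<in>UNIV. B l i * (q powi (int s * bform i j) - q powi (- (int s * bform i j)))) =
    (if l = j then 1 else 0))" for s
  have Binv: "(\<Sum>i\<in>UNIV. Binv s l i * (q powi (int s * bform i j) - q powi (- (int s * bform i j)))) = (if l = j then 1 else 0)"
    if "s \<ge> s0" for s l j
    using someI_ex[OF s1, of s] that unfolding Binv_def s0_def by simp
  define good where "good j G \<longleftrightarrow> (\<forall>n. coeff G n \<in> R) \<and> (\<forall>n<s0. coeff G n = 0) \<and>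
    (\<forall>x m. annihilates (bs j) x \<longrightarrow>
      shift_act G (\<lambda>m. fls_const (x m)) m = fls_const (x m)) \<and>
    (\<forall>x m. annihilates (as j) x \<longrightarrow>
      (\<Sum>s\<le>degree G. coeff G s * (y ^ s * fls_const (x (m + int s)))) = 0)" for j G
  have ex_good: "\<exists>G. good j G" for j
  proof -
    show ?thesis
    proof (rule interpolation[OF R const y bs(2)[of j], where as = "as j" and ?s0.0 = s0])
      show "fls_const b \<noteq> y * fls_const a \<and> inverse (fls_const b - y * fls_const a) \<in> R"
        if "a \<in> set (as j)" "b \<in> set (bs j)" for a b using that by (rule unit)
    next
      fix G assume "\<And>n. coeff G n \<in> R" "\<And>n. n < s0 \<Longrightarrow> coeff G n = 0"
        "\<And>x m. annihilates (bs j) x \<Longrightarrow>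
          shift_act G (\<lambda>m. fls_const (x m)) m = fls_const (x m)"
        "\<And>x m. annihilates (as j) x \<Longrightarrow>
          (\<Sum>s\<le>degree G. coeff G s * (y ^ s * fls_const (x (m + int s)))) = 0"
      then have "good j G" unfolding good_def by (intro conjI allI impI)
      then show ?thesis ..
    qed
  qed
  define F where "F j = (SOME G. good j G)" for j
  have good: "good j (F j)" for j unfolding F_def by (rule someI_ex[OF ex_good])
  have F: "coeff (F j) n \<in> R" "n < s0 \<Longrightarrow> coeff (F j) n = 0"
    "annihilates (bs j) x \<Longrightarrow>
      shift_act (F j) (\<lambda>m. fls_const (x m)) m = fls_const (x m)"
    "annihilates (as j) x \<Longrightarrow>
      (\<Sum>s\<le>degree (F j). coeff (F j) s * (y ^ s * fls_const (x (m + int s)))) = 0" for j n x m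
  proof -
    note g = good[of j, unfolded good_def]
    show "coeff (F j) n \<in> R" "n < s0 \<Longrightarrow> coeff (F j) n = 0"
      using g by simp_all
    show "annihilates (bs j) x \<Longrightarrow>
      shift_act (F j) (\<lambda>m. fls_const (x m)) m = fls_const (x m)"
      by (rule g[THEN conjunct2, THEN conjunct2, THEN conjunct1, rule_format])
    show "annihilates (as j) x \<Longrightarrow>
      (\<Sum>s\<le>degree (F j). coeff (F j) s * (y ^ s * fls_const (x (m + int s)))) = 0"
      by (rule g[THEN conjunct2, THEN conjunct2, THEN conjunct2, rule_format])
  qed
  define S where "S = (\<Sum>j\<in>UNIV. degree (F j))"
  have S: "degree (F j) \<le> S" for j unfolding S_def by (rule member_le_sum) simp_all
  have sum_S: "(\<Sum>s\<in>{1..S}. coeff (F j) s * G s) = (\<Sum>s\<le>degree (F j). coeff (F j) s * G s)" for j G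
  proof (rule sum.mono_neutral_cong)
    show "\<And>s. s \<in> {1..S} - {..degree (F j)} \<Longrightarrow> coeff (F j) s * G s = 0" by (simp add: coeff_eq_0)
    \<comment> \<open>As \<open>s0\<close> is at least 1, no \<open>F j\<close> has a constant term,
      so only Cartan elements of positive index are needed.\<close>
    have "coeff (F j) 0 = 0" by (rule F(2)) (simp add: s0_def)
    then show "\<And>s. s \<in> {..degree (F j)} - {1..S} \<Longrightarrow> coeff (F j) s * G s = 0"
      using S[of j] by (auto simp: not_le)
  qed simp_all
  define P where "P = (UNIV :: 'i set) \<times> {1..S}"
  \<comment> \<open>The factor \<open>of_nat s * (q - inverse q)\<close> cancels the denominator of
    \<open>h_scalar\<close>.\<close>
  define t where "t = (\<lambda>(i, s). \<Sum>j\<in>UNIV. coeff (F j) s * fls_const (Binv s j i * (of_nat s * (q - inverse q))))"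
  have t_R: "t p \<in> R" for p
    unfolding t_def by (auto simp: case_prod_unfold intro!: sum_mem mult_mem F const)
  have t_scalar: "(\<Sum>i\<in>UNIV. t (i, s) * fls_const (h_scalar q (bform i j) s)) = coeff (F j) s" if "s > 0" for s j
  proof (cases "s \<ge> s0")
    case True
    have nz: "of_nat s * (q - inverse q) \<noteq> 0" using that not_root_of_unity_simps[OF q] by simp
    have e: "Binv s l i * (of_nat s * (q - inverse q)) * h_scalar q (bform i j) s =
        Binv s l i * (q powi (int s * bform i j) - q powi (- (int s * bform i j)))" for l i
      using nz unfolding h_scalar_def by simp
    have B: "(\<Sum>i\<in>UNIV. Binv s l i * (of_nat s * (q - inverse q)) * h_scalar q (bform i j) s) = (if l = j then 1 else 0)" for l
      unfolding e by (rule Binv[OF True])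
    have "(\<Sum>i\<in>UNIV. t (i, s) * fls_const (h_scalar q (bform i j) s)) =
        (\<Sum>i\<in>UNIV. \<Sum>l\<in>UNIV. coeff (F l) s * fls_const (Binv s l i * (of_nat s * (q - inverse q)) * h_scalar q (bform i j) s))"
      by (simp only: t_def prod.case sum_distrib_right mult.assoc flip: fls_const_mult_const)
    also have "\<dots> = (\<Sum>l\<in>UNIV. coeff (F l) s * fls_const (\<Sum>i\<in>UNIV. Binv s l i * (of_nat s * (q - inverse q)) * h_scalar q (bform i j) s))"
      by (subst sum.swap) (simp only: fls_const_sum sum_distrib_left)
    also have "\<dots> = (\<Sum>l\<in>UNIV. if l = j then coeff (F l) s else 0)"
      by (intro sum.cong) (simp_all add: B)
    finally show ?thesis by simp
  next
    \<comment> \<open>Below \<open>s0\<close> the matrix may be singular and \<open>Binv s\<close>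
      is arbitrary, but there all coefficients of the \<open>F j\<close> vanish.\<close>
    case False
    then show ?thesis using F(2) by (simp add: t_def)
  qed
  have sum_P: "(\<Sum>p\<in>P. G p) = (\<Sum>s\<in>{1..S}. \<Sum>i\<in>UNIV. G (i, s))" for G :: "'i \<times> nat \<Rightarrow> complex fls"
    unfolding P_def by (subst sum.swap) (simp add: sum.cartesian_product)
  \<comment> \<open>The weight \<open>u s\<close> is 1 for the second tensor factor and
    \<open>y ^ s\<close> for the first.\<close>
  have x_sum: "(\<Sum>p\<in>P. (t p * u (snd p)) * fls_const (\<xi> (h_at p * D (GX \<sigma> j m) - D (GX \<sigma> j m) * h_at p) $ k $ l)) =
      of_int (pm_sign \<sigma>) * (\<Sum>s\<le>degree (F j). coeff (F j) s * (u s * fls_const (\<xi> (D (GX \<sigma> j (m + int s))) $ k $ l)))"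
    if \<xi>: "matrix_representation \<xi>" for \<xi> :: "'u \<Rightarrow> complex^'k^'k" and k l \<sigma> j m u
  proof -
    have "(t (i, s) * u s) * fls_const (\<xi> (h_at (i, s) * D (GX \<sigma> j m) - D (GX \<sigma> j m) * h_at (i, s)) $ k $ l) =
        t (i, s) * fls_const (h_scalar q (bform i j) s) *
          (of_int (pm_sign \<sigma>) * (u s * fls_const (\<xi> (D (GX \<sigma> j (m + int s))) $ k $ l)))"
      if "s > 0" for i s
      unfolding h_at_def fst_conv snd_conv h_x_commutator[OF currents that] matrix_representation_simps(4)[OF \<xi>]
        fls_const_mult_const[symmetric] fls_of_int
      by (simp only: mult_ac)
    then have "(\<Sum>p\<in>P. (t p * u (snd p)) * fls_const (\<xi> (h_at p * D (GX \<sigma> j m) - D (GX \<sigma> j m) * h_at p) $ k $ l)) =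
      (\<Sum>s\<in>{1..S}. \<Sum>i\<in>UNIV. t (i, s) * fls_const (h_scalar q (bform i j) s) *
          (of_int (pm_sign \<sigma>) * (u s * fls_const (\<xi> (D (GX \<sigma> j (m + int s))) $ k $ l))))"
      unfolding sum_P snd_conv by (intro sum.cong) simp_all
    also have "\<dots> = (\<Sum>s\<in>{1..S}. coeff (F j) s *
          (of_int (pm_sign \<sigma>) * (u s * fls_const (\<xi> (D (GX \<sigma> j (m + int s))) $ k $ l))))"
      by (intro sum.cong) (simp_all add: t_scalar flip: sum_distrib_right)
    also have "\<dots> = (\<Sum>s\<le>degree (F j). coeff (F j) s *
          (of_int (pm_sign \<sigma>) * (u s * fls_const (\<xi> (D (GX \<sigma> j (m + int s))) $ k $ l))))"
      by (rule sum_S)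
    also have "\<dots> = of_int (pm_sign \<sigma>) * (\<Sum>s\<le>degree (F j). coeff (F j) s * (u s * fls_const (\<xi> (D (GX \<sigma> j (m + int s))) $ k $ l)))"
      by (simp only: sum_distrib_left mult.left_commute)
    finally show ?thesis .
  qed
  have plus_gen: "ad_sum \<psi> P t h_at (D (GX Plus j m)) = const_matrix (\<psi> (D (GX Plus j m)))" for j m
  proof -
    have "(\<Sum>s\<le>degree (F j). coeff (F j) s * fls_const (\<psi> (D (GX Plus j (m + int s))) $ k $ l)) =
        fls_const (\<psi> (D (GX Plus j m)) $ k $ l)" for k l
      using F(3)[OF bs(1)[of j k l], of m] by (simp add: shift_act_def)
    then show ?thesis
      using x_sum[OF \<psi>, of "\<lambda>_. 1" Plus j m]
      by (simp add: vec_eq_iff ad_sum_nth[OF \<psi>] const_matrix_nth)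
  qed
  have minus_gen: "ad_sum \<phi> P (\<lambda>p. t p * y ^ snd p) h_at (D (GX Minus j m)) = 0" for j m
    using F(4)[OF as, of j]
    by (simp add: vec_eq_iff ad_sum_nth[OF \<phi>] x_sum[OF \<phi>, of "\<lambda>s. y ^ s"])
  show ?thesis
    by (rule that[OF t_R _ minus_gen plus_gen]) (auto simp: P_def)
qed

text \<open>Stated for an abstract family \<open>M\<close>, so that both R-matrices can be treated,
  with \<open>y = z\<close> and \<open>y = 1 / z\<close>. For \<open>\<beta> \<noteq> 0\<close> the
  sum of commutators lies in \<open>R\<close> by induction and equals the height times
  \<open>M \<beta>\<close>; the height is a nonzero constant, hence a unit of
  \<open>R\<close>.\<close>

lemma component_regular:
  fixes R :: "complex fls set" and as bs :: "'i \<Rightarrow> complex list"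
    and M :: "('i \<Rightarrow> nat) \<Rightarrow> (complex fls)^('n \<times> 'm)^('n \<times> 'm)"
  assumes R: "subring_of_field R" and const: "\<And>c. fls_const c \<in> R" and y: "y \<in> R" "y \<noteq> 0"
    and as: "\<And>j k l. annihilates (as j) (current \<phi> Minus j k l)"
    and bs: "\<And>j k l. annihilates (bs j) (current \<psi> Plus j k l)"
      "\<And>j. 0 \<notin> set (bs j)"
    and unit: "\<And>j a b. a \<in> set (as j) \<Longrightarrow> b \<in> set (bs j) \<Longrightarrow>
      fls_const b \<noteq> y * fls_const a \<and> inverse (fls_const b - y * fls_const a) \<in> R"
    and M_0: "M (\<lambda>_. 0) = mat 1"
    and M_coeff: "\<And>\<beta> n. \<exists>r\<in>bigraded_part (U_minus D) (U_plus D) D \<beta>. \<forall>k l. fls_nth (M \<beta> $ k $ l) n = \<rho> r $ k $ l"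
    and M_step: "\<And>\<beta> i s k l. s > 0 \<Longrightarrow> (\<And>\<gamma> k l. \<gamma> \<le> \<beta> \<Longrightarrow> \<gamma> \<noteq> \<beta> \<Longrightarrow> M \<gamma> $ k $ l \<in> R) \<Longrightarrow>
      (H_mat y i s ** M \<beta> - M \<beta> ** H_mat y i s) $ k $ l \<in> R"
  shows "M \<beta> $ k $ l \<in> R"
proof -
  interpret subring_of_field R by (rule R)
  obtain P t where Pt: "\<And>p. t p \<in> R" "\<And>p. p \<in> P \<Longrightarrow> snd p > 0"
    "\<And>j m. ad_sum \<phi> P (\<lambda>p. t p * y ^ snd p) h_at (D (GX Minus j m)) = 0"
    "\<And>j m. ad_sum \<psi> P t h_at (D (GX Plus j m)) = const_matrix (\<psi> (D (GX Plus j m)))"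
    by (rule interpolating_combination[OF R const y as bs unit], assumption, assumption, rule that)
  have eigen: "commutator_sum y P t (M \<beta>) $ k $ l = of_nat (\<Sum>i\<in>UNIV. \<beta> i) * M \<beta> $ k $ l" for \<beta> k l
    by (rule commutator_sum_component[OF commutator_sum_bigraded M_coeff])
      (rule ad_sum_U_minus[OF \<phi> Pt(3)] ad_sum_U_plus[OF \<psi> Pt(4)]; assumption)+
  show ?thesis
  proof (induction "\<Sum>i\<in>UNIV. \<beta> i" arbitrary: \<beta> k l rule: less_induct)
    case less
    have IH: "M \<gamma> $ k $ l \<in> R" if "\<gamma> \<le> \<beta>" "\<gamma> \<noteq> \<beta>" for \<gamma> k l
      by (rule less) (rule sum_fun_less[OF that])
    show ?case
    proof (cases "\<beta> = (\<lambda>_. 0)")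
      case True
      then show ?thesis by (simp add: M_0 mat_def one_mem zero_mem)
    next
      case False
      then obtain i where "\<beta> i \<noteq> 0" by auto
      then have nz: "(\<Sum>i\<in>UNIV. \<beta> i) \<noteq> 0" by (simp add: sum_eq_0_iff) blast
      have "commutator_sum y P t (M \<beta>) $ k $ l \<in> R"
        unfolding commutator_sum_def vec_lambda_beta
        by (intro sum_mem mult_mem Pt(1) M_step IH Pt(2))
      then have "fls_const (inverse (of_nat (\<Sum>i\<in>UNIV. \<beta> i))) * (of_nat (\<Sum>i\<in>UNIV. \<beta> i) * M \<beta> $ k $ l) \<in> R"
        unfolding eigen by (rule mult_mem[OF const])
      moreover have "fls_const (inverse (of_nat (\<Sum>i\<in>UNIV. \<beta> i))) * of_nat (\<Sum>i\<in>UNIV. \<beta> i) = (1 :: complex fls)"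
        using nz by (simp only: fls_of_nat fls_const_mult_const) (simp del: of_nat_sum)
      ultimately show ?thesis by (simp only: mult.assoc[symmetric] mult_1_left)
    qed
  qed
qed

end

section \<open>Finiteness of weights and the coproduct\<close>

lemma finite_fun_le:
  fixes \<beta> :: "'i::finite \<Rightarrow> nat"
  shows "finite {\<gamma>. \<gamma> \<le> \<beta>}"
proof (rule finite_subset)
  show "{\<gamma>. \<gamma> \<le> \<beta>} \<subseteq> PiE UNIV (\<lambda>i. {..\<beta> i})" by (auto simp: le_fun_def)
  show "finite (PiE UNIV (\<lambda>i. {..\<beta> i}))" by (rule finite_PiE) simp_all
qed

lemma completed_mult_weight_zero_left: "completed_mult (in_weight_zero X) B \<beta> = X * B \<beta>"
proof -
  have "(\<Sum>\<gamma> | \<gamma> \<le> \<beta>. in_weight_zero X \<gamma> * B (\<lambda>i. \<beta> i - \<gamma> i)) =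
      (\<Sum>\<gamma>\<in>{\<lambda>_. 0}. in_weight_zero X \<gamma> * B (\<lambda>i. \<beta> i - \<gamma> i))"
    by (rule sum.mono_neutral_right[OF finite_fun_le]) (auto simp: in_weight_zero_def le_fun_def)
  then show ?thesis by (simp add: completed_mult_def in_weight_zero_def)
qed

text \<open>This version isolates the component of full weight when it stands in the left factor, as
  in R_minus times the coproduct; the mirror version serves the coproduct times R_plus.\<close>

lemma completed_mult_split_right:
  "completed_mult A B \<beta> = A \<beta> * B (\<lambda>_. 0) + (\<Sum>\<gamma>\<in>{\<gamma>. \<gamma> \<le> \<beta>} - {\<beta>}. A \<gamma> * B (\<lambda>i. \<beta> i - \<gamma> i))"
  unfolding completed_mult_def by (subst sum.remove[OF finite_fun_le, of \<beta>]) simp_all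

lemma completed_mult_split_left:
  "completed_mult A B \<beta> = A (\<lambda>_. 0) * B \<beta> + (\<Sum>\<gamma>\<in>{\<gamma>. \<gamma> \<le> \<beta>} - {\<lambda>_. 0}. A \<gamma> * B (\<lambda>i. \<beta> i - \<gamma> i))"
  unfolding completed_mult_def by (subst sum.remove[OF finite_fun_le, of "\<lambda>_. 0"]) (simp_all add: le_fun_def)

lemma completed_mult_weight_zero_right: "completed_mult A (in_weight_zero X) \<beta> = A \<beta> * X"
proof -
  have "A \<gamma> * in_weight_zero X (\<lambda>i. \<beta> i - \<gamma> i) = 0" if \<gamma>: "\<gamma> \<in> {\<gamma>. \<gamma> \<le> \<beta>} - {\<beta>}" for \<gamma>
  proof -
    obtain i where "\<gamma> i \<noteq> \<beta> i" using \<gamma> by auto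
    moreover have "\<gamma> i \<le> \<beta> i" using \<gamma> by (simp add: le_fun_def)
    ultimately have "(\<lambda>i. \<beta> i - \<gamma> i) i \<noteq> 0" by simp
    then have "(\<lambda>i. \<beta> i - \<gamma> i) \<noteq> (\<lambda>_. 0)" by metis
    then show ?thesis by (simp add: in_weight_zero_def)
  qed
  then show ?thesis unfolding completed_mult_split_right by (simp add: in_weight_zero_def)
qed

lemma diff_fun_le:
  fixes \<beta> \<gamma> :: "'i \<Rightarrow> nat"
  assumes "\<gamma> \<in> {\<gamma>. \<gamma> \<le> \<beta>} - {\<lambda>_. 0}"
  shows "(\<lambda>i. \<beta> i - \<gamma> i) \<le> \<beta>" "(\<lambda>i. \<beta> i - \<gamma> i) \<noteq> \<beta>"
proof -
  show "(\<lambda>i. \<beta> i - \<gamma> i) \<le> \<beta>" by (simp add: le_fun_def)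
  obtain i where "\<gamma> i \<noteq> 0" using assms by auto
  moreover have "\<gamma> i \<le> \<beta> i" using assms by (simp add: le_fun_def)
  ultimately have "(\<lambda>i. \<beta> i - \<gamma> i) i \<noteq> \<beta> i" by simp
  then show "(\<lambda>i. \<beta> i - \<gamma> i) \<noteq> \<beta>" by metis
qed

definition power_series :: "'b::zero fls \<Rightarrow> bool"
  where "power_series f \<longleftrightarrow> (\<forall>n<0. fls_nth f n = 0)"

lemma power_series_mult: "power_series f \<Longrightarrow> power_series g \<Longrightarrow> power_series (f * g)"
  for f g :: "'b::semiring_0 fls"
  by (simp add: power_series_def fls_times_nth_bounds[of 0 f 0 g])

lemma power_series_sum: "(\<And>i. i \<in> S \<Longrightarrow> power_series (f i)) \<Longrightarrow> power_series (sum f S)"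
  by (simp add: power_series_def fls_nth_sum)

lemma monomial_fls_nth: "fls_nth (monomial_fls T s) n = (if n = s then T else 0)"
  by (auto simp: monomial_fls_def fls_X_intpow_times_conv_shift(2))

context drinfeld_algebra
begin

lemma weight_space_conj:
  assumes "a \<in> weight_space D \<kappa>"
  shows "D (GPhi Plus i 0) * a * D (GPhi Minus i 0) = q powi (\<Sum>j\<in>UNIV. bform i j * \<kappa> j) *\<^sub>C a"
  using assms unfolding weight_space_def
proof (induction rule: cvs.span_induct_alt)
  case base
  show ?case by (simp add: scaleC_zero_right)
next
  case (step c x a)
  let ?K = "D (GPhi Plus i 0)" and ?L = "D (GPhi Minus i 0)"
  from step obtain gs where x: "x = prod_list (map D gs)" and gs: "\<forall>i. (\<Sum>g\<leftarrow>gs. gen_weight g i) = \<kappa> i"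
    by blast
  have gen: "?K * D g * ?L = q powi (\<Sum>j\<in>UNIV. bform i j * gen_weight g j) *\<^sub>C D g" for g
  proof (cases g)
    case (GX \<sigma> j n)
    have "(\<Sum>k\<in>UNIV. bform i k * (pm_sign \<sigma> * simple_root j k)) = (\<Sum>k\<in>UNIV. if k = j then pm_sign \<sigma> * bform i j else 0)"
      by (intro sum.cong) (simp_all add: simple_root_def)
    then have "(\<Sum>k\<in>UNIV. bform i k * gen_weight g k) = pm_sign \<sigma> * bform i j"
      by (simp add: GX)
    then show ?thesis
      by (simp only: GX phi_0_x mult_scaleC_left mult.assoc phi_0_inverse mult_1_right)
  next
    case (GPhi \<epsilon> j n)
    have "?K * D g * ?L = D g * (?K * ?L)" by (simp add: GPhi phi_commute[of Plus i 0] mult.assoc)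
    then show ?thesis by (simp add: GPhi phi_0_inverse scaleC_one)
  qed
  have "?K * prod_list (map D gs) * ?L = q powi (\<Sum>j\<in>UNIV. bform i j * (\<Sum>g\<leftarrow>gs. gen_weight g j)) *\<^sub>C prod_list (map D gs)"
    for gs
  proof (induction gs)
    case Nil
    show ?case by (simp add: phi_0_inverse scaleC_one)
  next
    case (Cons g gs)
    have "?K * prod_list (map D (g # gs)) * ?L = ?K * D g * (?L * ?K) * prod_list (map D gs) * ?L"
      by (simp add: phi_0_inverse mult.assoc)
    also have "\<dots> = (?K * D g * ?L) * (?K * prod_list (map D gs) * ?L)" by (simp add: mult.assoc)
    also have "\<dots> = (q powi (\<Sum>j\<in>UNIV. bform i j * gen_weight g j) *
        q powi (\<Sum>j\<in>UNIV. bform i j * (\<Sum>g\<leftarrow>gs. gen_weight g j))) *\<^sub>C prod_list (map D (g # gs))"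
      by (simp only: gen Cons.IH mult_scaleC_left mult_scaleC_right scaleC_scaleC list.map prod_list.Cons mult.commute)
    also have "q powi (\<Sum>j\<in>UNIV. bform i j * gen_weight g j) *
        q powi (\<Sum>j\<in>UNIV. bform i j * (\<Sum>g\<leftarrow>gs. gen_weight g j)) =
        q powi (\<Sum>j\<in>UNIV. bform i j * (\<Sum>g\<leftarrow>g # gs. gen_weight g j))"
      using not_root_of_unity_simps[OF q] by (simp add: distrib_left sum.distrib power_int_add)
    finally show ?case .
  qed
  from this[of gs] have "?K * x * ?L = q powi (\<Sum>j\<in>UNIV. bform i j * \<kappa> j) *\<^sub>C x"
    using gs by (simp add: x)
  then show ?case
    using step.IH by (simp only: distrib_left distrib_right mult_scaleC_left mult_scaleC_right scaleC_add_right)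
      (simp add: scaleC_scaleC mult.commute)
qed

text \<open>A nonzero image of an element of weight \<open>- \<beta>\<close> is an eigenvector for
  conjugation by the image of K_i, with eigenvalue \<open>q\<close> to the power - (\<alpha>_i,
  \<beta>). Each of these operators has finitely many eigenvalues, the powers of \<open>q\<close>
  are distinct, and the pairings with all simple roots determine \<open>\<beta>\<close>.\<close>

lemma finite_weights:
  fixes \<xi> :: "'u \<Rightarrow> complex^'k^'k"
  assumes datum: "simple_cartan_datum C d" and \<xi>: "matrix_representation \<xi>"
  shows "finite {\<beta> :: 'i \<Rightarrow> nat. \<exists>a\<in>weight_space D (\<lambda>i. - int (\<beta> i)). \<xi> a \<noteq> 0}"
proof -
  note \<xi>_simps = matrix_representation_simps[OF \<xi>]
  define f where "f = (\<lambda>(\<beta> :: 'i \<Rightarrow> nat) i. \<Sum>j\<in>UNIV. bform i j * int (\<beta> j))"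
  define W where "W = {\<beta> :: 'i \<Rightarrow> nat. \<exists>a\<in>weight_space D (\<lambda>i. - int (\<beta> i)). \<xi> a \<noteq> 0}"
  have "\<exists>S. finite S \<and> (\<forall>\<beta>\<in>W. f \<beta> i \<in> S)" for i
  proof -
    define A where "A X = \<xi> (D (GPhi Plus i 0)) ** X ** \<xi> (D (GPhi Minus i 0))" for X
    have A_add: "A (X + Y) = A X + A Y" for X Y
      by (simp add: A_def vec_eq_iff matrix_matrix_mult_def distrib_left distrib_right sum.distrib)
    have A_scale: "A (\<chi> k l. z * X $ k $ l) = (\<chi> k l. z * A X $ k $ l)" for z X
      by (simp add: A_def vec_eq_iff matrix_matrix_mult_def sum_distrib_left sum_distrib_right mult_ac)
    obtain p :: "complex poly" where p: "p \<noteq> 0" "\<And>x a b. (\<Sum>k\<le>degree p. coeff p k * (A ^^ k) x $ a $ b) = 0"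
      using linear_operator_annihilator[OF A_add A_scale] by blast
    have "q powi (- f \<beta> i) \<in> {z. poly p z = 0}" if \<beta>: "\<beta> \<in> W" for \<beta>
    proof -
      obtain a where a: "a \<in> weight_space D (\<lambda>i. - int (\<beta> i))" "\<xi> a \<noteq> 0" using \<beta> by (auto simp: W_def)
      let ?z = "q powi (- f \<beta> i)"
      have "A (\<xi> a) = \<xi> (D (GPhi Plus i 0) * a * D (GPhi Minus i 0))" by (simp add: A_def \<xi>_simps(3))
      also have "\<dots> = (\<chi> k l. ?z * \<xi> a $ k $ l)"
        by (simp only: weight_space_conj[OF a(1)] \<xi>_simps(7)) (simp add: f_def sum_negf)
      finally have eig: "A (\<xi> a) = (\<chi> k l. ?z * \<xi> a $ k $ l)" .
      have pow: "(A ^^ k) (\<xi> a) = (\<chi> m l. ?z ^ k * \<xi> a $ m $ l)" for k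
      proof (induction k)
        case (Suc k)
        then show ?case
          by (simp only: funpow.simps o_apply A_scale eig) (simp add: vec_eq_iff mult_ac)
      qed (simp add: vec_eq_iff)
      obtain m l where ml: "\<xi> a $ m $ l \<noteq> 0" using a(2) by (auto simp: vec_eq_iff)
      have "poly p ?z * \<xi> a $ m $ l = (\<Sum>k\<le>degree p. coeff p k * (A ^^ k) (\<xi> a) $ m $ l)"
        by (simp add: poly_altdef pow sum_distrib_right mult.assoc)
      then show ?thesis using p(2) ml by simp
    qed
    moreover have "finite ((\<lambda>n. q powi (- n)) -` {z. poly p z = 0})"
    proof (rule finite_vimageI[OF poly_roots_finite[OF p(1)]])
      show "inj (\<lambda>n. q powi (- n))"
      proof (rule injI)
        fix m n assume "q powi (- m) = q powi (- n)"
        then have "- m = - n" by (rule injD[OF not_root_of_unity_powi_inj[OF q]])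
        then show "m = n" by simp
      qed
    qed
    ultimately show ?thesis by (intro exI[of _ "(\<lambda>n. q powi (- n)) -` {z. poly p z = 0}"]) auto
  qed
  then obtain S where S: "\<And>i. finite (S i)" "\<And>i \<beta>. \<beta> \<in> W \<Longrightarrow> f \<beta> i \<in> S i" by metis
  have "f ` W \<subseteq> PiE UNIV S" using S(2) by auto
  then have "finite (f ` W)" by (rule finite_subset) (simp add: finite_PiE S(1))
  moreover have "inj f" unfolding f_def by (rule simple_cartan_datum_form_inj[OF datum])
  then have "inj_on f W" by (rule inj_on_subset) simp
  ultimately have "finite W" by (rule finite_imageD)
  then show ?thesis by (simp add: W_def)
qed

end

context evaluation
begin

definition component :: "(('i \<Rightarrow> nat) \<Rightarrow> ('u, 'u) tensor fps) \<Rightarrow> ('i \<Rightarrow> nat) \<Rightarrow> (complex fls)^('n \<times> 'm)^('n \<times> 'm)"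
  where "component R \<beta> = \<rho>_fls (fps_to_fls (R \<beta>))"

lemma component_0:
  assumes "unitriangular D R"
  shows "component R (\<lambda>_. 0) = mat 1"
proof -
  have "R (\<lambda>_. 0) = 1" using assms by (simp add: unitriangular_def)
  then show ?thesis by (auto simp: component_def vec_eq_iff fls_eq_iff \<rho>_fls_nth \<rho>_one \<rho>_zero mat_def)
qed

lemma component_coeff:
  assumes "unitriangular D R"
  shows "\<exists>r\<in>bigraded_part (U_minus D) (U_plus D) D \<beta>. \<forall>k l. fls_nth (component R \<beta> $ k $ l) n = \<rho> r $ k $ l"
proof (cases "n < 0")
  case True
  have "0 \<in> bigraded_part (U_minus D) (U_plus D) D \<beta>"
    by (simp add: bigraded_part_def tensor_subspace_def cvs.span_zero)
  then show ?thesis using True by (intro bexI[of _ 0]) (simp_all add: component_def \<rho>_fls_nth)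
next
  case False
  have "fps_nth (R \<beta>) (nat n) \<in> bigraded_part (U_minus D) (U_plus D) D \<beta>"
    using assms by (simp add: unitriangular_def)
  then show ?thesis using False by (intro bexI[of _ "fps_nth (R \<beta>) (nat n)"]) (simp_all add: component_def \<rho>_fls_nth)
qed

lemma finite_support:
  assumes "unitriangular D R"
  shows "finite {\<beta>. \<exists>n. \<rho> (fps_nth (R \<beta>) n) \<noteq> 0}"
proof (rule finite_subset[OF _ finite_weights[OF datum \<phi>]])
  show "{\<beta>. \<exists>n. \<rho> (fps_nth (R \<beta>) n) \<noteq> 0} \<subseteq> {\<beta>. \<exists>a\<in>weight_space D (\<lambda>i. - int (\<beta> i)). \<phi> a \<noteq> 0}"
  proof (rule subsetI, rule ccontr)
    fix \<beta> assume "\<beta> \<in> {\<beta>. \<exists>n. \<rho> (fps_nth (R \<beta>) n) \<noteq> 0}"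
      and "\<beta> \<notin> {\<beta>. \<exists>a\<in>weight_space D (\<lambda>i. - int (\<beta> i)). \<phi> a \<noteq> 0}"
    then obtain n where n: "\<rho> (fps_nth (R \<beta>) n) \<noteq> 0"
      and 0: "\<And>a. a \<in> weight_space D (\<lambda>i. - int (\<beta> i)) \<Longrightarrow> \<phi> a = 0" by blast
    have "fps_nth (R \<beta>) n \<in> bigraded_part (U_minus D) (U_plus D) D \<beta>"
      using assms by (simp add: unitriangular_def)
    then have "\<rho> (fps_nth (R \<beta>) n) = 0"
      unfolding bigraded_part_def tensor_subspace_def
    proof (induction rule: cvs.span_induct_alt)
      case base
      show ?case by (rule \<rho>_zero)
    next
      case (step c x z)
      then obtain a b where x: "x = a \<otimes>\<^sub>C b" "a \<in> weight_space D (\<lambda>i. - int (\<beta> i))" by blast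
      have "\<rho> (c *\<^sub>C x) = 0" by (simp add: vec_eq_iff \<rho>_scale x(1) \<rho>_pure kronecker_nth 0[OF x(2)])
      then show ?case by (simp add: \<rho>_add step.IH)
    qed
    with n show False by simp
  qed
qed

text \<open>The range of summation in \<open>evaluate_R\<close> depends on \<open>n\<close>; it is
  enlarged to a finite set common to all \<open>n\<close>, so that the evaluated series is a finite
  sum of components.\<close>

lemma entry_series_evaluate_R:
  assumes "unitriangular D R"
  shows "entry_series (evaluate_R \<phi> \<psi> R) k l = (\<Sum>\<beta> | \<exists>n. \<rho> (fps_nth (R \<beta>) n) \<noteq> 0. component R \<beta> $ k $ l)"
proof (rule fls_eqI)
  fix n
  let ?S = "{\<beta>. \<exists>n. \<rho> (fps_nth (R \<beta>) n) \<noteq> 0}"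
  have "(\<Sum>\<beta> | \<rho> (fps_nth (R \<beta>) n) \<noteq> 0. \<rho> (fps_nth (R \<beta>) n)) = (\<Sum>\<beta>\<in>?S. \<rho> (fps_nth (R \<beta>) n))" for n
    by (rule sum.mono_neutral_left[OF finite_support[OF assms]]) auto
  then show "fls_nth (entry_series (evaluate_R \<phi> \<psi> R) k l) n = fls_nth (\<Sum>\<beta>\<in>?S. component R \<beta> $ k $ l) n"
    by (simp add: entry_series_def evaluate_R_def component_def fls_nth_sum \<rho>_fls_nth sum_component \<rho>_zero)
qed

lemma H_mat_eq:
  "\<rho>_fls (monomial_fls (h i (int s) \<otimes>\<^sub>C 1) (int s) + monomial_fls (1 \<otimes>\<^sub>C h i (int s)) 0) = H_mat fls_X i s"
  "\<rho>_fls (monomial_fls (h i (int s) \<otimes>\<^sub>C 1) (- int s) + monomial_fls (1 \<otimes>\<^sub>C h i (int s)) 0) = H_mat fls_X_inv i s"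
  by (auto simp: vec_eq_iff fls_eq_iff H_mat_def \<rho>_fls_nth monomial_fls_nth \<rho>_add \<rho>_zero \<rho>_pure
      fls_X_power_nth fls_X_inv_power_nth mult.commute[of _ "fls_const _"])

text \<open>Weight 0 of the relation identifies \<open>T\<close> there with the Cartan element,
  whose product with the component of weight \<open>\<beta>\<close> completes the commutator; all
  other terms involve smaller weights.\<close>

lemma commutator_R_minus:
  fixes i :: 'i and \<beta> :: "'i \<Rightarrow> nat"
  assumes R: "unitriangular_R_matrices D \<Delta> h R_minus R_plus" and s: "s > 0"
  defines "T \<equiv> tau_left D 1 (\<Delta> (h i (int s)))"
  shows "H_mat fls_X i s ** component R_minus \<beta> - component R_minus \<beta> ** H_mat fls_X i s =
    (\<Sum>\<gamma>\<in>{\<gamma>. \<gamma> \<le> \<beta>} - {\<beta>}. component R_minus \<gamma> ** \<rho>_fls (T (\<lambda>i. \<beta> i - \<gamma> i)))"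
    and "power_series (T \<beta>)"
proof -
  let ?Rm = "\<lambda>\<beta>. fps_to_fls (R_minus \<beta>)"
  let ?X = "monomial_fls (h i (int s) \<otimes>\<^sub>C 1) (int s) + monomial_fls (1 \<otimes>\<^sub>C h i (int s)) 0"
  have one: "R_minus (\<lambda>_. 0) = 1" using R by (simp add: unitriangular_R_matrices_def unitriangular_def)
  have "completed_mult (in_weight_zero ?X) ?Rm = completed_mult ?Rm T"
    using R s unfolding unitriangular_R_matrices_def T_def Let_def by simp
  then have rel: "?X * ?Rm \<beta> = completed_mult ?Rm T \<beta>" for \<beta>
    by (metis completed_mult_weight_zero_left)
  have none: "{\<gamma>. \<gamma> \<le> (\<lambda>_::'i. 0::nat)} - {\<lambda>_. 0} = {}" by (auto simp: le_fun_def)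
  then have T0: "T (\<lambda>_. 0) = ?X"
    using rel[of "\<lambda>_. 0"] unfolding completed_mult_split_left none by (simp add: one)
  have "\<rho>_fls ?X ** component R_minus \<beta> = component R_minus \<beta> ** \<rho>_fls ?X +
      (\<Sum>\<gamma>\<in>{\<gamma>. \<gamma> \<le> \<beta>} - {\<beta>}. component R_minus \<gamma> ** \<rho>_fls (T (\<lambda>i. \<beta> i - \<gamma> i)))"
    using arg_cong[OF rel[of \<beta>], of \<rho>_fls] unfolding completed_mult_split_right T0
    by (simp only: \<rho>_fls_mult \<rho>_fls_add[of "_ * _"] \<rho>_fls_sum component_def)
  then show "H_mat fls_X i s ** component R_minus \<beta> - component R_minus \<beta> ** H_mat fls_X i s =
    (\<Sum>\<gamma>\<in>{\<gamma>. \<gamma> \<le> \<beta>} - {\<beta>}. component R_minus \<gamma> ** \<rho>_fls (T (\<lambda>i. \<beta> i - \<gamma> i)))"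
    by (simp only: H_mat_eq add_diff_cancel_left')
  show "power_series (T \<beta>)"
  proof (induction "\<Sum>i\<in>UNIV. \<beta> i" arbitrary: \<beta> rule: less_induct)
    case less
    \<comment> \<open>The same relation solved for \<open>T \<beta>\<close>: \<open>R_minus\<close>
      is 1 in weight 0, the sum contains \<open>T\<close> only at smaller weights, and the exponents
      \<open>s\<close> and 0 of \<open>?X\<close> are not negative.\<close>
    have "T \<beta> = ?X * ?Rm \<beta> - (\<Sum>\<gamma>\<in>{\<gamma>. \<gamma> \<le> \<beta>} - {\<lambda>_. 0}. ?Rm \<gamma> * T (\<lambda>i. \<beta> i - \<gamma> i))"
      using rel[of \<beta>] unfolding completed_mult_split_left by (simp add: one)
    moreover have "power_series (?Rm \<gamma>)" for \<gamma> by (simp add: power_series_def)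
    moreover have "power_series ?X" by (simp add: power_series_def monomial_fls_nth)
    moreover have "power_series (T (\<lambda>i. \<beta> i - \<gamma> i))" if "\<gamma> \<in> {\<gamma>. \<gamma> \<le> \<beta>} - {\<lambda>_. 0}" for \<gamma>
      by (rule less) (rule sum_fun_less[OF diff_fun_le[OF that]])
    ultimately have "power_series (?X * ?Rm \<beta>)"
      "power_series (\<Sum>\<gamma>\<in>{\<gamma>. \<gamma> \<le> \<beta>} - {\<lambda>_. 0}. ?Rm \<gamma> * T (\<lambda>i. \<beta> i - \<gamma> i))"
      by (auto intro!: power_series_mult power_series_sum)
    then show ?case
      unfolding \<open>T \<beta> = _\<close> by (simp add: power_series_def)
  qed
qed

text \<open>Of the two relations for \<open>R_plus\<close>, the one with inverse twist on the first
  factor is used: its Cartan element is \<open>H_mat\<close> with y = 1 / z, so the scheme for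
  \<open>R_minus\<close> applies again.\<close>

lemma commutator_R_plus:
  fixes i :: 'i and \<beta> :: "'i \<Rightarrow> nat"
  assumes R: "unitriangular_R_matrices D \<Delta> h R_minus R_plus" and s: "s > 0"
  defines "T \<equiv> tau_left D (-1) (\<Delta> (h i (int s)))"
  shows "H_mat fls_X_inv i s ** component R_plus \<beta> - component R_plus \<beta> ** H_mat fls_X_inv i s =
    - (\<Sum>\<gamma>\<in>{\<gamma>. \<gamma> \<le> \<beta>} - {\<lambda>_. 0}. \<rho>_fls (T \<gamma>) ** component R_plus (\<lambda>i. \<beta> i - \<gamma> i))"
proof -
  let ?Rp = "\<lambda>\<beta>. fps_to_fls (R_plus \<beta>)"
  let ?X = "monomial_fls (h i (int s) \<otimes>\<^sub>C 1) (- int s) + monomial_fls (1 \<otimes>\<^sub>C h i (int s)) 0"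
  have one: "R_plus (\<lambda>_. 0) = 1" using R by (simp add: unitriangular_R_matrices_def unitriangular_def)
  have "completed_mult ?Rp (in_weight_zero ?X) = completed_mult T ?Rp"
    using R s unfolding unitriangular_R_matrices_def T_def Let_def by simp
  then have rel: "?Rp \<beta> * ?X = completed_mult T ?Rp \<beta>" for \<beta>
    by (metis completed_mult_weight_zero_right)
  have none: "{\<gamma>. \<gamma> \<le> (\<lambda>_::'i. 0::nat)} - {\<lambda>_. 0} = {}" by (auto simp: le_fun_def)
  then have T0: "T (\<lambda>_. 0) = ?X"
    using rel[of "\<lambda>_. 0"] unfolding completed_mult_split_left none by (simp add: one)
  have "component R_plus \<beta> ** \<rho>_fls ?X = \<rho>_fls ?X ** component R_plus \<beta> +
      (\<Sum>\<gamma>\<in>{\<gamma>. \<gamma> \<le> \<beta>} - {\<lambda>_. 0}. \<rho>_fls (T \<gamma>) ** component R_plus (\<lambda>i. \<beta> i - \<gamma> i))"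
    using arg_cong[OF rel[of \<beta>], of \<rho>_fls] unfolding completed_mult_split_left T0
    by (simp only: \<rho>_fls_mult \<rho>_fls_add[of "_ * _"] \<rho>_fls_sum component_def)
  then show ?thesis
    by (simp only: H_mat_eq) simp
qed

text \<open>
  \<open>\<Delta> (h i s)\<close> with \<open>s > 0\<close> has no component of negative degree in the first tensor factor, by the
  relation for \<open>R_minus\<close>. For \<open>R_plus\<close> this excludes positive powers of \<open>z\<close>, and hence a pole at
  \<open>z = \<infinity>\<close>.
\<close>

lemma tau_left_regular:
  assumes R: "unitriangular_R_matrices D \<Delta> h R_minus R_plus" and s: "s > 0"
  shows "\<rho>_fls (tau_left D 1 (\<Delta> (h i (int s))) \<beta>) $ k $ l \<in> regular_at fls_X w"
    and "\<rho>_fls (tau_left D (-1) (\<Delta> (h i (int s))) \<beta>) $ k $ l \<in> regular_at fls_X_inv w"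
proof -
  obtain K :: "int \<Rightarrow> ('u, 'u) tensor" where K: "finite {n. K n \<noteq> 0}"
    "\<And>n. fls_nth (tau_left D 1 (\<Delta> (h i (int s))) \<beta>) n = K n"
    "\<And>n. fls_nth (tau_left D (-1) (\<Delta> (h i (int s))) \<beta>) n = K (- n)"
    by (rule tau_left_nth[OF presented], rule that)
  have neg: "K n = 0" if "n < 0" for n
    using commutator_R_minus(2)[OF R s, of i \<beta>] that by (simp add: power_series_def K(2))
  have fin: "finite {n. \<rho> (K n) $ k $ l \<noteq> 0}"
    by (rule finite_subset[OF _ K(1)]) (auto simp: \<rho>_zero)
  show "\<rho>_fls (tau_left D 1 (\<Delta> (h i (int s))) \<beta>) $ k $ l \<in> regular_at fls_X w"
    using fin neg by (intro laurent_polynomial_regular) (simp_all add: \<rho>_fls_nth K(2) \<rho>_zero)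
  have "finite (uminus -` {n. \<rho> (K n) $ k $ l \<noteq> 0})" by (rule finite_vimageI[OF fin]) (simp add: inj_def)
  then show "\<rho>_fls (tau_left D (-1) (\<Delta> (h i (int s))) \<beta>) $ k $ l \<in> regular_at fls_X_inv w"
    using neg by (intro laurent_polynomial_regular) (simp_all add: \<rho>_fls_nth K(3) \<rho>_zero vimage_def)
qed

lemma evaluate_R_regular:
  fixes as bs :: "'i \<Rightarrow> complex list"
  assumes R: "unitriangular_R_matrices D \<Delta> h R_minus R_plus"
    and as: "\<And>j k l. annihilates (as j) (current \<phi> Minus j k l)"
    and bs: "\<And>j k l. annihilates (bs j) (current \<psi> Plus j k l)"
      "\<And>j. 0 \<notin> set (bs j)"
    and w: "\<And>j a b. a \<in> set (as j) \<Longrightarrow> b \<in> set (bs j) \<Longrightarrow> b \<noteq> w * a"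
  shows "entry_series (evaluate_R \<phi> \<psi> R_minus) k l \<in> regular_at fls_X w"
    and "entry_series (evaluate_R \<phi> \<psi> R_plus) k l \<in> regular_at fls_X_inv w"
proof -
  have uni: "unitriangular D R_minus" "unitriangular D R_plus"
    using R by (simp_all add: unitriangular_R_matrices_def)
  have unit: "fls_const b \<noteq> y * fls_const a \<and> inverse (fls_const b - y * fls_const a) \<in> regular_at y w"
    if "y = fls_X \<or> y = fls_X_inv" "a \<in> set (as j)" "b \<in> set (bs j)" for y a b j
  proof -
    \<comment> \<open>The difference \<open>fls_const b - y * fls_const a\<close> is this polynomial
      evaluated at \<open>y\<close>; it is a unit at \<open>w\<close> as soon as
      \<open>b \<noteq> w * a\<close>.\<close>
    have r: "poly [:b, - a:] w \<noteq> 0" using w[OF that(2,3)] by simp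
    then have nz: "[:b, - a:] \<noteq> 0" by (intro notI) (simp only: poly_0 simp_thms)
    have "ev y [:b, - a:] \<noteq> 0"
    proof (cases "y = fls_X")
      case True
      then show ?thesis using nz ev_X_inj[of "[:b, - a:]" 0] by (simp only: ev_0 simp_thms)
    next
      case False
      then show ?thesis using that(1) nz ev_X_inv_eq_0[of "[:b, - a:]"] by (simp only: simp_thms)
    qed
    moreover have "ev y [:b, - a:] = fls_const b - y * fls_const a"
      by (simp add: ev_pCons ev_0 fls_const_uminus)
    ultimately show ?thesis using regular_at_inverse_ev[OF r, of y] by auto
  qed
  show "entry_series (evaluate_R \<phi> \<psi> R_minus) k l \<in> regular_at fls_X w"
    unfolding entry_series_evaluate_R[OF uni(1)]
  proof (rule subring_of_field.sum_mem[OF regular_at_subring])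
    interpret subring_of_field "regular_at fls_X w" by (rule regular_at_subring)
    fix \<beta>
    show "component R_minus \<beta> $ k $ l \<in> regular_at fls_X w"
    proof (rule component_regular[OF regular_at_subring regular_at_const regular_at_var _ as bs unit])
      fix \<beta> i s k l
      assume s: "(s::nat) > 0" and IH: "\<And>\<gamma> k l. \<gamma> \<le> \<beta> \<Longrightarrow> \<gamma> \<noteq> \<beta> \<Longrightarrow> component R_minus \<gamma> $ k $ l \<in> regular_at fls_X w"
      show "(H_mat fls_X i s ** component R_minus \<beta> - component R_minus \<beta> ** H_mat fls_X i s) $ k $ l \<in> regular_at fls_X w"
        by (subst commutator_R_minus(1)[OF R s], unfold sum_component matrix_matrix_mult_def vec_lambda_beta, intro sum_mem mult_mem IH tau_left_regular(1)[OF R s]) auto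
    qed (use component_0 component_coeff uni in auto)
  qed
  show "entry_series (evaluate_R \<phi> \<psi> R_plus) k l \<in> regular_at fls_X_inv w"
    unfolding entry_series_evaluate_R[OF uni(2)]
  proof (rule subring_of_field.sum_mem[OF regular_at_subring])
    interpret subring_of_field "regular_at fls_X_inv w" by (rule regular_at_subring)
    fix \<beta>
    show "component R_plus \<beta> $ k $ l \<in> regular_at fls_X_inv w"
    proof (rule component_regular[OF regular_at_subring regular_at_const regular_at_var _ as bs unit])
      fix \<beta> i s k l
      assume s: "(s::nat) > 0" and IH: "\<And>\<gamma> k l. \<gamma> \<le> \<beta> \<Longrightarrow> \<gamma> \<noteq> \<beta> \<Longrightarrow> component R_plus \<gamma> $ k $ l \<in> regular_at fls_X_inv w"
      show "(H_mat fls_X_inv i s ** component R_plus \<beta> - component R_plus \<beta> ** H_mat fls_X_inv i s) $ k $ l \<in> regular_at fls_X_inv w"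
        by (subst commutator_R_plus[OF R s],
          unfold vector_uminus_component sum_component matrix_matrix_mult_def vec_lambda_beta, intro uminus_mem sum_mem mult_mem IH tau_left_regular(2)[OF R s] diff_fun_le)
    qed (use component_0 component_coeff uni in auto)
  qed
qed

end

theorem proposition3p6:
  fixes C :: "'i::finite \<Rightarrow> 'i \<Rightarrow> int" and d \<theta> :: "'i \<Rightarrow> int" and q :: complex
    and J :: "'i option jimbo_gen \<Rightarrow> 'u::complex_algebra_1" and D :: "'i drinfeld_gen \<Rightarrow> 'u"
    and \<Delta> :: "'u \<Rightarrow> ('u, 'u) tensor" and h :: "'i \<Rightarrow> int \<Rightarrow> 'u"
    and R_minus R_plus :: "('i \<Rightarrow> nat) \<Rightarrow> ('u, 'u) tensor fps"
    and \<phi> :: "'u \<Rightarrow> complex^'n^'n" and \<psi> :: "'u \<Rightarrow> complex^'m^'m"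
  assumes "simple_cartan_datum C d"
    and "is_highest_root C \<theta>"
    and "not_root_of_unity q"
    and "quantum_affine_algebra C d \<theta> q J D"
    and "is_coproduct J \<Delta>"
    and "cartan_currents q D h"
    and "unitriangular_R_matrices D \<Delta> h R_minus R_plus"
    and "matrix_representation \<phi>"
    and "matrix_representation \<psi>"
  shows "\<exists>\<rho>_minus \<rho>_plus.
    rational_with_taylor_expansion \<rho>_minus (evaluate_R \<phi> \<psi> R_minus) \<and>
    rational_with_taylor_expansion \<rho>_plus (evaluate_R \<phi> \<psi> R_plus) \<and>
    (\<forall>a. is_pole \<rho>_minus a \<or> is_pole (\<lambda>z. \<rho>_plus (inverse z)) a \<longrightarrow>
      (\<exists>i b c. pole_of_expansion (x_minus_positive_part D \<phi> i) b \<and>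
               pole_of_expansion (x_plus_nonnegative_part D \<psi> i) c \<and> a = b / c))"
proof -
  interpret evaluation C d q D \<phi> \<psi> h
    using assms by unfold_locales (simp_all add: quantum_affine_algebra_def)
  have "\<exists>as. (\<forall>k l. annihilates as (current \<phi> Minus j k l)) \<and> 0 \<notin> set as \<and>
    (\<forall>a\<in>set as. pole_of_expansion (x_minus_positive_part D \<phi> j) (inverse a))" for j
  proof (rule current_roots[OF datum currents \<phi>, of Minus j])
    fix as
    assume as: "\<And>k l. annihilates as (current \<phi> Minus j k l)" "0 \<notin> set as"
      "\<And>a. a \<in> set as \<Longrightarrow> \<exists>k l. geometric_root (current \<phi> Minus j k l) a"
    have "pole_of_expansion (x_minus_positive_part D \<phi> j) (inverse a)" if "a \<in> set as" for a
      by (rule x_minus_pole[OF as(1) _ as(3)[OF that]]) (use as(2) that in auto)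
    then show ?thesis using as(1,2) by (intro exI[of _ as]) simp
  qed
  then obtain as where as: "\<And>j k l. annihilates (as j) (current \<phi> Minus j k l)"
    "\<And>j. 0 \<notin> set (as j)" "\<And>j a. a \<in> set (as j) \<Longrightarrow> pole_of_expansion (x_minus_positive_part D \<phi> j) (inverse a)"
    by metis
  have "\<exists>bs. (\<forall>k l. annihilates bs (current \<psi> Plus j k l)) \<and> 0 \<notin> set bs \<and>
    (\<forall>a\<in>set bs. pole_of_expansion (x_plus_nonnegative_part D \<psi> j) (inverse a))" for j
  proof (rule current_roots[OF datum currents \<psi>, of Plus j])
    fix bs
    assume bs: "\<And>k l. annihilates bs (current \<psi> Plus j k l)" "0 \<notin> set bs"
      "\<And>a. a \<in> set bs \<Longrightarrow> \<exists>k l. geometric_root (current \<psi> Plus j k l) a"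
    have "pole_of_expansion (x_plus_nonnegative_part D \<psi> j) (inverse a)" if "a \<in> set bs" for a
      by (rule x_plus_pole[OF bs(1) _ bs(3)[OF that]]) (use bs(2) that in auto)
    then show ?thesis using bs(1,2) by (intro exI[of _ bs]) simp
  qed
  then obtain bs where bs: "\<And>j k l. annihilates (bs j) (current \<psi> Plus j k l)"
    "\<And>j. 0 \<notin> set (bs j)" "\<And>j a. a \<in> set (bs j) \<Longrightarrow> pole_of_expansion (x_plus_nonnegative_part D \<psi> j) (inverse a)"
    by metis
  \<comment> \<open>The ratios b / a of characteristic roots of one node. Poles are inverses of
    roots, so b / a is the pole 1 / a divided by the pole 1 / b.\<close>
  define Bad where "Bad = {w. \<exists>j a b. a \<in> set (as j) \<and> b \<in> set (bs j) \<and> b = w * a}"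
  have "0 \<notin> Bad" using bs(2) by (auto simp: Bad_def)
  have regular: "entry_series (evaluate_R \<phi> \<psi> R_minus) k l \<in> regular_at fls_X w"
    "entry_series (evaluate_R \<phi> \<psi> R_plus) k l \<in> regular_at fls_X_inv w" if "w \<notin> Bad" for k l w
    using that by (auto intro!: evaluate_R_regular[OF assms(7) as(1) bs(1,2)] simp: Bad_def)
  obtain \<rho>_minus where minus: "rational_with_taylor_expansion \<rho>_minus (evaluate_R \<phi> \<psi> R_minus)"
    "\<And>w. is_pole (\<lambda>z. \<rho>_minus (var_fun fls_X z)) w \<Longrightarrow> w \<in> Bad"
    by (rule rational_matrix_not_pole[OF disjI1[OF HOL.refl] regular(1) \<open>0 \<notin> Bad\<close>], assumption, rule that)
  \<comment> \<open>The coordinate is y = 1 / z here, so poles are controlled for the function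
    precomposed with inversion.\<close>
  obtain \<rho>_plus where plus: "rational_with_taylor_expansion \<rho>_plus (evaluate_R \<phi> \<psi> R_plus)"
    "\<And>w. is_pole (\<lambda>z. \<rho>_plus (var_fun fls_X_inv z)) w \<Longrightarrow> w \<in> Bad"
    by (rule rational_matrix_not_pole[OF disjI2[OF HOL.refl] regular(2) \<open>0 \<notin> Bad\<close>], assumption, rule that)
  have ratio: "\<exists>i b c. pole_of_expansion (x_minus_positive_part D \<phi> i) b \<and>
      pole_of_expansion (x_plus_nonnegative_part D \<psi> i) c \<and> w = b / c" if "w \<in> Bad" for w
  proof -
    from that obtain j a b where ab: "a \<in> set (as j)" "b \<in> set (bs j)" "b = w * a"
      by (auto simp: Bad_def)
    have "a \<noteq> 0" using as(2) ab(1) by metis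
    then have "w = inverse a / inverse b" by (simp add: ab(3) field_simps)
    with as(3)[OF ab(1)] bs(3)[OF ab(2)] show ?thesis by blast
  qed
  show ?thesis
  proof (rule exI[of _ \<rho>_minus], rule exI[of _ \<rho>_plus], intro conjI allI impI)
    fix w assume "is_pole \<rho>_minus w \<or> is_pole (\<lambda>z. \<rho>_plus (inverse z)) w"
    then have "w \<in> Bad"
      using minus(2)[of w] plus(2)[of w] by (auto simp: var_fun_def fls_X_neq_X_inv)
    then show "\<exists>i b c. pole_of_expansion (x_minus_positive_part D \<phi> i) b \<and>
      pole_of_expansion (x_plus_nonnegative_part D \<psi> i) c \<and> w = b / c" by (rule ratio)
  qed (rule minus(1) plus(1))+
qed

end
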